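(* Let $G$ be a connected compact semisimple Lie group, $K$ a closed subgroup, and let $g_0$ be an inner product on $\mathfrak m$ invariant under the $\mathrm{Ad}$-action of $K$, with associated operator $S$ on $\mathfrak m$ determined by $g_0(X,Y)=\mathrm{Kil}(SX,Y)$ for all $X,Y\in\mathfrak m$. Then the Levi--Civita connection $\nabla^0$ for the Riemannian metric $g_0$ on $G/K$ is $\nabla^0=\nabla^{ct}+L^S$, where for $V,W\in\mathcal T(G/K)$ and $x\in G$ $$(L^S_VW)(x)=\tfrac12 S^{-1}P\big([V(x),SW(x)]+[W(x),SV(x)]\big).$$
   Context: $G$ has Lie algebra $\mathfrak g$; $\mathrm{Kil}$ denotes the negative of the Killing form of $\mathfrak g$ (positive-definite). $\mathfrak k$ is the Lie algebra of the closed subgroup $K$ (not assumed connected), $\mathfrak m=\mathfrak k^\perp$ with respect to $\mathrm{Kil}$, and $P$ is the projection of $\mathfrak g$ onto $\mathfrak m$ along $\mathfrak k$. The operator $S$ is positive (for $\mathrm{Kil}$) and invertible and commutes with the $\mathrm{Ad}$-action of $K$ on $\mathfrak m$. $A=C^\infty(G/K,\mathbb R)$, viewed as a subalgebra of $C^\infty(G,\mathbb R)$. The module of tangent vector fields is $\mathcal T(G/K)=\{V\in C^\infty(G,\mathfrak m): V(xs)=\mathrm{Ad}_s^{-1}(V(x)) \text{ for } x\in G, s\in K\}$, an $A$-module for the pointwise product; $V\in\mathcal T(G/K)$ acts on $A$ as the derivation $(\delta_Vf)(x)=\frac{d}{dt}\big|_{t=0} f(x\exp(tV(x)))$. The bracket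 $[V,W]$ of vector fields is the one corresponding to the commutator of the derivations $\delta_V,\delta_W$, and Levi--Civita connection means the unique torsion-free connection on $\mathcal T(G/K)$ compatible with the metric. The inner product $g_0$ defines a $G$-invariant Riemannian metric, also denoted $g_0$, by $(g_0(V,W))(x)=g_0(V(x),W(x))$. The canonical connection is $(\nabla^c_VW)(x)=\frac{d}{dt}\big|_{t=0}W(x\exp(tV(x)))$, and the natural torsion-free connection is $\nabla^{ct}=\nabla^c+L^{ct}$ with $(L^{ct}_VW)(x)=\frac12P[V(x),W(x)]$ (pointwise Lie bracket in $\mathfrak g$). *)

theory Defs
  imports "HOL-Analysis.Analysis" "HOL-Algebra.Group"
begin

section \<open>Smooth maps\<close>

text \<open>\<open>C_k_on k S f\<close> means that \<open>f\<close> is \<open>k\<close> times continuously differentiable on \<open>S\<close>. It is only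
  used for open \<open>S\<close> in a finite-dimensional space, where continuity of all iterated directional
  derivatives is the usual notion.\<close>

primrec C_k_on :: "nat \<Rightarrow> 'a::real_normed_vector set \<Rightarrow> ('a \<Rightarrow> 'b::real_normed_vector) \<Rightarrow> bool" where
  "C_k_on 0 S f \<longleftrightarrow> continuous_on S f"
| "C_k_on (Suc k) S f \<longleftrightarrow>
     (\<forall>x\<in>S. f differentiable (at x)) \<and> (\<forall>v. C_k_on k S (\<lambda>x. frechet_derivative f (at x) v))"

definition smooth_on :: "'a::real_normed_vector set \<Rightarrow> ('a \<Rightarrow> 'b::real_normed_vector) \<Rightarrow> bool" where
  "smooth_on S f \<longleftrightarrow> (\<forall>k. C_k_on k S f)"


section \<open>Smooth manifolds\<close>

text \<open>A chart is a pair of its domain and its coordinate map; the coordinate map is irrelevant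
  outside the domain.\<close>

type_synonym ('g, 'e) chart = "'g set \<times> ('g \<Rightarrow> 'e)"

definition smooth_atlas :: "('g::topological_space, 'e::euclidean_space) chart set \<Rightarrow> bool" where
  "smooth_atlas A \<longleftrightarrow>
     (\<Union>(U, \<phi>)\<in>A. U) = UNIV \<and>
     (\<forall>(U, \<phi>)\<in>A. open U \<and> open (\<phi> ` U) \<and> homeomorphism U (\<phi> ` U) \<phi> (inv_into U \<phi>)) \<and>
     (\<forall>(U, \<phi>)\<in>A. \<forall>(V, \<psi>)\<in>A. smooth_on (\<phi> ` (U \<inter> V)) (\<psi> \<circ> inv_into U \<phi>))"

definition product_atlas ::
  "('g, 'e) chart set \<Rightarrow> ('h, 'f) chart set \<Rightarrow> ('g \<times> 'h, 'e \<times> 'f) chart set" where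
  "product_atlas A B = {(U \<times> V, map_prod \<phi> \<psi>) | U \<phi> V \<psi>. (U, \<phi>) \<in> A \<and> (V, \<psi>) \<in> B}"

definition smooth_map ::
  "('g::topological_space, 'e::euclidean_space) chart set \<Rightarrow>
   ('h::topological_space, 'f::euclidean_space) chart set \<Rightarrow> ('g \<Rightarrow> 'h) \<Rightarrow> bool" where
  "smooth_map A B f \<longleftrightarrow>
     continuous_on UNIV f \<and>
     (\<forall>(U, \<phi>)\<in>A. \<forall>(V, \<psi>)\<in>B. smooth_on (\<phi> ` (U \<inter> f -` V)) (\<psi> \<circ> f \<circ> inv_into U \<phi>))"

definition vector_atlas :: "('f::euclidean_space, 'f) chart set" where
  "vector_atlas = {(UNIV, id)}"


section \<open>Lie groups\<close>

text \<open>The underlying manifold is the whole type \<open>'g\<close>, whose topology is the manifold topology.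
  Since \<open>DIM('e) > 0\<close>, Lie groups here have positive dimension.\<close>

locale lie_group = group G
  for G :: "'g::{second_countable_topology, t2_space} monoid" (structure)
  and A :: "('g, 'e::euclidean_space) chart set" +
  assumes carrier_UNIV: "carrier G = UNIV"
    and atlas: "smooth_atlas A"
    and smooth_mult: "smooth_map (product_atlas A A) A (\<lambda>(x, y). x \<otimes> y)"
    and smooth_inv: "smooth_map A A (\<lambda>x. inv x)"
begin

text \<open>The Lie algebra of \<open>G\<close> is the tangent space at \<open>\<one>\<close>, identified with the model space \<open>'e\<close> by
  means of an arbitrarily chosen chart of \<open>A\<close> around \<open>\<one>\<close>: a curve through \<open>\<one>\<close> at time 0 represents
  the derivative at 0 of its coordinate expression. The inner product of the type \<open>'e\<close> plays no
  role.\<close>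

definition chart_one :: "'g \<Rightarrow> 'e" where
  "chart_one = snd (SOME c. c \<in> A \<and> \<one> \<in> fst c)"

definition one_param_subgroup :: "(real \<Rightarrow> 'g) \<Rightarrow> bool" where
  "one_param_subgroup \<gamma> \<longleftrightarrow>
     continuous_on UNIV \<gamma> \<and> (\<forall>s t. \<gamma> (s + t) = \<gamma> s \<otimes> \<gamma> t)"

definition lie_exp :: "'e \<Rightarrow> 'g" where
  "lie_exp X =
     (THE \<gamma>. one_param_subgroup \<gamma> \<and> ((chart_one \<circ> \<gamma>) has_vector_derivative X) (at 0)) 1"

text \<open>\<open>lie_deriv X\<close> is the left-invariant vector field given by \<open>X\<close>, acting on functions.\<close>

definition lie_deriv :: "'e \<Rightarrow> ('g \<Rightarrow> 'b::real_normed_vector) \<Rightarrow> 'g \<Rightarrow> 'b" where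
  "lie_deriv X f x = vector_derivative (\<lambda>t::real. f (x \<otimes> lie_exp (t *\<^sub>R X))) (at 0)"

definition smooth_fun :: "('g \<Rightarrow> 'b::euclidean_space) \<Rightarrow> bool" where
  "smooth_fun f \<longleftrightarrow> smooth_map A vector_atlas f"

definition lie_bracket :: "'e \<Rightarrow> 'e \<Rightarrow> 'e" where
  "lie_bracket X Y = (THE Z. \<forall>f :: 'g \<Rightarrow> real. smooth_fun f \<longrightarrow>
     (\<forall>x. lie_deriv Z f x = lie_deriv X (lie_deriv Y f) x - lie_deriv Y (lie_deriv X f) x))"

definition Ad :: "'g \<Rightarrow> 'e \<Rightarrow> 'e" where
  "Ad s X = vector_derivative (\<lambda>t::real. chart_one (s \<otimes> lie_exp (t *\<^sub>R X) \<otimes> inv s)) (at 0)"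

text \<open>The negative of the Killing form; the sum is the trace of \<open>ad X \<circ> ad Y\<close>.\<close>

definition Kil :: "'e \<Rightarrow> 'e \<Rightarrow> real" where
  "Kil X Y = - (\<Sum>b\<in>Basis. lie_bracket X (lie_bracket Y b) \<bullet> b)"

definition lie_ideal :: "'e set \<Rightarrow> bool" where
  "lie_ideal I \<longleftrightarrow> subspace I \<and> (\<forall>X. \<forall>Y\<in>I. lie_bracket X Y \<in> I)"

text \<open>The absence of nonzero abelian ideals is equivalent to that of nonzero solvable ideals.\<close>

definition semisimple :: bool where
  "semisimple \<longleftrightarrow> (\<forall>I. lie_ideal I \<and> (\<forall>X\<in>I. \<forall>Y\<in>I. lie_bracket X Y = 0) \<longrightarrow> I = {0})"


section \<open>The homogeneous space \<open>G/K\<close>\<close>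

definition subgroup_algebra :: "'g set \<Rightarrow> 'e set" where
  "subgroup_algebra K = {X. \<forall>t::real. lie_exp (t *\<^sub>R X) \<in> K}"

definition complement :: "'g set \<Rightarrow> 'e set" where
  "complement K = {X. \<forall>Y\<in>subgroup_algebra K. Kil X Y = 0}"

definition proj :: "'g set \<Rightarrow> 'e \<Rightarrow> 'e" where
  "proj K X = (THE Y. Y \<in> complement K \<and> X - Y \<in> subgroup_algebra K)"

text \<open>\<open>C\<^sup>\<infinity>(G/K, \<real>)\<close>, as functions on \<open>G\<close>.\<close>

definition quotient_funs :: "'g set \<Rightarrow> ('g \<Rightarrow> real) set" where
  "quotient_funs K = {f. smooth_fun f \<and> (\<forall>x. \<forall>s\<in>K. f (x \<otimes> s) = f x)}"

definition vector_fields :: "'g set \<Rightarrow> ('g \<Rightarrow> 'e) set" where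
  "vector_fields K =
     {V. smooth_fun V \<and> (\<forall>x. V x \<in> complement K) \<and> (\<forall>x. \<forall>s\<in>K. V (x \<otimes> s) = Ad (inv s) (V x))}"

definition derivation :: "('g \<Rightarrow> 'e) \<Rightarrow> ('g \<Rightarrow> real) \<Rightarrow> 'g \<Rightarrow> real" where
  "derivation V f x = deriv (\<lambda>t. f (x \<otimes> lie_exp (t *\<^sub>R V x))) 0"

definition field_bracket :: "'g set \<Rightarrow> ('g \<Rightarrow> 'e) \<Rightarrow> ('g \<Rightarrow> 'e) \<Rightarrow> 'g \<Rightarrow> 'e" where
  "field_bracket K V W = (THE U. U \<in> vector_fields K \<and> (\<forall>f\<in>quotient_funs K. \<forall>x.
     derivation U f x = derivation V (derivation W f) x - derivation W (derivation V f) x))"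


section \<open>Connections\<close>

definition connection :: "'g set \<Rightarrow> (('g \<Rightarrow> 'e) \<Rightarrow> ('g \<Rightarrow> 'e) \<Rightarrow> 'g \<Rightarrow> 'e) \<Rightarrow> bool" where
  "connection K D \<longleftrightarrow>
     (\<forall>V\<in>vector_fields K. \<forall>W\<in>vector_fields K. D V W \<in> vector_fields K) \<and>
     (\<forall>V\<in>vector_fields K. \<forall>V'\<in>vector_fields K. \<forall>W\<in>vector_fields K. \<forall>x.
        D (\<lambda>y. V y + V' y) W x = D V W x + D V' W x) \<and>
     (\<forall>V\<in>vector_fields K. \<forall>W\<in>vector_fields K. \<forall>W'\<in>vector_fields K. \<forall>x.
        D V (\<lambda>y. W y + W' y) x = D V W x + D V W' x) \<and>
     (\<forall>f\<in>quotient_funs K. \<forall>V\<in>vector_fields K. \<forall>W\<in>vector_fields K. \<forall>x.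
        D (\<lambda>y. f y *\<^sub>R V y) W x = f x *\<^sub>R D V W x) \<and>
     (\<forall>f\<in>quotient_funs K. \<forall>V\<in>vector_fields K. \<forall>W\<in>vector_fields K. \<forall>x.
        D V (\<lambda>y. f y *\<^sub>R W y) x = derivation V f x *\<^sub>R W x + f x *\<^sub>R D V W x)"

definition torsion_free :: "'g set \<Rightarrow> (('g \<Rightarrow> 'e) \<Rightarrow> ('g \<Rightarrow> 'e) \<Rightarrow> 'g \<Rightarrow> 'e) \<Rightarrow> bool" where
  "torsion_free K D \<longleftrightarrow>
     (\<forall>V\<in>vector_fields K. \<forall>W\<in>vector_fields K. \<forall>x. D V W x - D W V x = field_bracket K V W x)"

definition metric_compatible ::
  "'g set \<Rightarrow> ('e \<Rightarrow> 'e \<Rightarrow> real) \<Rightarrow> (('g \<Rightarrow> 'e) \<Rightarrow> ('g \<Rightarrow> 'e) \<Rightarrow> 'g \<Rightarrow> 'e) \<Rightarrow> bool" where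
  "metric_compatible K g D \<longleftrightarrow>
     (\<forall>V\<in>vector_fields K. \<forall>W\<in>vector_fields K. \<forall>Z\<in>vector_fields K. \<forall>x.
        derivation V (\<lambda>y. g (W y) (Z y)) x = g (D V W x) (Z x) + g (W x) (D V Z x))"

definition levi_civita ::
  "'g set \<Rightarrow> ('e \<Rightarrow> 'e \<Rightarrow> real) \<Rightarrow> (('g \<Rightarrow> 'e) \<Rightarrow> ('g \<Rightarrow> 'e) \<Rightarrow> 'g \<Rightarrow> 'e) \<Rightarrow> bool" where
  "levi_civita K g D \<longleftrightarrow> connection K D \<and> torsion_free K D \<and> metric_compatible K g D"

definition nabla_c :: "('g \<Rightarrow> 'e) \<Rightarrow> ('g \<Rightarrow> 'e) \<Rightarrow> 'g \<Rightarrow> 'e" where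
  "nabla_c V W x = vector_derivative (\<lambda>t::real. W (x \<otimes> lie_exp (t *\<^sub>R V x))) (at 0)"

definition L_ct :: "'g set \<Rightarrow> ('g \<Rightarrow> 'e) \<Rightarrow> ('g \<Rightarrow> 'e) \<Rightarrow> 'g \<Rightarrow> 'e" where
  "L_ct K V W x = (1/2) *\<^sub>R proj K (lie_bracket (V x) (W x))"

definition nabla_ct :: "'g set \<Rightarrow> ('g \<Rightarrow> 'e) \<Rightarrow> ('g \<Rightarrow> 'e) \<Rightarrow> 'g \<Rightarrow> 'e" where
  "nabla_ct K V W x = nabla_c V W x + L_ct K V W x"

definition L_S :: "'g set \<Rightarrow> ('e \<Rightarrow> 'e) \<Rightarrow> ('g \<Rightarrow> 'e) \<Rightarrow> ('g \<Rightarrow> 'e) \<Rightarrow> 'g \<Rightarrow> 'e" where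
  "L_S K S V W x = (1/2) *\<^sub>R inv_into (complement K) S
     (proj K (lie_bracket (V x) (S (W x)) + lie_bracket (W x) (S (V x))))"

end

definition inner_product_on :: "'a::real_vector set \<Rightarrow> ('a \<Rightarrow> 'a \<Rightarrow> real) \<Rightarrow> bool" where
  "inner_product_on M g \<longleftrightarrow>
     (\<forall>X\<in>M. \<forall>Y\<in>M. g X Y = g Y X) \<and>
     (\<forall>X\<in>M. \<forall>Y\<in>M. \<forall>Z\<in>M. g (X + Y) Z = g X Z + g Y Z) \<and>
     (\<forall>c. \<forall>X\<in>M. \<forall>Y\<in>M. g (c *\<^sub>R X) Y = c * g X Y) \<and>
     (\<forall>X\<in>M. X \<noteq> 0 \<longrightarrow> g X X > 0)"

end

theory Submission
  imports Defs
begin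

text \<open>
  The difference \<open>B\<close> of two metric torsion-free connections is symmetric in its two arguments and
  skew with respect to \<open>g\<^sub>0\<close>, hence vanishes; so it suffices to check that \<open>\<nabla>\<^sup>c\<^sup>t + L\<^sup>S\<close> is metric
  and torsion-free. Metricity is the ad-invariance of \<open>Kil\<close>. Torsion-freeness means that
  \<open>[V, W] = \<nabla>\<^sup>c\<^sub>V W - \<nabla>\<^sup>c\<^sub>W V + P[V, W]\<close>, which holds because elements of the Lie algebra \<open>\<kk>\<close> of \<open>K\<close>
  kill \<open>C\<^sup>\<infinity>(G/K)\<close>.

  Everything about \<open>\<kk>\<close> follows from the description \<open>\<kk> = {X. Xf(1) = 0 for all f in C\<^sup>\<infinity>(G/K)}\<close>,
  which shows that \<open>\<kk>\<close> is a subspace and that vector fields are determined by their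
  derivations. It holds because averages over \<open>K\<close> of bump functions on \<open>G\<close> separate \<open>K\<close> from the
  other points of \<open>G\<close>. Averaging over \<open>G\<close> yields an Ad-invariant inner product on the Lie algebra,
  hence the definiteness of \<open>Kil\<close>. The averages are obtained from an invariant mean on the continuous
  functions of a compact group, and the bracket is the derivative of \<open>Ad\<close>.
\<close>

section \<open>Smooth maps between normed spaces\<close>

text \<open>The exponential map, the bracket, \<open>proj\<close> and \<open>field_bracket\<close>
  are definite descriptions, so each needs existence and uniqueness before anything can be computed
  with it: for the exponential map through a differential equation in one chart around the identity,
  for the bracket through symmetry of second derivatives and a supply of smooth functions, for
  \<open>proj\<close> through definiteness of \<open>Kil\<close>. No manifold structure on G/K is
  constructed; functions and vector fields remain K-equivariant functions on G, differentiated along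
  t \<mapsto> x exp(tX). Since \<open>K\<close> may be disconnected, equivariance is always checked
  for elements of \<open>K\<close> and never infinitesimally. The mean has to be linear, monotone,
  left invariant and compatible with differentiation in a parameter; approximation by finite
  averages of translates yields all of this without a measure. The formula for \<open>L_S\<close>
  has two properties: it is symmetric in V and W, so it leaves the torsion alone, and together with
  half of P[V, W] it is the solution of the Koszul formula, which makes the sum skew for g0.\<close>

lemma C_k_on_subset: "C_k_on k S f \<Longrightarrow> T \<subseteq> S \<Longrightarrow> C_k_on k T f"
  by (induction k arbitrary: f) (auto intro: continuous_on_subset)

lemma C_k_on_cong:
  assumes "open S" "\<And>x. x \<in> S \<Longrightarrow> f x = g x" "C_k_on k S f"
  shows "C_k_on k S g"
  using assms(2,3)
proof (induction k arbitrary: f g)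
  case 0
  then show ?case using continuous_on_cong[of S S f g] by simp
next
  case (Suc k)
  have d: "(g has_derivative frechet_derivative f (at x)) (at x)" if "x \<in> S" for x
    using Suc.prems that assms(1)
    by (auto intro!: has_derivative_transform_within_open[of f _ x UNIV S g] simp: frechet_derivative_works)
  then have e: "frechet_derivative g (at x) = frechet_derivative f (at x)" if "x \<in> S" for x
    using frechet_derivative_at that by metis
  have "C_k_on k S (\<lambda>x. frechet_derivative g (at x) v)" for v
    by (rule Suc.IH[of "\<lambda>x. frechet_derivative f (at x) v"]) (use e Suc.prems in auto)
  then show ?case using d by (auto simp: differentiable_def)
qed

text \<open>\<open>C_k_on\<close> speaks of the choice term \<open>frechet_derivative\<close>; here
  any explicit formula for the derivative may be supplied instead, which is how the closure
  properties below are proved by induction on k.\<close>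

lemma C_k_on_SucI:
  assumes "open S" "\<And>x. x \<in> S \<Longrightarrow> (f has_derivative f' x) (at x)"
    "\<And>v. C_k_on k S (\<lambda>x. f' x v)"
  shows "C_k_on (Suc k) S f"
proof -
  have "C_k_on k S (\<lambda>x. frechet_derivative f (at x) v)" for v
    by (rule C_k_on_cong[OF assms(1) _ assms(3)[of v]]) (use assms(2) frechet_derivative_at in metis)
  then show ?thesis using assms(2) by (auto simp: differentiable_def)
qed

lemma C_k_on_SucD:
  "C_k_on (Suc k) S f \<Longrightarrow> x \<in> S \<Longrightarrow> (f has_derivative frechet_derivative f (at x)) (at x)"
  by (simp add: frechet_derivative_works)

lemma C_k_on_Suc_imp: "C_k_on (Suc k) S f \<Longrightarrow> C_k_on k S f"
proof (induction k arbitrary: f)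
  case 0
  then show ?case
    by (auto simp: continuous_on_eq_continuous_within
        intro!: continuous_at_imp_continuous_within[OF differentiable_imp_continuous_within])
qed auto

lemma C_k_on_le: "C_k_on n S f \<Longrightarrow> m \<le> n \<Longrightarrow> C_k_on m S f"
  by (induction n) (auto simp: le_Suc_eq simp del: C_k_on.simps dest: C_k_on_Suc_imp)

lemma C_k_on_imp_continuous_on: "C_k_on k S f \<Longrightarrow> continuous_on S f"
  using C_k_on_le[of k S f 0] by simp

text \<open>For composites with charts, smoothness is available only near each point, on the part
  mapped into the chart domains; this glues such local statements.\<close>

lemma C_k_on_local:
  assumes "\<And>x. x \<in> S \<Longrightarrow> \<exists>N. open N \<and> x \<in> N \<and> C_k_on k N f"
  shows "C_k_on k S f"
  using assms
proof (induction k arbitrary: f)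
  case 0
  have "continuous (at x within S) f" if "x \<in> S" for x
    using 0[OF that] by (auto simp: continuous_on_eq_continuous_at intro: continuous_at_imp_continuous_within)
  then show ?case by (simp add: continuous_on_eq_continuous_within)
next
  case (Suc k)
  have "f differentiable at x" if "x \<in> S" for x using Suc.prems[OF that] by auto
  moreover have "C_k_on k S (\<lambda>x. frechet_derivative f (at x) v)" for v
    by (rule Suc.IH) (use Suc.prems in fastforce)
  ultimately show ?case by simp
qed

lemma C_k_on_const [simp, intro]: "C_k_on k S (\<lambda>x. c)"
  by (induction k arbitrary: c) auto

lemma C_k_on_bounded_linear:
  assumes "bounded_linear f" shows "C_k_on k S f"
proof (cases k)
  case (Suc j)
  have "frechet_derivative f (at x) = f" for x
    using frechet_derivative_at bounded_linear_imp_has_derivative[OF assms] by metis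
  then show ?thesis using Suc assms bounded_linear_imp_differentiable by auto
qed (simp add: assms linear_continuous_on)

lemma C_k_on_add:
  assumes "open S" "C_k_on k S f" "C_k_on k S g" shows "C_k_on k S (\<lambda>x. f x + g x)"
  using assms(2,3)
proof (induction k arbitrary: f g)
  case (Suc k)
  show ?case
    by (rule C_k_on_SucI[OF assms(1) has_derivative_add[OF C_k_on_SucD C_k_on_SucD]])
      (use Suc in auto)
qed (auto intro: continuous_intros)

lemma C_k_on_bounded_linear_comp:
  assumes "bounded_linear L" "open S" "C_k_on k S f" shows "C_k_on k S (\<lambda>x. L (f x))"
  using assms(3)
proof (induction k arbitrary: f)
  case (Suc k)
  show ?case
    by (rule C_k_on_SucI[OF assms(2) bounded_linear.has_derivative[OF assms(1) C_k_on_SucD]])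
      (use Suc in auto)
qed (use assms(1) in \<open>auto intro: bounded_linear.continuous_on\<close>)

lemma C_k_on_sum:
  assumes "open S" "\<And>i. i \<in> I \<Longrightarrow> C_k_on k S (f i)" shows "C_k_on k S (\<lambda>x. \<Sum>i\<in>I. f i x)"
  using assms(2) by (induction I rule: infinite_finite_induct) (auto intro: C_k_on_add assms(1))

text \<open>The product rule pairs each factor with the derivative of the other, so the induction
  also needs the undifferentiated factors to be of class k; this is
  \<open>C_k_on_Suc_imp\<close>.\<close>

lemma C_k_on_bilinear:
  assumes "bounded_bilinear B" "open S" "C_k_on k S f" "C_k_on k S g"
  shows "C_k_on k S (\<lambda>x. B (f x) (g x))"
  using assms(3,4)
proof (induction k arbitrary: f g)
  case 0
  then show ?case by (auto intro: bounded_bilinear.continuous_on[OF assms(1)])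
next
  case (Suc k)
  note fg = C_k_on_Suc_imp[OF Suc.prems(1)] C_k_on_Suc_imp[OF Suc.prems(2)]
  show ?case
    by (rule C_k_on_SucI[OF assms(2) bounded_bilinear.FDERIV[OF assms(1) C_k_on_SucD C_k_on_SucD]])
      (use Suc fg in \<open>auto intro!: C_k_on_add assms(2)\<close>)
qed

lemma C_k_on_Pair:
  assumes "open S" "C_k_on k S f" "C_k_on k S g" shows "C_k_on k S (\<lambda>x. (f x, g x))"
proof -
  have "bounded_linear (\<lambda>x::'b. (x, 0::'c))" "bounded_linear (\<lambda>x::'c. (0::'b, x))"
    by (auto intro!: bounded_linear_Pair bounded_linear_ident bounded_linear_zero)
  then have "C_k_on k S (\<lambda>x. (f x, 0) + (0, g x))"
    using C_k_on_add[OF assms(1) C_k_on_bounded_linear_comp[OF _ assms(1,2)]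
        C_k_on_bounded_linear_comp[OF _ assms(1,3)]] by blast
  then show ?thesis by simp
qed

text \<open>The chain rule composes linear maps that depend on the point. Expanding the inner
  derivative in \<open>Basis\<close> turns this into a finite sum of scalar coefficients times
  partial derivatives of g along f, to which the bilinear rule and the induction hypothesis apply;
  hence the Euclidean middle space.\<close>

lemma C_k_on_comp:
  fixes f :: "'a::real_normed_vector \<Rightarrow> 'b::euclidean_space"
  assumes "open S" "C_k_on k S f" "C_k_on k T g" "f ` S \<subseteq> T"
  shows "C_k_on k S (\<lambda>x. g (f x))"
  using assms(2-)
proof (induction k arbitrary: f g)
  case 0
  then show ?case by (auto intro: continuous_on_compose2)
next
  case (Suc k)
  let ?D = "\<lambda>x v. \<Sum>b\<in>Basis. (frechet_derivative f (at x) v \<bullet> b) *\<^sub>R frechet_derivative g (at (f x)) b"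
  have d: "((\<lambda>x. g (f x)) has_derivative ?D x) (at x)" if x: "x \<in> S" for x
  proof -
    have f': "(f has_derivative frechet_derivative f (at x)) (at x)"
      and g': "(g has_derivative frechet_derivative g (at (f x))) (at (f x))"
      using Suc.prems x by (auto simp flip: frechet_derivative_works)
    have "frechet_derivative g (at (f x)) (frechet_derivative f (at x) v) = ?D x v" for v
      using linear_sum[OF has_derivative_linear[OF g'], of "\<lambda>b. (frechet_derivative f (at x) v \<bullet> b) *\<^sub>R b" Basis]
      by (simp add: euclidean_representation linear_cmul[OF has_derivative_linear[OF g']])
    then show ?thesis
      using diff_chain_at[OF f' g'] by (simp add: o_def)
  qed
  have "C_k_on k S (\<lambda>x. ?D x v)" for v
  proof (intro C_k_on_sum C_k_on_bilinear[OF bounded_bilinear_scaleR] assms(1))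
    fix b :: 'b
    show "C_k_on k S (\<lambda>x. frechet_derivative f (at x) v \<bullet> b)"
      by (rule C_k_on_bounded_linear_comp) (use Suc.prems assms(1) in \<open>auto intro: bounded_linear_inner_left\<close>)
    show "C_k_on k S (\<lambda>x. frechet_derivative g (at (f x)) b)"
      by (rule Suc.IH[OF C_k_on_Suc_imp[OF Suc.prems(1)]]) (use Suc.prems in auto)
  qed
  then show ?case by (intro C_k_on_SucI[OF assms(1), of _ ?D] d)
qed

lemma C_k_on_deriv:
  fixes f :: "real \<Rightarrow> 'b::real_normed_vector"
  assumes "open S" "\<And>x. x \<in> S \<Longrightarrow> (f has_vector_derivative f' x) (at x)" "C_k_on k S f'"
  shows "C_k_on (Suc k) S f"
  by (rule C_k_on_SucI[OF assms(1) assms(2)[unfolded has_vector_derivative_def]])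
    (auto intro: C_k_on_bounded_linear_comp[OF _ assms(1,3)] bounded_linear_scaleR_right)

lemma smooth_on_subset: "smooth_on S f \<Longrightarrow> T \<subseteq> S \<Longrightarrow> smooth_on T f"
  unfolding smooth_on_def using C_k_on_subset by blast

lemma smooth_on_cong: "open S \<Longrightarrow> (\<And>x. x \<in> S \<Longrightarrow> f x = g x) \<Longrightarrow> smooth_on S f \<Longrightarrow> smooth_on S g"
  unfolding smooth_on_def using C_k_on_cong by blast

lemma smooth_on_local:
  "(\<And>x. x \<in> S \<Longrightarrow> \<exists>N. open N \<and> x \<in> N \<and> smooth_on N f) \<Longrightarrow> smooth_on S f"
  unfolding smooth_on_def by (intro allI C_k_on_local) blast

lemma smooth_on_const [simp, intro]: "smooth_on S (\<lambda>x. c)"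
  unfolding smooth_on_def by simp

lemma smooth_on_bounded_linear: "bounded_linear f \<Longrightarrow> smooth_on S f"
  unfolding smooth_on_def by (simp add: C_k_on_bounded_linear)

lemma smooth_on_add: "open S \<Longrightarrow> smooth_on S f \<Longrightarrow> smooth_on S g \<Longrightarrow> smooth_on S (\<lambda>x. f x + g x)"
  unfolding smooth_on_def by (simp add: C_k_on_add)

lemma smooth_on_bilinear:
  "bounded_bilinear B \<Longrightarrow> open S \<Longrightarrow> smooth_on S f \<Longrightarrow> smooth_on S g \<Longrightarrow> smooth_on S (\<lambda>x. B (f x) (g x))"
  unfolding smooth_on_def by (simp add: C_k_on_bilinear)

lemma smooth_on_Pair: "open S \<Longrightarrow> smooth_on S f \<Longrightarrow> smooth_on S g \<Longrightarrow> smooth_on S (\<lambda>x. (f x, g x))"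
  unfolding smooth_on_def by (simp add: C_k_on_Pair)

lemma smooth_on_comp:
  fixes f :: "'a::real_normed_vector \<Rightarrow> 'b::euclidean_space"
  shows "open S \<Longrightarrow> smooth_on S f \<Longrightarrow> smooth_on T g \<Longrightarrow> f ` S \<subseteq> T \<Longrightarrow> smooth_on S (\<lambda>x. g (f x))"
  unfolding smooth_on_def by (intro allI C_k_on_comp[of S _ f T g]) auto

lemma smooth_on_frechet: "smooth_on S f \<Longrightarrow> smooth_on S (\<lambda>x. frechet_derivative f (at x) v)"
  unfolding smooth_on_def using C_k_on.simps(2) by blast

lemma smooth_on_has_derivative:
  "smooth_on S f \<Longrightarrow> x \<in> S \<Longrightarrow> (f has_derivative frechet_derivative f (at x)) (at x)"
  unfolding smooth_on_def using C_k_on_SucD by blast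

lemma smooth_on_imp_continuous_on: "smooth_on S f \<Longrightarrow> continuous_on S f"
  unfolding smooth_on_def using C_k_on_imp_continuous_on by blast

lemma frechet_derivative_sum_Basis:
  fixes f :: "'a::euclidean_space \<Rightarrow> 'b::real_normed_vector"
  assumes "f differentiable (at x)"
  shows "frechet_derivative f (at x) v = (\<Sum>b\<in>Basis. (v \<bullet> b) *\<^sub>R frechet_derivative f (at x) b)"
proof -
  have l: "linear (frechet_derivative f (at x))"
    using assms linear_frechet_derivative by blast
  show ?thesis
    using linear_sum[OF l, of "\<lambda>b. (v \<bullet> b) *\<^sub>R b" Basis] by (simp add: euclidean_representation linear_cmul[OF l])
qed

text \<open>Schwarz's theorem. The second difference over the parallelogram spanned by h u and h v
  is symmetric in u and v, and divided by h^2 it tends to either mixed derivative.\<close>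

lemma symmetric_second_derivative:
  fixes f :: "'a::real_normed_vector \<Rightarrow> real"
  assumes S: "open S" "a \<in> S" and f: "C_k_on 2 S f"
  shows "frechet_derivative (\<lambda>x. frechet_derivative f (at x) u) (at a) v =
         frechet_derivative (\<lambda>x. frechet_derivative f (at x) v) (at a) u"
proof -
  let ?D = "\<lambda>u x. frechet_derivative f (at x) u"
  let ?D2 = "\<lambda>u v x. frechet_derivative (?D u) (at x) v"
  have f1: "(f has_derivative frechet_derivative f (at x)) (at x)" if "x \<in> S" for x
    using f that by (auto simp: numeral_2_eq_2 simp flip: frechet_derivative_works)
  have f2: "(?D u has_derivative frechet_derivative (?D u) (at x)) (at x)" if "x \<in> S" for x u
    using f that by (auto simp: numeral_2_eq_2 simp flip: frechet_derivative_works)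
  have c: "continuous_on S (?D2 u v)" for u v
    using f by (auto simp: numeral_2_eq_2)
  have approx: "\<exists>d>0. \<forall>h. 0 < h \<and> h < d \<longrightarrow>
      \<bar>(f (a + h *\<^sub>R u + h *\<^sub>R v) - f (a + h *\<^sub>R u) - f (a + h *\<^sub>R v) + f a) / h\<^sup>2 - ?D2 u v a\<bar> < e"
    if e: "e > 0" for e u v
  proof -
    have "continuous (at a) (?D2 u v)"
      using c S continuous_on_eq_continuous_at by blast
    then obtain d1 where d1: "d1 > 0" "\<And>x. dist x a < d1 \<Longrightarrow> dist (?D2 u v x) (?D2 u v a) < e"
      unfolding continuous_at_eps_delta using e by blast
    obtain d2 where d2: "d2 > 0" "ball a d2 \<subseteq> S" using S openE by blast
    \<comment> \<open>Below d, the point a + s u + t v stays in S and in the ball where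
      \<open>?D2 u v\<close> is e-close to its value at a; the summand 1 avoids division by zero
      when u = v = 0.\<close>
    define d where "d = min d1 d2 / (norm u + norm v + 1)"
    have d: "d > 0" unfolding d_def using d1 d2 by (auto intro!: divide_pos_pos add_nonneg_pos)
    have near: "dist (a + s *\<^sub>R u + t *\<^sub>R v) a < min d1 d2" if "0 \<le> s" "s < d" "0 \<le> t" "t < d" for s t
    proof -
      have "dist (a + s *\<^sub>R u + t *\<^sub>R v) a \<le> s * norm u + t * norm v"
        using norm_triangle_ineq[of "s *\<^sub>R u" "t *\<^sub>R v"] that by (simp add: dist_norm add.assoc)
      also have "\<dots> \<le> d * norm u + d * norm v"
        using that by (intro add_mono mult_right_mono) auto
      also have "\<dots> < d * (norm u + norm v + 1)" using d by (simp add: algebra_simps)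
      also have "\<dots> = min d1 d2"
      proof -
        have "norm u + norm v + 1 > 0" by (simp add: add_nonneg_pos)
        then show ?thesis unfolding d_def by simp
      qed
      finally show ?thesis .
    qed
    have inS: "a + s *\<^sub>R u + t *\<^sub>R v \<in> S" if "0 \<le> s" "s < d" "0 \<le> t" "t < d" for s t
      using near[OF that] d2(2) by (auto simp: dist_commute)
    have "\<bar>(f (a + h *\<^sub>R u + h *\<^sub>R v) - f (a + h *\<^sub>R u) - f (a + h *\<^sub>R v) + f a) / h\<^sup>2 - ?D2 u v a\<bar> < e"
      if h: "0 < h" "h < d" for h
    proof -
      \<comment> \<open>The mean value theorem is used twice: the increment in direction v is
        differentiated along u as a function of s, and the resulting increment of
        \<open>?D u\<close> along v as a function of t.\<close>
      let ?g = "\<lambda>s. f (a + s *\<^sub>R u + h *\<^sub>R v) - f (a + s *\<^sub>R u + 0 *\<^sub>R v)"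
      let ?g' = "\<lambda>s. ?D u (a + s *\<^sub>R u + h *\<^sub>R v) - ?D u (a + s *\<^sub>R u + 0 *\<^sub>R v)"
      have line: "((\<lambda>s. f (a + s *\<^sub>R u + t *\<^sub>R v)) has_real_derivative ?D u (a + s *\<^sub>R u + t *\<^sub>R v)) (at s)"
        if "0 \<le> s" "s < d" "0 \<le> t" "t < d" for s t
      proof -
        have p: "((\<lambda>s. a + s *\<^sub>R u + t *\<^sub>R v) has_derivative (\<lambda>h. h *\<^sub>R u)) (at s)"
          by (auto intro!: derivative_eq_intros)
        show ?thesis
          using diff_chain_at[OF p f1[OF inS[OF that]]]
          unfolding has_field_derivative_def o_def
          by (simp add: linear_cmul[OF has_derivative_linear[OF f1[OF inS[OF that]]]] mult_commute_abs)
      qed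
      have "\<exists>z. 0 < z \<and> z < h \<and> ?g h - ?g 0 = (h - 0) * ?g' z"
        by (rule MVT2) (use h line in \<open>auto intro!: DERIV_diff line[where t = 0, simplified]\<close>)
      then obtain z where z: "0 < z" "z < h" "?g h - ?g 0 = h * ?g' z" by auto
      have line2: "((\<lambda>t. ?D u (a + z *\<^sub>R u + t *\<^sub>R v)) has_real_derivative ?D2 u v (a + z *\<^sub>R u + t *\<^sub>R v)) (at t)"
        if "0 \<le> t" "t \<le> h" for t
      proof -
        have i: "a + z *\<^sub>R u + t *\<^sub>R v \<in> S" using inS[of z t] z h that by auto
        have p: "((\<lambda>t. a + z *\<^sub>R u + t *\<^sub>R v) has_derivative (\<lambda>h. h *\<^sub>R v)) (at t)"
          by (auto intro!: derivative_eq_intros)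
        show ?thesis
          using diff_chain_at[OF p f2[OF i, of u]]
          unfolding has_field_derivative_def o_def
          by (simp add: linear_cmul[OF has_derivative_linear[OF f2[OF i]]] mult_commute_abs)
      qed
      have "\<exists>w. 0 < w \<and> w < h \<and> ?D u (a + z *\<^sub>R u + h *\<^sub>R v) - ?D u (a + z *\<^sub>R u + 0 *\<^sub>R v)
          = (h - 0) * ?D2 u v (a + z *\<^sub>R u + w *\<^sub>R v)"
        by (rule MVT2) (use h line2 in auto)
      then obtain w where w: "0 < w" "w < h" "?g' z = h * ?D2 u v (a + z *\<^sub>R u + w *\<^sub>R v)" by auto
      have "(f (a + h *\<^sub>R u + h *\<^sub>R v) - f (a + h *\<^sub>R u) - f (a + h *\<^sub>R v) + f a) / h\<^sup>2
          = ?D2 u v (a + z *\<^sub>R u + w *\<^sub>R v)"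
        using z(3) h unfolding w(3) by (simp add: power2_eq_square algebra_simps)
      moreover have "\<bar>?D2 u v (a + z *\<^sub>R u + w *\<^sub>R v) - ?D2 u v a\<bar> < e"
        using d1(2)[of "a + z *\<^sub>R u + w *\<^sub>R v"] near[of z w] z w h by (auto simp: dist_real_def)
      ultimately show ?thesis by simp
    qed
    then show ?thesis using d by blast
  qed
  show ?thesis
  proof (rule ccontr)
    assume ne: "\<not> ?thesis"
    \<comment> \<open>Half the gap between the two mixed derivatives, so that one quotient cannot be
      e-close to both.\<close>
    define e where "e = \<bar>?D2 u v a - ?D2 v u a\<bar> / 2"
    have e: "e > 0" using ne by (simp add: e_def)
    obtain d1 where d1: "d1 > 0" "\<And>h. 0 < h \<and> h < d1 \<Longrightarrow>
      \<bar>(f (a + h *\<^sub>R u + h *\<^sub>R v) - f (a + h *\<^sub>R u) - f (a + h *\<^sub>R v) + f a) / h\<^sup>2 - ?D2 u v a\<bar> < e"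
      using approx[OF e, of u v] by blast
    obtain d2 where d2: "d2 > 0" "\<And>h. 0 < h \<and> h < d2 \<Longrightarrow>
      \<bar>(f (a + h *\<^sub>R v + h *\<^sub>R u) - f (a + h *\<^sub>R v) - f (a + h *\<^sub>R u) + f a) / h\<^sup>2 - ?D2 v u a\<bar> < e"
      using approx[OF e, of v u] by blast
    define h where "h = min d1 d2 / 2"
    have h: "0 < h \<and> h < d1" "0 < h \<and> h < d2" using d1 d2 by (auto simp: h_def)
    let ?q = "(f (a + h *\<^sub>R u + h *\<^sub>R v) - f (a + h *\<^sub>R u) - f (a + h *\<^sub>R v) + f a) / h\<^sup>2"
    have "\<bar>?q - ?D2 u v a\<bar> < e" using d1(2)[OF h(1)] .
    moreover have sw: "a + h *\<^sub>R v + h *\<^sub>R u = a + h *\<^sub>R u + h *\<^sub>R v" by simp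
    have "?q = (f (a + h *\<^sub>R v + h *\<^sub>R u) - f (a + h *\<^sub>R v) - f (a + h *\<^sub>R u) + f a) / h\<^sup>2"
      unfolding sw by (simp add: algebra_simps del: add_left_cancel add_right_cancel)
    then have "\<bar>?q - ?D2 v u a\<bar> < e"
      using d2(2)[OF h(2)] by (simp only:)
    moreover have "\<bar>A - B\<bar> < 2 * e" if "\<bar>q - A\<bar> < e" "\<bar>q - B\<bar> < e" for q A B :: real
      using that by linarith
    ultimately have "\<bar>?D2 u v a - ?D2 v u a\<bar> < 2 * e" by blast
    then show False unfolding e_def by simp
  qed
qed

section \<open>Bump functions\<close>

text \<open>The factor \<open>p(1/t)\<close> makes this class closed under differentiation.\<close>

definition flat_fun :: "real poly \<Rightarrow> real \<Rightarrow> real" where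
  "flat_fun p t = (if t > 0 then poly p (1 / t) * exp (- (1 / t)) else 0)"

lemma tendsto_poly_mult_exp_minus: "((\<lambda>x::real. poly p x * exp (- x)) \<longlongrightarrow> 0) at_top"
proof -
  have "((\<lambda>x::real. \<Sum>i\<le>degree p. coeff p i * (x ^ i / exp x)) \<longlongrightarrow> (\<Sum>i\<le>degree p. coeff p i * 0)) at_top"
    by (intro tendsto_sum tendsto_mult tendsto_const tendsto_power_div_exp_0)
  then show ?thesis
    by (simp add: poly_altdef sum_distrib_right exp_minus sum_divide_distrib divide_inverse mult.assoc)
qed

text \<open>With x = 1/t, differentiating p(x) exp(-x) in t gives x^2 (p(x) - p'(x)) exp(-x), which
  is where the new polynomial comes from. At 0 both one-sided difference quotients tend to
  0.\<close>

lemma flat_fun_has_vector_derivative: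
  "(flat_fun p has_vector_derivative flat_fun ([:0, 0, 1:] * (p - pderiv p)) t) (at t)"
proof -
  consider "t > 0" | "t < 0" | "t = 0" by linarith
  then have "(flat_fun p has_real_derivative flat_fun ([:0, 0, 1:] * (p - pderiv p)) t) (at t)"
  proof cases
    case 1
    have "((\<lambda>t. poly p (1 / t) * exp (- (1 / t))) has_real_derivative
        poly (pderiv p) (1 / t) * (- (1 / t\<^sup>2)) * exp (- (1 / t)) + poly p (1 / t) * (exp (- (1 / t)) * (1 / t\<^sup>2))) (at t)"
      using 1 by (auto intro!: derivative_eq_intros DERIV_chain2[OF poly_DERIV] simp: power2_eq_square field_simps)
    then have "((\<lambda>t. poly p (1 / t) * exp (- (1 / t))) has_real_derivative
        flat_fun ([:0, 0, 1:] * (p - pderiv p)) t) (at t)"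
      using 1 by (simp add: flat_fun_def algebra_simps power2_eq_square)
    then show ?thesis
      by (rule has_field_derivative_transform_within_open[of _ _ _ "{0<..}"])
        (use 1 in \<open>auto simp: flat_fun_def\<close>)
  next
    case 2
    have "((\<lambda>t. 0) has_real_derivative flat_fun ([:0, 0, 1:] * (p - pderiv p)) t) (at t)"
      using 2 by (simp add: flat_fun_def)
    then show ?thesis
      by (rule has_field_derivative_transform_within_open[of _ _ _ "{..<0}"])
        (use 2 in \<open>auto simp: flat_fun_def\<close>)
  next
    case 3
    \<comment> \<open>The difference quotient for h > 0 is p(1/h) exp(-1/h) / h; the extra factor
      1/h turns p into \<open>pCons 0 p\<close>.\<close>
    have "((\<lambda>h. poly (pCons 0 p) (inverse h) * exp (- inverse h)) \<longlongrightarrow> 0) (at_right (0::real))"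
      by (rule filterlim_compose[OF tendsto_poly_mult_exp_minus filterlim_inverse_at_top_right])
    then have r: "((\<lambda>h. (flat_fun p (0 + h) - flat_fun p 0) / h) \<longlongrightarrow> 0) (at_right 0)"
      by (rule Lim_transform_eventually)
        (auto simp: eventually_at_right[of 0 1] flat_fun_def field_simps intro!: exI[of _ 1])
    have l: "((\<lambda>h. (flat_fun p (0 + h) - flat_fun p 0) / h) \<longlongrightarrow> 0) (at_left 0)"
      by (rule Lim_transform_eventually[of "\<lambda>_. 0"])
        (auto simp: eventually_at_left[of "-1" 0] flat_fun_def intro!: exI[of _ "-1"])
    have "((\<lambda>h. (flat_fun p (0 + h) - flat_fun p 0) / h) \<longlongrightarrow> 0) (at 0)"
      using l r filterlim_at_split by blast
    then show ?thesis using 3 by (simp add: DERIV_def flat_fun_def)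
  qed
  then show ?thesis by (simp add: has_real_derivative_iff_has_vector_derivative)
qed

lemma smooth_on_flat_fun: "smooth_on S (flat_fun p)"
proof -
  have "C_k_on k UNIV (flat_fun p)" for k
  proof (induction k arbitrary: p)
    case 0
    then show ?case
      using flat_fun_has_vector_derivative[of p]
      by (auto simp: continuous_on_eq_continuous_at intro: has_vector_derivative_continuous)
  next
    case (Suc k)
    show ?case by (rule C_k_on_deriv[OF open_UNIV flat_fun_has_vector_derivative Suc])
  qed
  then show ?thesis using smooth_on_subset[of UNIV] unfolding smooth_on_def by blast
qed

text \<open>The classical exp(-1/(r^2 - |x - c|^2)) inside the ball of radius r, extended by
  0.\<close>

definition bump :: "'a::euclidean_space \<Rightarrow> real \<Rightarrow> 'a \<Rightarrow> real" where
  "bump c r x = flat_fun 1 (r\<^sup>2 - (x - c) \<bullet> (x - c))"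

lemma smooth_on_bump: "smooth_on S (bump c r)"
proof -
  have id: "smooth_on UNIV (\<lambda>x::'a. x)" and m: "smooth_on UNIV (uminus :: real \<Rightarrow> real)"
    by (auto intro!: smooth_on_bounded_linear bounded_linear_minus)
  have 1: "smooth_on UNIV (\<lambda>x::'a. x + - c)"
    using smooth_on_add[OF open_UNIV id, of "\<lambda>x. - c"] by simp
  have 2: "smooth_on UNIV (\<lambda>x::'a. (x + - c) \<bullet> (x + - c))"
    using smooth_on_bilinear[OF bounded_bilinear_inner open_UNIV 1 1] .
  have 3: "smooth_on UNIV (\<lambda>x::'a. - ((x + - c) \<bullet> (x + - c)))"
    using smooth_on_comp[OF open_UNIV 2 m] by simp
  have 4: "smooth_on UNIV (\<lambda>x::'a. r\<^sup>2 + - ((x + - c) \<bullet> (x + - c)))"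
    using smooth_on_add[OF open_UNIV smooth_on_const 3] .
  have "smooth_on UNIV (bump c r)"
    using smooth_on_comp[OF open_UNIV 4 smooth_on_flat_fun[of UNIV 1]] by (simp add: bump_def[abs_def])
  then show ?thesis using smooth_on_subset by blast
qed

lemma bump_nonneg: "bump c r x \<ge> 0"
  by (simp add: bump_def flat_fun_def)

lemma bump_pos_iff: "r > 0 \<Longrightarrow> bump c r x > 0 \<longleftrightarrow> dist x c < r"
proof -
  assume "r > 0"
  have "(x - c) \<bullet> (x - c) < r\<^sup>2 \<longleftrightarrow> dist x c < r"
    using \<open>r > 0\<close> norm_lt_square[of "x - c" r] by (simp add: dist_norm)
  then show ?thesis by (auto simp: bump_def flat_fun_def)
qed

lemma bump_eq_0: "r > 0 \<Longrightarrow> r \<le> dist x c \<Longrightarrow> bump c r x = 0"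
  using bump_pos_iff[of r c x] bump_nonneg[of c r x] by linarith

section \<open>Ordinary differential equations\<close>

text \<open>The short interval replaces a Gronwall estimate: at a point m where the norm of the
  difference w is maximal, the mean value inequality bounds norm (w m) by h L norm (w m) with h L <
  1, so w vanishes.\<close>

lemma ode_unique:
  fixes u v :: "real \<Rightarrow> 'a::real_normed_vector"
  assumes lip: "\<And>x y. x \<in> X \<Longrightarrow> y \<in> X \<Longrightarrow> norm (F x - F y) \<le> L * norm (x - y)"
    and h: "0 \<le> h" "h * L < 1"
    and u: "\<And>t. \<bar>t\<bar> \<le> h \<Longrightarrow> u t \<in> X \<and> (u has_vector_derivative F (u t)) (at t)"
    and v: "\<And>t. \<bar>t\<bar> \<le> h \<Longrightarrow> v t \<in> X \<and> (v has_vector_derivative F (v t)) (at t)"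
    and uv: "u 0 = v 0" and t: "\<bar>t\<bar> \<le> h"
  shows "u t = v t"
proof -
  define w where "w t = u t - v t" for t
  have w': "(w has_vector_derivative F (u t) - F (v t)) (at t)" if "\<bar>t\<bar> \<le> h" for t
    unfolding w_def using u[OF that] v[OF that] by (auto intro: has_vector_derivative_diff)
  have cont: "continuous_on {-h..h} (\<lambda>t. norm (w t))"
    using w' by (intro continuous_intros continuous_at_imp_continuous_on)
      (auto intro!: has_vector_derivative_continuous[OF w'])
  obtain m where m: "m \<in> {-h..h}" "\<And>t. t \<in> {-h..h} \<Longrightarrow> norm (w t) \<le> norm (w m)"
    using continuous_attains_sup[OF compact_Icc _ cont] h by fastforce
  have "norm (w m - w 0) \<le> (max L 0 * norm (w m)) * norm (m - 0)"
  proof (rule differentiable_bound[of "{-h..h}" w "\<lambda>t s. s *\<^sub>R (F (u t) - F (v t))"])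
    fix s assume s: "s \<in> {-h..h}"
    then have s': "\<bar>s\<bar> \<le> h" by auto
    show "(w has_derivative (\<lambda>r. r *\<^sub>R (F (u s) - F (v s)))) (at s within {-h..h})"
      using w'[OF s'] unfolding has_vector_derivative_def by (rule has_derivative_at_withinI)
    have "norm (F (u s) - F (v s)) \<le> L * norm (w s)"
      using lip u[OF s'] v[OF s'] unfolding w_def by blast
    also have "\<dots> \<le> max L 0 * norm (w m)"
      using m(2)[OF s] by (intro mult_mono) auto
    finally show "onorm (\<lambda>r. r *\<^sub>R (F (u s) - F (v s))) \<le> max L 0 * norm (w m)"
      by (simp add: onorm_scaleR_left onorm_id bounded_linear_ident)
  qed (use m h in auto)
  also have "\<dots> \<le> (max L 0 * norm (w m)) * h"
    using m(1) by (intro mult_left_mono) auto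
  finally have "norm (w m) \<le> (h * max L 0) * norm (w m)"
    using uv by (simp add: w_def mult_ac)
  moreover have "h * max L 0 < 1" using h by (simp add: max_def)
  ultimately have "norm (w m) \<le> 0"
    using mult_strict_right_mono[of "h * max L 0" 1 "norm (w m)"] by linarith
  moreover have "t \<in> {-h..h}" using t by auto
  ultimately have "norm (w t) \<le> 0" using m(2) order_trans by blast
  then show ?thesis by (simp add: w_def)
qed

text \<open>Composing \<open>F\<close> with the projection onto the ball makes it bounded and globally Lipschitz, so that
  the Picard operator is a contraction on all bounded continuous functions.\<close>

lemma ode_exists:
  fixes F :: "'a::euclidean_space \<Rightarrow> 'a"
  assumes r: "r > 0"
    and lip: "\<And>x y. x \<in> cball p r \<Longrightarrow> y \<in> cball p r \<Longrightarrow> norm (F x - F y) \<le> L * norm (x - y)"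
  shows "\<exists>h>0. \<exists>y. y 0 = p \<and> (\<forall>t. \<bar>t\<bar> < h \<longrightarrow> y t \<in> cball p r \<and> (y has_vector_derivative F (y t)) (at t))"
proof -
  define G where "G x = F (closest_point (cball p r) x)" for x
  have cp: "closest_point (cball p r) x \<in> cball p r" for x
    using r by (intro closest_point_in_set) auto
  define L' where "L' = max L 0"
  have L': "L' \<ge> 0" by (simp add: L'_def)
  have G_lip: "norm (G x - G y) \<le> L' * norm (x - y)" for x y
  proof -
    have "norm (G x - G y) \<le> L * norm (closest_point (cball p r) x - closest_point (cball p r) y)"
      unfolding G_def by (rule lip[OF cp cp])
    also have "\<dots> \<le> L' * norm (x - y)"
      using closest_point_lipschitz[of "cball p r" x y] r
      by (intro mult_mono) (auto simp: L'_def dist_norm)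
    finally show ?thesis .
  qed
  define M where "M = norm (F p) + L' * r"
  have G_bd: "norm (G x) \<le> M" for x
  proof -
    let ?c = "closest_point (cball p r) x"
    have "norm (F ?c - F p) \<le> L * norm (?c - p)" using cp r by (intro lip) auto
    also have "\<dots> \<le> L' * r" using cp[of x] r by (intro mult_mono) (auto simp: L'_def dist_norm norm_minus_commute)
    finally show ?thesis unfolding G_def M_def using norm_triangle_sub[of "F ?c" "F p"] by simp
  qed
  have M: "M \<ge> 0" using G_bd[of p] norm_ge_zero order_trans by blast
  have G_cont: "continuous_on UNIV G"
    by (rule lipschitz_on_continuous_on[of L']) (use G_lip L' in \<open>auto simp: lipschitz_on_def dist_norm\<close>)
  \<comment> \<open>The integrals from -h to t and from -h to 0 have total length at most 3h: the
    first entry makes the Picard operator contract by 1/2, the second keeps its values within r of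
    p.\<close>
  define h where "h = min (1 / (6 * (L' + 1))) (r / (3 * (M + 1)))"
  have h0: "h > 0" using L' M r by (simp add: h_def)
  have hL: "3 * h * L' \<le> 1 / 2"
  proof -
    have "3 * h * L' \<le> 3 * (1 / (6 * (L' + 1))) * L'" using L' by (intro mult_right_mono mult_left_mono) (auto simp: h_def)
    also have "\<dots> \<le> 1 / 2" using L' by (simp add: divide_simps)
    finally show ?thesis .
  qed
  have hM: "3 * h * M \<le> r"
  proof -
    have "3 * h * M \<le> 3 * (r / (3 * (M + 1))) * M" using M by (intro mult_right_mono mult_left_mono) (auto simp: h_def)
    also have "\<dots> \<le> r" using M r by (simp add: divide_simps)
    finally show ?thesis .
  qed
  \<comment> \<open>Clamping the time to [-h, h] lets the Picard operator act on the bounded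
    continuous functions of the whole real line, a complete metric space.\<close>
  define c where "c t = max (-h) (min h t)" for t
  have c: "c t \<in> {-h..h}" for t using h0 by (auto simp: c_def)
  have c_cont: "continuous_on UNIV c" unfolding c_def by (intro continuous_intros)
  \<comment> \<open>Integrating from -h keeps the limits in order for negative t as well;
    \<open>T\<close> subtracts \<open>I u 0\<close> to restore the initial value at 0.\<close>
  define I where "I u t = integral {-h..t} (\<lambda>s. G (u s))" for u t
  have Gu_cont: "continuous_on A (\<lambda>s. G (u s))" if "continuous_on UNIV u" for A and u :: "real \<Rightarrow> 'a"
    using continuous_on_compose2[OF G_cont that] continuous_on_subset by blast
  have I_cont: "continuous_on {-h..h} (I u)" if "continuous_on UNIV u" for u
    unfolding I_def by (intro indefinite_integral_continuous_1 integrable_continuous_interval Gu_cont that)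
  have I_bd: "norm (I u t) \<le> M * (2 * h)" if "continuous_on UNIV u" "t \<in> {-h..h}" for u t
  proof -
    have "norm (I u t) \<le> M * (t - - h)"
      unfolding I_def by (rule integral_bound) (use that G_bd Gu_cont in auto)
    also have "\<dots> \<le> M * (2 * h)" using that M by (intro mult_left_mono) auto
    finally show ?thesis .
  qed
  have I_bd0: "norm (I u 0) \<le> M * h" if "continuous_on UNIV u" for u
  proof -
    have "norm (I u 0) \<le> M * (0 - - h)"
      unfolding I_def by (rule integral_bound) (use that h0 G_bd Gu_cont in auto)
    then show ?thesis by simp
  qed
  define T where "T u t = p + (I u (c t) - I u 0)" for u t
  have T_bd: "norm (T u t - p) \<le> r" if "continuous_on UNIV u" for u t
  proof -
    have "norm (T u t - p) \<le> norm (I u (c t)) + norm (I u 0)"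
      unfolding T_def using norm_triangle_ineq4 by simp
    also have "\<dots> \<le> 3 * h * M" using I_bd[OF that c, of t] I_bd0[OF that] by (simp add: algebra_simps)
    finally show ?thesis using hM by simp
  qed
  have T_cont: "continuous_on UNIV (T u)" if "continuous_on UNIV u" for u
    unfolding T_def using c by (intro continuous_intros continuous_on_compose2[OF I_cont[OF that] c_cont]) auto
  have T_bcont: "T u \<in> bcontfun" if "continuous_on UNIV u" for u
  proof (rule bcontfun_normI[OF T_cont[OF that]])
    show "norm (T u x) \<le> norm p + r" for x
      using T_bd[OF that, of x] norm_triangle_sub[of "T u x" p] by simp
  qed
  define TT where "TT u = Bcontfun (T (apply_bcontfun u))" for u :: "real \<Rightarrow>\<^sub>C 'a"
  have uc: "continuous_on UNIV (apply_bcontfun u)" for u :: "real \<Rightarrow>\<^sub>C 'a"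
    using apply_bcontfun[of u] by (simp add: bcontfun_def)
  have TT: "apply_bcontfun (TT u) = T (apply_bcontfun u)" for u
    unfolding TT_def using Bcontfun_inverse[OF T_bcont[OF uc]] .
  have I_diff: "norm (I (apply_bcontfun u) t - I (apply_bcontfun v) t) \<le> L' * dist u v * (t + h)"
    if t: "t \<in> {-h..h}" for u v t
  proof -
    have i: "(\<lambda>s. G (apply_bcontfun w s)) integrable_on {-h..t}" for w
      by (intro integrable_continuous_interval Gu_cont uc)
    have "I (apply_bcontfun u) t - I (apply_bcontfun v) t
        = integral {-h..t} (\<lambda>s. G (apply_bcontfun u s) - G (apply_bcontfun v s))"
      unfolding I_def by (rule integral_diff[symmetric, OF i i])
    also have "norm \<dots> \<le> L' * dist u v * (t - - h)"
    proof (rule integral_bound)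
      fix s
      have "norm (G (apply_bcontfun u s) - G (apply_bcontfun v s)) \<le> L' * norm (apply_bcontfun u s - apply_bcontfun v s)"
        by (rule G_lip)
      also have "\<dots> \<le> L' * dist u v"
        using dist_bounded[of u s v] L' by (intro mult_left_mono) (auto simp: dist_norm)
      finally show "norm (G (apply_bcontfun u s) - G (apply_bcontfun v s)) \<le> L' * dist u v" .
    qed (use t uc in \<open>auto intro!: continuous_intros Gu_cont\<close>)
    finally show ?thesis by simp
  qed
  have "dist (TT u) (TT v) \<le> 1 / 2 * dist u v" for u v
  proof (rule dist_bound)
    fix t
    let ?u = "apply_bcontfun u" and ?v = "apply_bcontfun v"
    have "dist (TT u t) (TT v t) = norm ((I ?u (c t) - I ?v (c t)) - (I ?u 0 - I ?v 0))"
      unfolding TT T_def dist_norm by (simp add: algebra_simps)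
    also have "\<dots> \<le> norm (I ?u (c t) - I ?v (c t)) + norm (I ?u 0 - I ?v 0)"
      by (rule norm_triangle_ineq4)
    also have "\<dots> \<le> L' * dist u v * (c t + h) + L' * dist u v * (0 + h)"
      using c h0 by (intro add_mono I_diff) auto
    also have "\<dots> \<le> L' * dist u v * (2 * h) + L' * dist u v * h"
      using c[of t] L' by (intro add_mono mult_left_mono) auto
    also have "\<dots> = 3 * h * L' * dist u v" by simp
    also have "\<dots> \<le> 1 / 2 * dist u v" by (rule mult_right_mono[OF hL]) simp
    finally show "dist (TT u t) (TT v t) \<le> 1 / 2 * dist u v" .
  qed
  then obtain u where u: "TT u = u"
    using banach_fix_type[of "1/2" TT] by auto
  define y where "y = apply_bcontfun u"
  have yT: "y = T y" using TT[of u] u by (simp add: y_def)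
  have yc: "continuous_on UNIV y" using uc by (simp add: y_def)
  have y0: "y 0 = p"
    by (subst yT) (use h0 in \<open>simp add: T_def c_def\<close>)
  have yb: "y t \<in> cball p r" for t
    using T_bd[OF yc, of t] yT by (simp add: dist_norm norm_minus_commute)
  have "(y has_vector_derivative F (y t)) (at t)" if t: "\<bar>t\<bar> < h" for t
  proof -
    have "(I y has_vector_derivative G (y t)) (at t within {-h..h})"
      unfolding I_def by (rule integral_has_vector_derivative[OF Gu_cont[OF yc]]) (use t in auto)
    moreover have "at t within {-h..h} = at t" using t by (intro at_within_interior) auto
    moreover have "G (y t) = F (y t)" unfolding G_def using yb[of t] by (simp add: closest_point_self)
    ultimately have "((\<lambda>t. p + (I y t - I y 0)) has_vector_derivative F (y t)) (at t)"
      by (auto intro!: derivative_eq_intros)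
    then show ?thesis
    proof (rule has_vector_derivative_transform_within_open[of _ _ _ "{-h<..<h}"])
      fix s assume "s \<in> {-h<..<h}"
      then show "p + (I y s - I y 0) = y s"
        using fun_cong[OF yT, of s] by (simp add: T_def c_def)
    qed (use t in auto)
  qed
  then show ?thesis using h0 y0 yb by blast
qed

section \<open>Invariant means on compact groups\<close>

lemma sum_list_swap:
  "(\<Sum>s\<leftarrow>S. \<Sum>t\<leftarrow>T. g s t) = (\<Sum>t\<leftarrow>T. \<Sum>s\<leftarrow>S. (g s t :: 'a::comm_monoid_add))"
  by (induction S) (simp_all add: sum_list_addf)

lemma sum_list_average_bounds:
  fixes F :: "'a \<Rightarrow> real"
  assumes "S \<noteq> []" "\<And>s. s \<in> set S \<Longrightarrow> a \<le> F s" "\<And>s. s \<in> set S \<Longrightarrow> F s \<le> b"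
  shows "a \<le> (\<Sum>s\<leftarrow>S. F s) / length S" "(\<Sum>s\<leftarrow>S. F s) / length S \<le> b"
proof -
  have "(\<Sum>s\<leftarrow>S. a) \<le> (\<Sum>s\<leftarrow>S. F s)" "(\<Sum>s\<leftarrow>S. F s) \<le> (\<Sum>s\<leftarrow>S. b)"
    using assms by (auto intro: sum_list_mono)
  then show "a \<le> (\<Sum>s\<leftarrow>S. F s) / length S" "(\<Sum>s\<leftarrow>S. F s) / length S \<le> b"
    using assms(1) by (auto simp: sum_list_const_mult sum_list_triv field_simps)
qed

lemma sum_list_average_abs:
  fixes F :: "'a \<Rightarrow> real"
  assumes "S \<noteq> []" "\<And>s. s \<in> set S \<Longrightarrow> \<bar>F s - c\<bar> \<le> e"
  shows "\<bar>(\<Sum>s\<leftarrow>S. F s) / length S - c\<bar> \<le> e"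
proof -
  have "c - e \<le> F s" "F s \<le> c + e" if "s \<in> set S" for s
    using assms(2)[OF that] by linarith+
  then have "c - e \<le> (\<Sum>s\<leftarrow>S. F s) / length S" "(\<Sum>s\<leftarrow>S. F s) / length S \<le> c + e"
    using sum_list_average_bounds[OF assms(1), of "c - e" F "c + e"] by auto
  then show ?thesis by linarith
qed

text \<open>Tube lemma: compactness of K gives one neighbourhood of p for all k. It supplies the
  equicontinuity of averages and the uniformity needed to differentiate under the mean.\<close>

lemma continuous_on_compact_uniform:
  fixes H :: "'a::topological_space \<Rightarrow> 'k::topological_space \<Rightarrow> 'c::metric_space"
  assumes "continuous_on (S \<times> K) (\<lambda>(p, k). H p k)" "p \<in> S" "compact K" "e > 0"
  shows "\<exists>U. open U \<and> p \<in> U \<and> (\<forall>q\<in>U \<inter> S. \<forall>k\<in>K. dist (H q k) (H p k) < e)"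
proof -
  obtain X where X: "p \<in> X" "open X" "\<forall>x\<in>X \<inter> S. \<forall>t\<in>K. dist ((\<lambda>(p, k). H p k) (x, t)) ((\<lambda>(p, k). H p k) (p, t)) \<le> e / 2"
    using continuous_on_prod_compactE[of S K "\<lambda>(p, k). H p k" p "e / 2"] assms by auto
  have "dist (H q k) (H p k) < e" if "q \<in> X \<inter> S" "k \<in> K" for q k
  proof -
    have "dist (H q k) (H p k) \<le> e / 2" using X(3) that by auto
    then show ?thesis using assms(4) by linarith
  qed
  then show ?thesis using X by blast
qed

text \<open>Purely topological hypotheses, so that the same mean serves the whole group, where it
  makes an inner product invariant, and the subgroup, where it produces functions on G/K.\<close>

locale compact_subgroup = group G for G :: "'g::topological_space monoid" (structure) +
  fixes K :: "'g set"
  assumes carrier: "carrier G = UNIV"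
    and continuous_mult: "continuous_on UNIV (\<lambda>(x, y). x \<otimes> y)"
    and continuous_inv: "continuous_on UNIV (\<lambda>x. inv x)"
    and subgroup: "subgroup K G"
    and compact: "compact K"
begin

text \<open>Translates are listed with multiplicity, so that an average of an average is again an
  average, over the list of all products.\<close>

definition ravg :: "'g list \<Rightarrow> ('g \<Rightarrow> real) \<Rightarrow> 'g \<Rightarrow> real" where
  "ravg S f x = (\<Sum>s\<leftarrow>S. f (x \<otimes> s)) / length S"

definition lavg :: "'g list \<Rightarrow> ('g \<Rightarrow> real) \<Rightarrow> 'g \<Rightarrow> real" where
  "lavg S f x = (\<Sum>s\<leftarrow>S. f (s \<otimes> x)) / length S"

definition right_mean :: "('g \<Rightarrow> real) \<Rightarrow> real \<Rightarrow> bool" where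
  "right_mean f c \<longleftrightarrow> (\<forall>e>0. \<exists>S. S \<noteq> [] \<and> set S \<subseteq> K \<and> (\<forall>x\<in>K. \<bar>ravg S f x - c\<bar> < e))"

definition left_mean :: "('g \<Rightarrow> real) \<Rightarrow> real \<Rightarrow> bool" where
  "left_mean f c \<longleftrightarrow> (\<forall>e>0. \<exists>S. S \<noteq> [] \<and> set S \<subseteq> K \<and> (\<forall>x\<in>K. \<bar>lavg S f x - c\<bar> < e))"

text \<open>For continuous f exactly one constant qualifies, because every right mean equals every
  left mean; for other f nothing is claimed.\<close>

definition mean :: "('g \<Rightarrow> real) \<Rightarrow> real" where
  "mean f = (SOME c. right_mean f c)"

lemma right_meanD:
  "right_mean f c \<Longrightarrow> e > 0 \<Longrightarrow> \<exists>S. S \<noteq> [] \<and> set S \<subseteq> K \<and> (\<forall>x\<in>K. \<bar>ravg S f x - c\<bar> < e)"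
  by (simp add: right_mean_def)

lemma left_meanD:
  "left_mean f c \<Longrightarrow> e > 0 \<Longrightarrow> \<exists>S. S \<noteq> [] \<and> set S \<subseteq> K \<and> (\<forall>x\<in>K. \<bar>lavg S f x - c\<bar> < e)"
  by (simp add: left_mean_def)

lemma one_K: "\<one> \<in> K" and mult_K: "x \<in> K \<Longrightarrow> y \<in> K \<Longrightarrow> x \<otimes> y \<in> K" and inv_K: "x \<in> K \<Longrightarrow> inv x \<in> K"
  using subgroup by (auto simp: subgroup.one_closed subgroup.m_closed subgroup.m_inv_closed)

lemma ravg_ravg:
  "ravg S (ravg T f) x = ravg (concat (map (\<lambda>s. map (\<lambda>t. s \<otimes> t) T) S)) f x"
proof -
  have "(\<Sum>s\<leftarrow>S. \<Sum>t\<leftarrow>T. f (x \<otimes> s \<otimes> t)) = (\<Sum>r\<leftarrow>concat (map (\<lambda>s. map (\<lambda>t. s \<otimes> t) T) S). f (x \<otimes> r))"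
    by (induction S) (simp_all add: o_def m_assoc carrier)
  moreover have "length (concat (map (\<lambda>s. map (\<lambda>t. s \<otimes> t) T) S)) = length S * length T"
    by (induction S) simp_all
  moreover have "(\<Sum>s\<leftarrow>S. (\<Sum>t\<leftarrow>T. f (x \<otimes> s \<otimes> t)) / real (length T)) =
      (\<Sum>s\<leftarrow>S. \<Sum>t\<leftarrow>T. f (x \<otimes> s \<otimes> t)) / real (length T)"
    by (induction S) (simp_all add: add_divide_distrib)
  ultimately show ?thesis by (simp add: ravg_def mult.commute)
qed

lemma lavg_ravg: "lavg S (ravg T f) x = ravg T (lavg S f) x"
proof -
  have 1: "(\<Sum>s\<leftarrow>S. g s / c) = (\<Sum>s\<leftarrow>S. g s) / c" for S and g :: "'g \<Rightarrow> real" and c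
    by (induction S) (simp_all add: add_divide_distrib)
  show ?thesis
    by (simp add: ravg_def lavg_def 1 sum_list_swap[of _ T S] m_assoc carrier mult.commute)
qed

lemma continuous_on_translate:
  assumes "continuous_on K f" shows "continuous_on (K \<times> K) (\<lambda>(x, y). f (x \<otimes> y))"
proof -
  have "continuous_on (K \<times> K) (\<lambda>z. f ((\<lambda>(x, y). x \<otimes> y) z))"
    by (rule continuous_on_compose2[OF assms continuous_on_subset[OF continuous_mult]])
      (auto intro: mult_K)
  then show ?thesis by (simp add: case_prod_unfold)
qed

text \<open>Averages of \<open>f\<close> are equicontinuous. If the infimum of their maxima were approached by an
  average that is much smaller than it at one point, averaging over finitely many translates, whose
  number depends only on the modulus of continuity of \<open>f\<close>, would get below the infimum.\<close>

lemma right_mean_exists: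
  assumes f: "continuous_on K f"
  shows "\<exists>c. right_mean f c"
proof -
  \<comment> \<open>Uniform upper bounds of averages of f; the infimum M of \<open>B\<close> is the
    candidate for the mean.\<close>
  define B where "B = {b. \<exists>S. S \<noteq> [] \<and> set S \<subseteq> K \<and> (\<forall>x\<in>K. ravg S f x \<le> b)}"
  obtain lo where lo: "\<And>x. x \<in> K \<Longrightarrow> f lo \<le> f x"
    using continuous_attains_inf[OF compact _ f] one_K by auto
  obtain hi where hi: "\<And>x. x \<in> K \<Longrightarrow> f x \<le> f hi"
    using continuous_attains_sup[OF compact _ f] one_K by auto
  have "f hi \<in> B" unfolding B_def
    using hi one_K by (auto intro!: exI[of _ "[\<one>]"] simp: ravg_def carrier)
  then have B_ne: "B \<noteq> {}" by blast
  have "f lo \<le> b" if b: "b \<in> B" for b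
  proof -
    obtain S where S: "S \<noteq> []" "set S \<subseteq> K" "ravg S f \<one> \<le> b" using b one_K by (auto simp: B_def)
    have "f lo \<le> ravg S f \<one>" unfolding ravg_def
      by (rule sum_list_average_bounds(1)[OF S(1), of _ _ "f hi"]) (use S lo hi in \<open>auto simp: carrier\<close>)
    then show ?thesis using S by simp
  qed
  then have B_bdd: "bdd_below B" by (rule bdd_belowI)
  define M where "M = Inf B"
  have "\<exists>S. S \<noteq> [] \<and> set S \<subseteq> K \<and> (\<forall>x\<in>K. \<bar>ravg S f x - M\<bar> < e)" if e: "e > 0" for e
  proof -
    define d where "d = e / 3"
    have d: "d > 0" using e by (simp add: d_def)
    have "\<exists>U. open U \<and> y \<in> U \<and> (\<forall>q\<in>U \<inter> K. \<forall>k\<in>K. dist (f (q \<otimes> k)) (f (y \<otimes> k)) < d)" if "y \<in> K" for y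
      by (rule continuous_on_compact_uniform[OF continuous_on_translate[OF f] that compact d])
    then obtain U where U: "\<And>y. y \<in> K \<Longrightarrow> open (U y)" "\<And>y. y \<in> K \<Longrightarrow> y \<in> U y"
      "\<And>y q k. \<lbrakk>y \<in> K; q \<in> U y; q \<in> K; k \<in> K\<rbrakk> \<Longrightarrow> dist (f (q \<otimes> k)) (f (y \<otimes> k)) < d"
      by (metis IntI)
    obtain Y where Y: "Y \<subseteq> K" "finite Y" "K \<subseteq> (\<Union>y\<in>Y. U y)"
      by (rule compactE_image[OF compact, of K U]) (use U(1,2) in auto)
    obtain ys where ys: "set ys = Y" "distinct ys" using finite_distinct_list[OF Y(2)] by blast
    define N where "N = real (card Y)"
    have "Y \<noteq> {}" using Y(3) one_K by auto
    then have N: "N \<ge> 1" using Y(2) by (simp add: N_def Suc_leI card_gt_0_iff)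
    \<comment> \<open>The slack is so small that N - 1 values of at most M + \<eta> cannot
      compensate one value of at most M - 2d: their sum is at most N M - d.\<close>
    define \<eta> where "\<eta> = d / N"
    have \<eta>: "\<eta> > 0" "\<eta> \<le> d" using d N by (auto simp: \<eta>_def divide_simps)
    have "\<exists>b\<in>B. b < M + \<eta>"
      using \<eta> cInf_lessD[OF B_ne, of "M + \<eta>"] by (simp add: M_def)
    then obtain S where S: "S \<noteq> []" "set S \<subseteq> K" "\<And>x. x \<in> K \<Longrightarrow> ravg S f x \<le> M + \<eta>"
      unfolding B_def by force
    let ?g = "ravg S f"
    have "M - e < ?g x" if x: "x \<in> K" for x
    proof (rule ccontr)
      assume "\<not> M - e < ?g x"
      then have gx: "?g x \<le> M - 3 * d" by (simp add: d_def)
      \<comment> \<open>For z in \<open>U y\<close>, right translation by inv y x carries y to x,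
        and z to a point where the average differs from its value at x by at most d.\<close>
      define T where "T = map (\<lambda>y. inv y \<otimes> x) ys"
      have T: "T \<noteq> []" "set T \<subseteq> K" "length T = card Y"
        using ys \<open>Y \<noteq> {}\<close> Y(1) x by (auto simp: T_def distinct_card[symmetric] intro: mult_K inv_K)
      have "ravg T ?g z \<le> M - d / N" if z: "z \<in> K" for z
      proof -
        obtain y where y: "y \<in> Y" "z \<in> U y" using Y(3) z by blast
        have yK: "y \<in> K" using y Y by blast
        let ?u = "inv y \<otimes> x"
        have uK: "?u \<in> K" by (intro mult_K inv_K yK x)
        have "\<bar>ravg S f (z \<otimes> ?u) - ravg S f (y \<otimes> ?u)\<bar> \<le> d"
        proof -
          have *: "ravg S f (z \<otimes> ?u) - ravg S f (y \<otimes> ?u) = (\<Sum>s\<leftarrow>S. f (z \<otimes> ?u \<otimes> s) - f (y \<otimes> ?u \<otimes> s)) / length S - 0"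
            by (simp add: ravg_def sum_list_subtractf diff_divide_distrib)
          show ?thesis unfolding *
          proof (rule sum_list_average_abs[OF S(1)])
            fix s assume "s \<in> set S"
            then have "dist (f (z \<otimes> (?u \<otimes> s))) (f (y \<otimes> (?u \<otimes> s))) < d"
              using U(3)[OF yK y(2) z, of "?u \<otimes> s"] uK S(2) mult_K by blast
            then show "\<bar>f (z \<otimes> ?u \<otimes> s) - f (y \<otimes> ?u \<otimes> s) - 0\<bar> \<le> d"
              by (simp add: dist_real_def m_assoc carrier)
          qed
        qed
        moreover have "y \<otimes> ?u = x" by (simp add: carrier flip: m_assoc)
        ultimately have "\<bar>?g (z \<otimes> ?u) - ?g x\<bar> \<le> d" by simp
        then have 1: "?g (z \<otimes> ?u) \<le> M - 2 * d" using gx by linarith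
        have "(\<Sum>s\<leftarrow>T. ?g (z \<otimes> s)) = (\<Sum>y\<in>Y. ?g (z \<otimes> (inv y \<otimes> x)))"
          using sum_list_distinct_conv_sum_set[OF ys(2), of "\<lambda>y. ?g (z \<otimes> (inv y \<otimes> x))"] ys
          by (simp add: T_def o_def)
        also have "\<dots> = ?g (z \<otimes> ?u) + (\<Sum>y\<in>Y - {y}. ?g (z \<otimes> (inv y \<otimes> x)))"
          by (rule sum.remove[OF Y(2) y(1)])
        also have "\<dots> \<le> (M - 2 * d) + (\<Sum>y\<in>Y - {y}. M + \<eta>)"
          using 1 Y(1) z x by (intro add_mono sum_mono S(3) mult_K inv_K) auto
        also have "\<dots> = (M - 2 * d) + (N - 1) * (M + \<eta>)"
          using Y(2) y(1) N by (simp add: N_def of_nat_diff card_gt_0_iff Suc_leI)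
        also have "\<dots> = N * M - 2 * d + (N * \<eta> - \<eta>)" by (simp add: algebra_simps)
        also have "\<dots> \<le> N * M - d" using \<eta> N by (simp add: \<eta>_def)
        finally have "(\<Sum>s\<leftarrow>T. ?g (z \<otimes> s)) / N \<le> (N * M - d) / N"
          using N by (intro divide_right_mono) auto
        also have "\<dots> = M - d / N" using N by (simp add: field_simps)
        finally show ?thesis by (simp add: ravg_def[of T] T(3) N_def)
      qed
      then have "M - d / N \<in> B"
        unfolding B_def ravg_ravg
        using T S(1,2) by (auto intro!: exI[of _ "concat (map (\<lambda>s. map (\<lambda>t. s \<otimes> t) S) T)"] mult_K)
      then have "M \<le> M - d / N" unfolding M_def using B_bdd cInf_lower by blast
      then show False using d N by (simp add: divide_le_0_iff)
    qed
    moreover have "?g x < M + e" if "x \<in> K" for x using S(3)[OF that] \<eta> d by (simp add: d_def)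
    ultimately have "\<bar>?g x - M\<bar> < e" if "x \<in> K" for x
      using that by (smt (verit))
    then show ?thesis using S(1,2) by blast
  qed
  then show ?thesis unfolding right_mean_def by blast
qed

lemma left_mean_exists:
  assumes f: "continuous_on K f"
  shows "\<exists>c. left_mean f c"
proof -
  have "continuous_on K (\<lambda>x. f (inv x))"
    by (rule continuous_on_compose2[OF f continuous_on_subset[OF continuous_inv]]) (auto intro: inv_K)
  then obtain c where c: "right_mean (\<lambda>x. f (inv x)) c" using right_mean_exists by blast
  have "\<exists>S. S \<noteq> [] \<and> set S \<subseteq> K \<and> (\<forall>x\<in>K. \<bar>lavg S f x - c\<bar> < e)" if e: "e > 0" for e
  proof -
    obtain S where S: "S \<noteq> []" "set S \<subseteq> K" "\<forall>x\<in>K. \<bar>ravg S (\<lambda>x. f (inv x)) x - c\<bar> < e"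
      using right_meanD[OF c e] by blast
    have "lavg (map (\<lambda>s. inv s) S) f x = ravg S (\<lambda>x. f (inv x)) (inv x)" for x
      by (simp add: lavg_def ravg_def o_def carrier inv_mult_group)
    then show ?thesis
      using S inv_K by (intro exI[of _ "map (\<lambda>s. inv s) S"]) auto
  qed
  then show ?thesis unfolding left_mean_def by blast
qed

text \<open>Averaging on both sides at once gives a number within e of both constants, since left
  and right averages commute (\<open>lavg_ravg\<close>).\<close>

lemma right_left_mean_eq:
  assumes "right_mean f c" "left_mean f d" shows "c = d"
proof (rule ccontr)
  assume "c \<noteq> d"
  define e where "e = \<bar>c - d\<bar> / 3"
  have e: "e > 0" using \<open>c \<noteq> d\<close> by (simp add: e_def)
  obtain S where S: "S \<noteq> []" "set S \<subseteq> K" "\<And>x. x \<in> K \<Longrightarrow> \<bar>ravg S f x - c\<bar> < e"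
    using right_meanD[OF assms(1) e] by blast
  obtain T where T: "T \<noteq> []" "set T \<subseteq> K" "\<And>x. x \<in> K \<Longrightarrow> \<bar>lavg T f x - d\<bar> < e"
    using left_meanD[OF assms(2) e] by blast
  have "\<bar>lavg T (ravg S f) \<one> - c\<bar> \<le> e"
    unfolding lavg_def by (rule sum_list_average_abs[OF T(1)])
      (use S(3) T(2) in \<open>auto simp: carrier less_imp_le subset_iff\<close>)
  moreover have "\<bar>ravg S (lavg T f) \<one> - d\<bar> \<le> e"
    unfolding ravg_def by (rule sum_list_average_abs[OF S(1)])
      (use T(3) S(2) in \<open>auto simp: carrier less_imp_le subset_iff\<close>)
  ultimately have "\<bar>c - d\<bar> \<le> 2 * e" unfolding lavg_ravg by linarith
  then show False using e by (simp add: e_def)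
qed

section \<open>Linearity, positivity and invariance of the mean\<close>

lemma right_mean_mean: "continuous_on K f \<Longrightarrow> right_mean f (mean f)"
  unfolding mean_def using right_mean_exists someI_ex by metis

lemma left_mean_mean: "continuous_on K f \<Longrightarrow> left_mean f (mean f)"
  using left_mean_exists right_left_mean_eq right_mean_mean by metis

lemma mean_eqI: "continuous_on K f \<Longrightarrow> right_mean f c \<Longrightarrow> mean f = c"
  using left_mean_mean right_left_mean_eq by metis

lemma mean_cong: "(\<And>x. x \<in> K \<Longrightarrow> f x = g x) \<Longrightarrow> mean f = mean g"
proof -
  assume eq: "\<And>x. x \<in> K \<Longrightarrow> f x = g x"
  have "ravg S f x = ravg S g x" if "set S \<subseteq> K" "x \<in> K" for S x
    using that by (auto simp: ravg_def intro!: arg_cong[of _ _ "\<lambda>y. y / _"] arg_cong[of _ _ sum_list] eq mult_K)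
  then have "right_mean f = right_mean g" unfolding right_mean_def by (intro ext) (metis (no_types, lifting))
  then show ?thesis by (simp add: mean_def)
qed

lemma continuous_on_left_translate:
  "continuous_on K f \<Longrightarrow> k \<in> K \<Longrightarrow> continuous_on K (\<lambda>x. f (k \<otimes> x))"
  by (rule continuous_on_compose2[OF continuous_on_translate, of f K "\<lambda>x. (k, x)", simplified])
    (auto intro!: continuous_on_Pair continuous_on_const continuous_on_id)

text \<open>Left translation commutes with right averages, so the lists that approximate the mean of
  f work for its translate as well.\<close>

lemma mean_left_translate:
  assumes "continuous_on K f" "k \<in> K"
  shows "mean (\<lambda>x. f (k \<otimes> x)) = mean f"
proof (rule mean_eqI[OF continuous_on_left_translate[OF assms]])
  have "ravg S (\<lambda>x. f (k \<otimes> x)) x = ravg S f (k \<otimes> x)" for S x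
    by (simp add: ravg_def m_assoc carrier)
  then show "right_mean (\<lambda>x. f (k \<otimes> x)) (mean f)"
    using right_mean_mean[OF assms(1)] assms(2) mult_K unfolding right_mean_def by metis
qed

lemma mean_bounds:
  assumes f: "continuous_on K f" and b: "\<And>x. x \<in> K \<Longrightarrow> a \<le> f x" "\<And>x. x \<in> K \<Longrightarrow> f x \<le> b"
  shows "a \<le> mean f" "mean f \<le> b"
proof -
  have "a - e \<le> mean f \<and> mean f \<le> b + e" if e: "e > 0" for e
  proof -
    obtain S where S: "S \<noteq> []" "set S \<subseteq> K" "\<forall>x\<in>K. \<bar>ravg S f x - mean f\<bar> < e"
      using right_meanD[OF right_mean_mean[OF f] e] by blast
    have "a \<le> ravg S f \<one>" "ravg S f \<one> \<le> b"
      unfolding ravg_def using S b by (intro sum_list_average_bounds(1)[OF S(1), of a _ b]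
          sum_list_average_bounds(2)[OF S(1), of a _ b]; auto simp: carrier)+
    then show ?thesis using S(3) one_K by (smt (verit) abs_less_iff)
  qed
  then show "a \<le> mean f" "mean f \<le> b"
    by (smt (verit, best) field_le_epsilon)+
qed

lemma mean_const: "mean (\<lambda>x. c) = c"
  using mean_bounds[of "\<lambda>x. c" c c] by auto

lemma mean_abs_le:
  assumes "continuous_on K f" "\<And>x. x \<in> K \<Longrightarrow> \<bar>f x\<bar> \<le> b" shows "\<bar>mean f\<bar> \<le> b"
proof -
  have "- b \<le> f x" "f x \<le> b" if "x \<in> K" for x using assms(2)[OF that] by linarith+
  then show ?thesis using mean_bounds[OF assms(1), of "- b" b] by (simp add: abs_le_iff)
qed

lemma mean_pos:
  assumes f: "continuous_on K f" and "\<And>x. x \<in> K \<Longrightarrow> 0 < f x" shows "0 < mean f"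
proof -
  obtain lo where lo: "lo \<in> K" "\<And>x. x \<in> K \<Longrightarrow> f lo \<le> f x"
    using continuous_attains_inf[OF compact _ f] one_K by auto
  obtain hi where hi: "\<And>x. x \<in> K \<Longrightarrow> f x \<le> f hi"
    using continuous_attains_sup[OF compact _ f] one_K by auto
  show ?thesis using mean_bounds(1)[OF f lo(2) hi] assms(2)[OF lo(1)] by linarith
qed

text \<open>Keeps track of the mean of g after averaging over a list that was chosen for another
  function, as happens in the proof of additivity.\<close>

lemma left_mean_ravg:
  assumes "T \<noteq> []" "set T \<subseteq> K" "left_mean g d" shows "left_mean (ravg T g) d"
  unfolding left_mean_def
proof (intro allI impI)
  fix e :: real assume "e > 0"
  obtain S where S: "S \<noteq> []" "set S \<subseteq> K" "\<forall>x\<in>K. \<bar>lavg S g x - d\<bar> < e / 2"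
    using left_meanD[OF assms(3) half_gt_zero[OF \<open>e > 0\<close>]] by blast
  have "\<bar>lavg S (ravg T g) x - d\<bar> < e" if x: "x \<in> K" for x
  proof -
    have "\<bar>ravg T (lavg S g) x - d\<bar> \<le> e / 2"
      unfolding ravg_def by (rule sum_list_average_abs[OF assms(1)])
        (use S(3) assms(2) mult_K that in \<open>auto simp: less_imp_le subset_iff\<close>)
    then show ?thesis using \<open>e > 0\<close> unfolding lavg_ravg by linarith
  qed
  then show "\<exists>S. S \<noteq> [] \<and> set S \<subseteq> K \<and> (\<forall>x\<in>K. \<bar>lavg S (ravg T g) x - d\<bar> < e)"
    using S by blast
qed

lemma continuous_on_ravg:
  assumes f: "continuous_on K f" and "set T \<subseteq> K" shows "continuous_on K (ravg T f)"
proof -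
  have "continuous_on K (\<lambda>x. f (x \<otimes> t))" if "t \<in> K" for t
    by (rule continuous_on_compose2[OF continuous_on_translate[OF f], of K "\<lambda>x. (x, t)", simplified])
      (use that in \<open>auto intro!: continuous_on_Pair continuous_on_const continuous_on_id\<close>)
  then have "continuous_on K (\<lambda>x. \<Sum>t\<leftarrow>T. f (x \<otimes> t))"
    using assms(2) by (induction T) (auto intro!: continuous_intros)
  then show ?thesis unfolding ravg_def[abs_def] divide_inverse by (intro continuous_intros)
qed

text \<open>A list \<open>T\<close> that is good for f need not be good for g. Averaging g over
  \<open>T\<close> does not change its mean, so some \<open>S\<close> is good for the averaged g;
  averaging the nearly constant \<open>ravg T f\<close> over \<open>S\<close> does no harm, and the
  products of both lists serve f and g at once.\<close>

lemma mean_add: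
  assumes f: "continuous_on K f" and g: "continuous_on K g"
  shows "mean (\<lambda>x. f x + g x) = mean f + mean g"
proof (rule mean_eqI)
  show "continuous_on K (\<lambda>x. f x + g x)" using f g by (intro continuous_intros)
  show "right_mean (\<lambda>x. f x + g x) (mean f + mean g)"
    unfolding right_mean_def
  proof (intro allI impI)
    fix e :: real assume e: "e > 0"
    obtain T where T: "T \<noteq> []" "set T \<subseteq> K" "\<forall>x\<in>K. \<bar>ravg T f x - mean f\<bar> < e / 2"
      using right_meanD[OF right_mean_mean[OF f] half_gt_zero[OF e]] by blast
    have "right_mean (ravg T g) (mean g)"
      using right_left_mean_eq right_mean_mean[OF continuous_on_ravg[OF g T(2)]]
        left_mean_ravg[OF T(1,2) left_mean_mean[OF g]] by metis
    then obtain S where S: "S \<noteq> []" "set S \<subseteq> K" "\<forall>x\<in>K. \<bar>ravg S (ravg T g) x - mean g\<bar> < e / 2"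
      using right_meanD[OF _ half_gt_zero[OF e]] by blast
    define R where "R = concat (map (\<lambda>s. map (\<lambda>t. s \<otimes> t) T) S)"
    have R: "R \<noteq> []" "set R \<subseteq> K" using S(1,2) T(1,2) by (auto simp: R_def subset_iff intro!: mult_K)
    have "\<bar>ravg R (\<lambda>x. f x + g x) x - (mean f + mean g)\<bar> < e" if x: "x \<in> K" for x
    proof -
      have "\<bar>ravg S (ravg T f) x - mean f\<bar> \<le> e / 2"
        unfolding ravg_def[of S] by (rule sum_list_average_abs[OF S(1)])
          (use T(3) S(2) mult_K x in \<open>auto simp: less_imp_le subset_iff\<close>)
      moreover have "ravg R (\<lambda>x. f x + g x) x = ravg R f x + ravg R g x"
        by (simp add: ravg_def sum_list_addf add_divide_distrib)
      moreover have "\<bar>ravg S (ravg T g) x - mean g\<bar> < e / 2" using S(3) x by blast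
      ultimately show ?thesis unfolding ravg_ravg R_def[symmetric] by linarith
    qed
    then show "\<exists>S. S \<noteq> [] \<and> set S \<subseteq> K \<and> (\<forall>x\<in>K. \<bar>ravg S (\<lambda>x. f x + g x) x - (mean f + mean g)\<bar> < e)"
      using R by blast
  qed
qed

lemma mean_cmult:
  assumes f: "continuous_on K f" shows "mean (\<lambda>x. c * f x) = c * mean f"
proof (cases "c = 0")
  case False
  show ?thesis
  proof (rule mean_eqI)
    show "continuous_on K (\<lambda>x. c * f x)" using f by (intro continuous_intros)
    have "ravg S (\<lambda>x. c * f x) x = c * ravg S f x" for S x
      by (simp add: ravg_def sum_list_const_mult)
    moreover have "\<bar>c * a - c * b\<bar> < e \<longleftrightarrow> \<bar>a - b\<bar> < e / \<bar>c\<bar>" for a b e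
      using False by (simp add: pos_less_divide_eq mult.commute[of _ "\<bar>c\<bar>"] abs_mult flip: right_diff_distrib)
    ultimately show "right_mean (\<lambda>x. c * f x) (c * mean f)"
      using right_mean_mean[OF f] False unfolding right_mean_def by simp
  qed
qed (simp add: mean_const)

lemma mean_diff:
  "continuous_on K f \<Longrightarrow> continuous_on K g \<Longrightarrow> mean (\<lambda>x. f x - g x) = mean f - mean g"
  using mean_add[of f "\<lambda>x. (- 1) * g x"] mean_cmult[of g "- 1"] by (auto intro: continuous_intros)

text \<open>The parameter k lives in a mere topological space, so only p is differentiated; joint
  continuity on S \<times> L is what makes the estimates uniform in k.\<close>

primrec param_C_k :: "nat \<Rightarrow> 'a::real_normed_vector set \<Rightarrow> 'k::topological_space set \<Rightarrow> ('a \<Rightarrow> 'k \<Rightarrow> real) \<Rightarrow> bool" where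
  "param_C_k 0 S L H \<longleftrightarrow> continuous_on (S \<times> L) (\<lambda>(p, k). H p k)"
| "param_C_k (Suc n) S L H \<longleftrightarrow> continuous_on (S \<times> L) (\<lambda>(p, k). H p k) \<and>
     (\<forall>k\<in>L. \<forall>p\<in>S. (\<lambda>p. H p k) differentiable (at p)) \<and>
     (\<forall>v. param_C_k n S L (\<lambda>p k. frechet_derivative (\<lambda>p. H p k) (at p) v))"

lemma param_C_k_continuous: "param_C_k n S L H \<Longrightarrow> continuous_on (S \<times> L) (\<lambda>(p, k). H p k)"
  by (cases n) auto

lemma param_C_k_slice:
  assumes "param_C_k n S L H" "p \<in> S" shows "continuous_on L (H p)"
  by (rule continuous_on_compose2[OF param_C_k_continuous[OF assms(1)], of L "\<lambda>k. (p, k)", simplified])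
    (use assms(2) in \<open>auto intro!: continuous_on_Pair continuous_on_const continuous_on_id\<close>)

text \<open>Differentiation under the mean: the remainder of the linear approximation in p is
  bounded uniformly in k, and the mean respects bounds and linear combinations.\<close>

lemma C_k_on_mean:
  fixes H :: "'a::euclidean_space \<Rightarrow> 'g \<Rightarrow> real"
  assumes S: "open S" and H: "param_C_k n S K H"
  shows "C_k_on n S (\<lambda>p. mean (H p))"
  using H
proof (induction n arbitrary: H)
  case 0
  note H = param_C_k_continuous[OF 0] and Hs = param_C_k_slice[OF 0]
  have "\<exists>d>0. \<forall>q\<in>S. dist q p < d \<longrightarrow> dist (mean (H q)) (mean (H p)) < e" if p: "p \<in> S" and e: "e > 0" for p e
  proof -
    have "e / 2 > 0" using e by simp
    obtain U where U: "open U" "p \<in> U" "\<And>q k. q \<in> U \<inter> S \<Longrightarrow> k \<in> K \<Longrightarrow> dist (H q k) (H p k) < e / 2"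
      using continuous_on_compact_uniform[OF H p compact \<open>e / 2 > 0\<close>] by blast
    obtain d where d: "d > 0" "ball p d \<subseteq> U" using U(1,2) openE by blast
    have "dist (mean (H q)) (mean (H p)) < e" if q: "q \<in> S" "dist q p < d" for q
    proof -
      have qU: "q \<in> U \<inter> S" using q d by (auto simp: dist_commute)
      have "\<bar>mean (\<lambda>k. H q k - H p k)\<bar> \<le> e / 2"
        using U(3)[OF qU] p q(1) Hs
        by (intro mean_abs_le continuous_intros) (auto simp: dist_real_def less_imp_le)
      then show ?thesis using e mean_diff[OF Hs[OF q(1)] Hs[OF p]] by (simp add: dist_real_def)
    qed
    then show ?thesis using d by blast
  qed
  then show ?case by (simp add: continuous_on_iff)
next
  case (Suc n)
  let ?D = "\<lambda>p k v. frechet_derivative (\<lambda>p. H p k) (at p) v"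
  have D: "((\<lambda>p. H p k) has_derivative ?D p k) (at p)" if "p \<in> S" "k \<in> K" for p k
    using Suc.prems that by (auto simp flip: frechet_derivative_works)
  have PD: "param_C_k n S K (\<lambda>p k. ?D p k v)" for v using Suc.prems by simp
  note Hs = param_C_k_slice[OF Suc.prems] and Ds = param_C_k_slice[OF PD]
  have bl: "bounded_linear (\<lambda>v. mean (\<lambda>k. ?D p k v))" if p: "p \<in> S" for p
  proof (intro linear_conv_bounded_linear[THEN iffD1] linearI)
    fix u v
    have "mean (\<lambda>k. ?D p k (u + v)) = mean (\<lambda>k. ?D p k u + ?D p k v)"
      by (rule mean_cong) (use D[OF p] has_derivative_linear linear_add in blast)
    then show "mean (\<lambda>k. ?D p k (u + v)) = mean (\<lambda>k. ?D p k u) + mean (\<lambda>k. ?D p k v)"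
      by (simp add: mean_add Ds[OF p])
  next
    fix c u
    have "mean (\<lambda>k. ?D p k (c *\<^sub>R u)) = mean (\<lambda>k. c * ?D p k u)"
      by (rule mean_cong) (use D[OF p] has_derivative_linear linear_cmul in \<open>metis real_scaleR_def\<close>)
    then show "mean (\<lambda>k. ?D p k (c *\<^sub>R u)) = c *\<^sub>R mean (\<lambda>k. ?D p k u)"
      by (simp add: mean_cmult Ds[OF p])
  qed
  have "((\<lambda>p. mean (H p)) has_derivative (\<lambda>v. mean (\<lambda>k. ?D p k v))) (at p)" if p: "p \<in> S" for p
    unfolding has_derivative_at_alt
  proof (intro conjI bl[OF p] allI impI)
    fix e :: real assume e: "e > 0"
    \<comment> \<open>Continuity of the derivative is known for one direction at a time; the errors
      of the \<open>DIM('a)\<close> basis directions add up to e.\<close>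
    define e' where "e' = e / DIM('a)"
    have e': "e' > 0" using e by (simp add: e'_def)
    have "\<exists>U. open U \<and> p \<in> U \<and> (\<forall>q\<in>U \<inter> S. \<forall>k\<in>K. dist (?D q k b) (?D p k b) < e')" for b
      by (rule continuous_on_compact_uniform[OF param_C_k_continuous[OF PD] p compact e'])
    then obtain U where U: "\<And>b. open (U b)" "\<And>b. p \<in> U b"
      "\<And>b q k. q \<in> U b \<inter> S \<Longrightarrow> k \<in> K \<Longrightarrow> dist (?D q k b) (?D p k b) < e'" by metis
    have "open (S \<inter> (\<Inter>b\<in>Basis. U b))" using S U(1) by (intro open_Int open_INT) auto
    then obtain d where d: "d > 0" "ball p d \<subseteq> S \<inter> (\<Inter>b\<in>Basis. U b)"
      using U(2) p openE[of "S \<inter> (\<Inter>b\<in>Basis. U b)" p] by auto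
    have "norm (mean (H q) - mean (H p) - mean (\<lambda>k. ?D p k (q - p))) \<le> e * norm (q - p)"
      if q: "norm (q - p) < d" for q
    proof -
      have qS: "q \<in> S" using q d by (auto simp: dist_norm norm_minus_commute subset_iff)
      have "\<bar>H q k - H p k - ?D p k (q - p)\<bar> \<le> e * norm (q - p)" if k: "k \<in> K" for k
      proof -
        have "norm (H q k - H p k - ?D p k (q - p)) \<le> norm (q - p) * e"
        \<comment> \<open>The mean value inequality for H minus its linear part at p; the ball does
          not depend on k.\<close>
        proof (rule differentiable_bound_linearization[where S = "ball p d" and f = "\<lambda>p. H p k" and f' = "\<lambda>p. ?D p k"])
          show "p + t *\<^sub>R (q - p) \<in> ball p d" if "t \<in> {0..1}" for t
          proof -
            have "norm (t *\<^sub>R (q - p)) \<le> 1 * norm (q - p)" using that by (auto intro!: mult_left_le_one_le)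
            then show ?thesis using q by (simp add: dist_norm)
          qed
          fix x assume x: "x \<in> ball p d"
          then have xS: "x \<in> S" "\<And>b. b \<in> Basis \<Longrightarrow> x \<in> U b \<inter> S" using d by auto
          show "((\<lambda>p. H p k) has_derivative ?D x k) (at x within ball p d)"
            using D[OF xS(1) k] by (rule has_derivative_at_withinI)
          show "onorm (?D x k - ?D p k) \<le> e"
          proof (rule onorm_le)
            fix v
            have lin: "linear (\<lambda>v. ?D x k v - ?D p k v)"
              using D[OF xS(1) k] D[OF p k] by (intro linear_compose_sub has_derivative_linear) auto
            have "?D x k v - ?D p k v = (\<Sum>b\<in>Basis. (v \<bullet> b) * (?D x k b - ?D p k b))"
              using linear_sum[OF lin, of "\<lambda>b. (v \<bullet> b) *\<^sub>R b" Basis]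
              by (simp add: euclidean_representation linear_cmul[OF lin])
            also have "norm \<dots> \<le> (\<Sum>b\<in>(Basis::'a set). norm v * e')"
            proof (rule sum_norm_le)
              fix b :: 'a assume b: "b \<in> Basis"
              have "dist (?D x k b) (?D p k b) < e'" using U(3)[OF xS(2)[OF b] k] .
              then show "norm ((v \<bullet> b) * (?D x k b - ?D p k b)) \<le> norm v * e'"
                unfolding norm_mult using Basis_le_norm[OF b, of v]
                by (intro mult_mono) (auto simp: dist_real_def)
            qed
            also have "\<dots> = e * norm v" by (simp add: e'_def)
            finally show "norm ((?D x k - ?D p k) v) \<le> e * norm v" by simp
          qed
        qed (use d in auto)
        then show ?thesis by (simp add: mult.commute)
      qed
      then have "\<bar>mean (\<lambda>k. H q k - H p k - ?D p k (q - p))\<bar> \<le> e * norm (q - p)"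
        by (intro mean_abs_le continuous_intros Hs Ds qS p)
      moreover have "mean (\<lambda>k. H q k - H p k - ?D p k (q - p)) = mean (H q) - mean (H p) - mean (\<lambda>k. ?D p k (q - p))"
        using mean_diff[OF continuous_on_diff[OF Hs[OF qS] Hs[OF p]] Ds[OF p]] mean_diff[OF Hs[OF qS] Hs[OF p]]
        by simp
      ultimately show ?thesis by simp
    qed
    then show "\<exists>d>0. \<forall>q. norm (q - p) < d \<longrightarrow>
        norm (mean (H q) - mean (H p) - mean (\<lambda>k. ?D p k (q - p))) \<le> e * norm (q - p)"
      using d by blast
  qed
  then show ?case
    using Suc.IH[OF PD] by (intro C_k_on_SucI[OF S]) auto
qed

text \<open>A compact subgroup is covered by several charts of the ambient group, and coordinates
  for k exist only inside each of them.\<close>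

lemma param_C_k_local:
  fixes S :: "'a::real_normed_vector set" and L :: "'k::topological_space set"
  assumes "\<And>k. k \<in> L \<Longrightarrow> \<exists>T. open T \<and> k \<in> T \<and> param_C_k n S (L \<inter> T) H"
  shows "param_C_k n S L H"
proof -
  have cont: "continuous_on (S \<times> L) (\<lambda>(p, k). H p k)"
    if loc: "\<And>k. k \<in> L \<Longrightarrow> \<exists>T. open T \<and> k \<in> T \<and> continuous_on (S \<times> (L \<inter> T)) (\<lambda>(p, k). H p k)"
    for H :: "'a \<Rightarrow> 'k \<Rightarrow> real"
    unfolding continuous_on_def
  proof
    fix z assume z: "z \<in> S \<times> L"
    then obtain T where T: "open T" "snd z \<in> T" "continuous_on (S \<times> (L \<inter> T)) (\<lambda>(p, k). H p k)"
      using loc[of "snd z"] by auto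
    have "at z within S \<times> L = at z within S \<times> (L \<inter> T)"
      by (rule at_within_nhd[of _ "UNIV \<times> T"]) (use T z in \<open>auto intro: open_Times\<close>)
    then show "((\<lambda>(p, k). H p k) \<longlongrightarrow> (\<lambda>(p, k). H p k) z) (at z within S \<times> L)"
      using T z by (auto simp: continuous_on_def)
  qed
  show ?thesis using assms
  proof (induction n arbitrary: H)
    case 0
    then show ?case by (auto intro!: cont)
  next
    case (Suc n)
    have "param_C_k n S L (\<lambda>p k. frechet_derivative (\<lambda>p. H p k) (at p) v)" for v
      by (rule Suc.IH) (use Suc.prems in fastforce)
    moreover have "continuous_on (S \<times> L) (\<lambda>(p, k). H p k)"
      by (rule cont) (use Suc.prems in fastforce)
    moreover have "(\<lambda>p. H p k) differentiable (at p)" if "k \<in> L" "p \<in> S" for k p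
      using Suc.prems[OF that(1)] that by auto
    ultimately show ?case by simp
  qed
qed

end

section \<open>The exponential map\<close>

lemma frechet_derivative_partial_snd:
  fixes \<Phi> :: "'a::real_normed_vector \<times> 'b::real_normed_vector \<Rightarrow> 'c::real_normed_vector"
  assumes "smooth_on S \<Phi>" "(p, a) \<in> S"
  shows "((\<lambda>q. \<Phi> (p, q)) has_derivative (\<lambda>v. frechet_derivative \<Phi> (at (p, a)) (0, v))) (at a)"
    and "frechet_derivative (\<lambda>q. \<Phi> (p, q)) (at a) v = frechet_derivative \<Phi> (at (p, a)) (0, v)"
proof -
  have "((\<lambda>q. (p, q)) has_derivative (\<lambda>v. (0, v))) (at a)"
    by (auto intro!: derivative_eq_intros)
  from diff_chain_at[OF this smooth_on_has_derivative[OF assms]]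
  show d: "((\<lambda>q. \<Phi> (p, q)) has_derivative (\<lambda>v. frechet_derivative \<Phi> (at (p, a)) (0, v))) (at a)"
    by (simp add: o_def)
  then show "frechet_derivative (\<lambda>q. \<Phi> (p, q)) (at a) v = frechet_derivative \<Phi> (at (p, a)) (0, v)"
    using frechet_derivative_at by metis
qed

text \<open>The common source of smoothness for \<open>lfield\<close>, \<open>lie_deriv\<close> and
  \<open>Ad\<close>, each of which is a derivative at the fixed point \<open>base\<close> in a
  second variable.\<close>

lemma smooth_on_partial_snd:
  fixes \<Phi> :: "'a::euclidean_space \<times> 'b::euclidean_space \<Rightarrow> 'c::real_normed_vector"
  assumes "smooth_on S \<Phi>" "open T" "\<And>p. p \<in> T \<Longrightarrow> (p, a) \<in> S"
  shows "smooth_on T (\<lambda>p. frechet_derivative (\<lambda>q. \<Phi> (p, q)) (at a) v)"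
proof -
  have "smooth_on T (\<lambda>p::'a. (p, a))"
    by (rule smooth_on_Pair[OF assms(2) smooth_on_bounded_linear[OF bounded_linear_ident] smooth_on_const])
  then have "smooth_on T (\<lambda>p. frechet_derivative \<Phi> (at (p, a)) (0, v))"
    by (rule smooth_on_comp[OF assms(2) _ smooth_on_frechet[OF assms(1)]]) (use assms(3) in auto)
  then show ?thesis
    by (rule smooth_on_cong[OF assms(2), rotated])
      (simp add: frechet_derivative_partial_snd(2)[OF assms(1) assms(3)])
qed

lemma smooth_on_imp_lipschitz_cball:
  fixes f :: "'a::euclidean_space \<Rightarrow> 'b::real_normed_vector"
  assumes "smooth_on S f" "cball p r \<subseteq> S"
  obtains L where "\<And>x y. x \<in> cball p r \<Longrightarrow> y \<in> cball p r \<Longrightarrow> norm (f x - f y) \<le> L * norm (x - y)"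
proof -
  have "\<exists>C. \<forall>x\<in>cball p r. norm (frechet_derivative f (at x) b) \<le> C" for b
  proof -
    have "continuous_on (cball p r) (\<lambda>x. frechet_derivative f (at x) b)"
      by (rule continuous_on_subset[OF smooth_on_imp_continuous_on[OF smooth_on_frechet[OF assms(1)]] assms(2)])
    then have "bounded ((\<lambda>x. frechet_derivative f (at x) b) ` cball p r)"
      by (intro compact_imp_bounded compact_continuous_image) auto
    then show ?thesis by (auto simp: bounded_iff)
  qed
  then obtain C where C: "\<And>b x. x \<in> cball p r \<Longrightarrow> norm (frechet_derivative f (at x) b) \<le> C b" by metis
  have d: "(f has_derivative frechet_derivative f (at x)) (at x)" if "x \<in> cball p r" for x
    using smooth_on_has_derivative[OF assms(1)] assms(2) that by blast
  have "norm (f x - f y) \<le> (\<Sum>b\<in>Basis. C b) * norm (x - y)" if "x \<in> cball p r" "y \<in> cball p r" for x y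
  proof (rule differentiable_bound[OF convex_cball _ _ that])
    fix z assume z: "z \<in> cball p r"
    show "(f has_derivative frechet_derivative f (at z)) (at z within cball p r)"
      using d[OF z] by (rule has_derivative_at_withinI)
    show "onorm (frechet_derivative f (at z)) \<le> (\<Sum>b\<in>Basis. C b)"
    proof (rule onorm_le)
      fix v
      have "frechet_derivative f (at z) v = (\<Sum>b\<in>Basis. (v \<bullet> b) *\<^sub>R frechet_derivative f (at z) b)"
        using d[OF z] by (intro frechet_derivative_sum_Basis) (auto simp: differentiable_def)
      also have "norm \<dots> \<le> (\<Sum>b\<in>(Basis::'a set). norm v * C b)"
        by (rule sum_norm_le) (auto intro!: mult_mono Basis_le_norm C z)
      finally show "norm (frechet_derivative f (at z) v) \<le> (\<Sum>b\<in>Basis. C b) * norm v"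
        by (simp add: sum_distrib_left mult.commute)
    qed
  qed
  then show ?thesis using that by blast
qed

section \<open>Extension of local homomorphisms on the real line\<close>

context group begin

lemma local_hom_multiple:
  fixes \<gamma> :: "real \<Rightarrow> 'a"
  assumes UNIV: "carrier G = UNIV" and h: "h > 0"
    and hom: "\<And>s t. \<bar>s\<bar> \<le> h \<Longrightarrow> \<bar>t\<bar> \<le> h \<Longrightarrow> \<gamma> (s + t) = \<gamma> s \<otimes> \<gamma> t"
    and k: "\<bar>real k * s\<bar> \<le> h"
  shows "\<gamma> (real k * s) = \<gamma> s [^] k"
  using k
proof (induction k)
  case 0
  have "\<gamma> 0 = \<gamma> 0 \<otimes> \<gamma> 0" using hom[of 0 0] h by simp
  then show ?case using l_cancel_one' UNIV by (metis UNIV_I mult_zero_left nat_pow_0 of_nat_0)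
next
  case (Suc k)
  have "real k * \<bar>s\<bar> \<le> real (Suc k) * \<bar>s\<bar>" "1 * \<bar>s\<bar> \<le> real (Suc k) * \<bar>s\<bar>"
    by (intro mult_right_mono; simp)+
  then have "\<bar>real k * s\<bar> \<le> \<bar>real (Suc k) * s\<bar>" "\<bar>s\<bar> \<le> \<bar>real (Suc k) * s\<bar>"
    by (simp_all add: abs_mult)
  then have a: "\<bar>real k * s\<bar> \<le> h" "\<bar>s\<bar> \<le> h" using Suc.prems by linarith+
  have "\<gamma> (real (Suc k) * s) = \<gamma> (real k * s + s)" by (simp add: algebra_simps)
  then show ?case using hom[OF a] Suc.IH[OF a(1)] by simp
qed

text \<open>The extension at t is the n-th power of \<gamma>(t/n) for any sufficiently large n; two
  choices n and m agree by comparison with n m.\<close>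

lemma local_hom_extend:
  fixes \<gamma> :: "real \<Rightarrow> 'a"
  assumes UNIV: "carrier G = UNIV" and h: "h > 0"
    and hom: "\<And>s t. \<bar>s\<bar> \<le> h \<Longrightarrow> \<bar>t\<bar> \<le> h \<Longrightarrow> \<gamma> (s + t) = \<gamma> s \<otimes> \<gamma> t"
  obtains \<Gamma> where "\<And>s t. \<Gamma> (s + t) = \<Gamma> s \<otimes> \<Gamma> t" "\<And>t. \<bar>t\<bar> \<le> h \<Longrightarrow> \<Gamma> t = \<gamma> t"
proof -
  note mult = local_hom_multiple[OF UNIV h hom]
  \<comment> \<open>The summand 1 keeps the exponent positive at t = 0.\<close>
  define N where "N t = nat \<lceil>\<bar>t\<bar> / h\<rceil> + 1" for t :: real
  define \<Gamma> where "\<Gamma> t = \<gamma> (t / N t) [^] N t" for t :: real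
  have small: "\<bar>t / real n\<bar> \<le> h" if "n > 0" "\<bar>t\<bar> / h \<le> real n" for t n
    using that h by (simp add: field_simps)
  have N: "N t > 0" "\<bar>t\<bar> / h \<le> real (N t)" for t
    unfolding N_def by linarith+
  have indep: "\<gamma> (t / real n) [^] n = \<gamma> (t / real m) [^] m"
    if n: "n > 0" "\<bar>t\<bar> / h \<le> real n" and m: "m > 0" "\<bar>t\<bar> / h \<le> real m" for t n m
  proof -
    have *: "\<gamma> (t / real n) = \<gamma> (t / real (n * m)) [^] m"
      if n: "n > 0" "\<bar>t\<bar> / h \<le> real n" and m: "m > 0" for n m
    proof -
      have "real m * (t / real (n * m)) = t / real n" using m by simp
      then show ?thesis using mult[of m "t / real (n * m)"] small[OF n] by simp
    qed
    show ?thesis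
      using *[OF n m(1)] *[OF m n(1)] by (simp add: nat_pow_pow UNIV mult.commute)
  qed
  have \<Gamma>: "\<Gamma> t = \<gamma> (t / real n) [^] n" if "n > 0" "\<bar>t\<bar> / h \<le> real n" for t n
    unfolding \<Gamma>_def using indep[OF N that] .
  have "\<Gamma> (s + t) = \<Gamma> s \<otimes> \<Gamma> t" for s t
  proof -
    define n where "n = N s + N t + N (s + t)"
    have n: "n > 0" "\<bar>s\<bar> / h \<le> real n" "\<bar>t\<bar> / h \<le> real n" "\<bar>s + t\<bar> / h \<le> real n"
      using N(1)[of s] N(2)[of s] N(2)[of t] N(2)[of "s + t"] unfolding n_def by linarith+
    have e: "(s + t) / n = s / n + t / n" by (simp add: add_divide_distrib)
    \<comment> \<open>The two values commute, since both products are the value of \<gamma> at the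
      same sum; therefore powers distribute over the product.\<close>
    have c: "\<gamma> (s / n) \<otimes> \<gamma> (t / n) = \<gamma> (t / n) \<otimes> \<gamma> (s / n)"
      using hom[of "s / n" "t / n"] hom[of "t / n" "s / n"] small n by (simp add: add.commute)
    have "\<Gamma> (s + t) = (\<gamma> (s / n) \<otimes> \<gamma> (t / n)) [^] n"
      using \<Gamma>[OF n(1,4)] hom[of "s / n" "t / n"] small n by (simp add: e)
    also have "\<dots> = \<gamma> (s / n) [^] n \<otimes> \<gamma> (t / n) [^] n"
      by (rule pow_mult_distrib[OF c]) (auto simp: UNIV)
    finally show ?thesis using \<Gamma>[OF n(1,2)] \<Gamma>[OF n(1,3)] by simp
  qed
  moreover have "\<Gamma> t = \<gamma> t" if "\<bar>t\<bar> \<le> h" for t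
    using \<Gamma>[of 1 t] that h by (simp add: UNIV)
  ultimately show ?thesis using that by blast
qed

lemma one_param_eq_if_eq_near_0:
  fixes \<gamma> \<delta> :: "real \<Rightarrow> 'a"
  assumes UNIV: "carrier G = UNIV" and h: "h > 0"
    and \<gamma>: "\<And>s t. \<gamma> (s + t) = \<gamma> s \<otimes> \<gamma> t" and \<delta>: "\<And>s t. \<delta> (s + t) = \<delta> s \<otimes> \<delta> t"
    and eq: "\<And>t. \<bar>t\<bar> \<le> h \<Longrightarrow> \<gamma> t = \<delta> t"
  shows "\<gamma> t = \<delta> t"
proof -
  define n where "n = nat \<lceil>\<bar>t\<bar> / h\<rceil> + 1"
  have n: "n > 0" "\<bar>t\<bar> / h \<le> real n" unfolding n_def by linarith+
  have *: "\<gamma> t = \<gamma> (t / n) [^] n" if "\<And>s t. \<gamma> (s + t) = \<gamma> s \<otimes> \<gamma> t" for \<gamma> :: "real \<Rightarrow> 'a"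
    using local_hom_multiple[OF UNIV _ that, of "\<bar>t\<bar> + 1" n "t / n"] n by simp
  have "\<bar>t / n\<bar> \<le> h" using n h by (simp add: field_simps)
  then show ?thesis using *[of \<gamma>, OF \<gamma>] *[of \<delta>, OF \<delta>] eq by simp
qed

end

section \<open>Charts and smooth maps into the group\<close>

context lie_group begin

lemma carrier_simp [simp]: "x \<in> carrier G"
  by (simp add: carrier_UNIV)

lemma chart_facts:
  assumes "(U, \<phi>) \<in> A"
  shows "open U" "open (\<phi> ` U)" "inj_on \<phi> U" "continuous_on U \<phi>" "continuous_on (\<phi> ` U) (inv_into U \<phi>)"
proof -
  have *: "open U" "open (\<phi> ` U)" "homeomorphism U (\<phi> ` U) \<phi> (inv_into U \<phi>)"
    using atlas assms unfolding smooth_atlas_def by auto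
  then show "open U" "open (\<phi> ` U)" "continuous_on U \<phi>" "continuous_on (\<phi> ` U) (inv_into U \<phi>)"
    by (auto simp: homeomorphism_def)
  show "inj_on \<phi> U" using *(3) by (auto simp: homeomorphism_def intro: inj_on_inverseI)
qed

lemma chart_at: obtains U \<phi> where "(U, \<phi>) \<in> A" "x \<in> U"
proof -
  have "x \<in> (\<Union>(U, \<phi>)\<in>A. U)" using atlas by (simp add: smooth_atlas_def)
  then show ?thesis using that by auto
qed

lemma continuous_mult: "continuous_on UNIV (\<lambda>(x, y). x \<otimes> y)"
  using smooth_mult by (simp add: smooth_map_def)

lemma continuous_inverse: "continuous_on UNIV (\<lambda>x. inv x)"
  using smooth_inv by (simp add: smooth_map_def)

lemma continuous_on_mult:
  "continuous_on S f \<Longrightarrow> continuous_on S g \<Longrightarrow> continuous_on S (\<lambda>x. f x \<otimes> g x)"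
  using continuous_on_compose2[OF continuous_mult continuous_on_Pair[of S f g]] by simp

lemma continuous_on_inverse: "continuous_on S f \<Longrightarrow> continuous_on S (\<lambda>x. inv (f x))"
  by (rule continuous_on_compose2[OF continuous_inverse]) auto

lemma isCont_mult_left:
  assumes "continuous (at t) f" shows "continuous (at t) (\<lambda>s. x \<otimes> f s)"
proof -
  have "continuous_on UNIV (\<lambda>y. x \<otimes> y)"
    by (intro continuous_on_mult continuous_on_const continuous_on_id)
  then have "isCont (\<lambda>y. x \<otimes> y) (f t)" by (simp add: continuous_on_eq_continuous_at)
  then show ?thesis using continuous_at_compose[OF assms, of "\<lambda>y. x \<otimes> y"] by (simp add: o_def)
qed

text \<open>Smoothness of maps from and into \<open>G\<close> is tested on maps from open subsets of vector spaces into
  \<open>G\<close>. These are closed under multiplication and inversion, which avoids product charts.\<close>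

definition plot :: "'a::real_normed_vector set \<Rightarrow> ('a \<Rightarrow> 'g) \<Rightarrow> bool" where
  "plot S h \<longleftrightarrow> open S \<and> continuous_on S h \<and> (\<forall>(U, \<phi>)\<in>A. smooth_on (S \<inter> h -` U) (\<lambda>p. \<phi> (h p)))"

lemma plotI:
  assumes "open S" "continuous_on S h"
    "\<And>U \<phi>. (U, \<phi>) \<in> A \<Longrightarrow> smooth_on (S \<inter> h -` U) (\<lambda>p. \<phi> (h p))"
  shows "plot S h"
  unfolding plot_def using assms by (intro conjI ballI) (simp_all add: split_paired_all)

lemma plot_open: "plot S h \<Longrightarrow> open S"
  and plot_continuous: "plot S h \<Longrightarrow> continuous_on S h"
  unfolding plot_def by simp_all

lemma plot_smooth:
  assumes "plot S h" "(U, \<phi>) \<in> A" shows "smooth_on (S \<inter> h -` U) (\<lambda>p. \<phi> (h p))"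
proof -
  have "\<forall>(U, \<phi>)\<in>A. smooth_on (S \<inter> h -` U) (\<lambda>p. \<phi> (h p))" using assms(1) by (simp add: plot_def)
  from bspec[OF this assms(2)] show ?thesis by simp
qed

lemma plot_open_vimage: "plot S h \<Longrightarrow> open U \<Longrightarrow> open (S \<inter> h -` U)"
  by (intro continuous_open_preimage plot_continuous plot_open)

lemma plot_const: "open S \<Longrightarrow> plot S (\<lambda>p. x)"
  by (intro plotI smooth_on_const continuous_on_const)

lemma plot_comp:
  fixes g :: "'b::real_normed_vector \<Rightarrow> 'a::euclidean_space"
  assumes h: "plot S h" and g: "open T" "smooth_on T g" "g ` T \<subseteq> S"
  shows "plot T (\<lambda>p. h (g p))"
proof (rule plotI)
  show "open T" by fact
  show "continuous_on T (\<lambda>p. h (g p))"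
    by (rule continuous_on_compose2[OF plot_continuous[OF h] smooth_on_imp_continuous_on[OF g(2)] g(3)])
  fix U \<phi> assume U: "(U, \<phi>) \<in> A"
  have "T \<inter> (\<lambda>p. h (g p)) -` U = T \<inter> g -` (S \<inter> h -` U)" using g(3) by auto
  moreover have "open (T \<inter> g -` (S \<inter> h -` U))"
    by (intro continuous_open_preimage smooth_on_imp_continuous_on g plot_open_vimage[OF h] chart_facts[OF U])
  ultimately show "smooth_on (T \<inter> (\<lambda>p. h (g p)) -` U) (\<lambda>p. \<phi> (h (g p)))"
    using smooth_on_comp[of "T \<inter> g -` (S \<inter> h -` U)" g, OF _ smooth_on_subset[OF g(2)] plot_smooth[OF h U]]
    by auto
qed

lemma plot_chart:
  assumes U: "(U, \<phi>) \<in> A" shows "plot (\<phi> ` U) (inv_into U \<phi>)"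
proof (rule plotI, rule chart_facts(2)[OF U], rule chart_facts(5)[OF U])
  fix V \<psi> assume V: "(V, \<psi>) \<in> A"
  have "\<phi> ` U \<inter> inv_into U \<phi> -` V = \<phi> ` (U \<inter> V)"
    using chart_facts(3)[OF U] by auto
  moreover have "smooth_on (\<phi> ` (U \<inter> V)) (\<psi> \<circ> inv_into U \<phi>)"
    using atlas U V unfolding smooth_atlas_def by blast
  ultimately show "smooth_on (\<phi> ` U \<inter> inv_into U \<phi> -` V) (\<lambda>p. \<psi> (inv_into U \<phi> p))"
    by (simp add: o_def)
qed

text \<open>The one place that works in product charts; later smoothness arguments only compose
  plots.\<close>

lemma plot_mult:
  assumes f: "plot S f" and g: "plot S g"
  shows "plot S (\<lambda>p. f p \<otimes> g p)"
proof (rule plotI)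
  show "open S" using plot_open[OF f] .
  show c: "continuous_on S (\<lambda>p. f p \<otimes> g p)"
    by (intro continuous_on_mult plot_continuous f g)
  fix U \<phi> assume U: "(U, \<phi>) \<in> A"
  show "smooth_on (S \<inter> (\<lambda>p. f p \<otimes> g p) -` U) (\<lambda>p. \<phi> (f p \<otimes> g p))"
  proof (rule smooth_on_local)
    fix x assume x: "x \<in> S \<inter> (\<lambda>p. f p \<otimes> g p) -` U"
    obtain V \<xi> where V: "(V, \<xi>) \<in> A" "f x \<in> V" using chart_at .
    obtain W \<psi> where W: "(W, \<psi>) \<in> A" "g x \<in> W" using chart_at .
    define N where "N = (S \<inter> f -` V) \<inter> (S \<inter> g -` W) \<inter> (S \<inter> (\<lambda>p. f p \<otimes> g p) -` U)"
    have N: "open N" unfolding N_def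
      by (intro open_Int plot_open_vimage f g chart_facts[OF V(1)] chart_facts[OF W(1)]
          continuous_open_preimage[OF c] plot_open[OF f] chart_facts(1)[OF U])
    let ?m = "\<lambda>(x, y). x \<otimes> y"
    have "(V \<times> W, map_prod \<xi> \<psi>) \<in> product_atlas A A"
      using V W by (auto simp: product_atlas_def)
    then have sm: "smooth_on (map_prod \<xi> \<psi> ` ((V \<times> W) \<inter> ?m -` U)) (\<phi> \<circ> ?m \<circ> inv_into (V \<times> W) (map_prod \<xi> \<psi>))"
      using smooth_mult U unfolding smooth_map_def by blast
    have sp: "smooth_on N (\<lambda>p. (\<xi> (f p), \<psi> (g p)))"
      by (intro smooth_on_Pair N smooth_on_subset[OF plot_smooth[OF f V(1)]] smooth_on_subset[OF plot_smooth[OF g W(1)]])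
        (auto simp: N_def)
    have "smooth_on N (\<lambda>p. (\<phi> \<circ> ?m \<circ> inv_into (V \<times> W) (map_prod \<xi> \<psi>)) (\<xi> (f p), \<psi> (g p)))"
      by (rule smooth_on_comp[OF N sp sm]) (force simp: N_def)
    moreover have "inv_into (V \<times> W) (map_prod \<xi> \<psi>) (\<xi> (f p), \<psi> (g p)) = (f p, g p)" if "p \<in> N" for p
    proof -
      have "inj_on (map_prod \<xi> \<psi>) (V \<times> W)"
        using chart_facts(3)[OF V(1)] chart_facts(3)[OF W(1)] by (rule map_prod_inj_on)
      then show ?thesis
        using inv_into_f_f[of "map_prod \<xi> \<psi>" "V \<times> W" "(f p, g p)"] that by (simp add: N_def)
    qed
    ultimately have "smooth_on N (\<lambda>p. \<phi> (f p \<otimes> g p))"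
      by (elim smooth_on_cong[OF N, rotated]) auto
    then show "\<exists>N. open N \<and> x \<in> N \<and> smooth_on N (\<lambda>p. \<phi> (f p \<otimes> g p))"
      using N x V W by (intro exI[of _ N]) (auto simp: N_def)
  qed
qed

lemma plot_inv:
  assumes f: "plot S f" shows "plot S (\<lambda>p. inv (f p))"
proof (rule plotI)
  show "open S" using plot_open[OF f] .
  show c: "continuous_on S (\<lambda>p. inv (f p))"
    by (intro continuous_on_inverse plot_continuous f)
  fix U \<phi> assume U: "(U, \<phi>) \<in> A"
  show "smooth_on (S \<inter> (\<lambda>p. inv (f p)) -` U) (\<lambda>p. \<phi> (inv (f p)))"
  proof (rule smooth_on_local)
    fix x assume x: "x \<in> S \<inter> (\<lambda>p. inv (f p)) -` U"
    obtain V \<xi> where V: "(V, \<xi>) \<in> A" "f x \<in> V" using chart_at .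
    define N where "N = (S \<inter> f -` V) \<inter> (S \<inter> (\<lambda>p. inv (f p)) -` U)"
    have N: "open N" unfolding N_def
      by (intro open_Int plot_open_vimage f chart_facts[OF V(1)]
          continuous_open_preimage[OF c] plot_open[OF f] chart_facts(1)[OF U])
    have sm: "smooth_on (\<xi> ` (V \<inter> (\<lambda>x. inv x) -` U)) (\<phi> \<circ> (\<lambda>x. inv x) \<circ> inv_into V \<xi>)"
      using smooth_inv U V unfolding smooth_map_def by blast
    have sp: "smooth_on N (\<lambda>p. \<xi> (f p))"
      by (rule smooth_on_subset[OF plot_smooth[OF f V(1)]]) (auto simp: N_def)
    have "smooth_on N (\<lambda>p. (\<phi> \<circ> (\<lambda>x. inv x) \<circ> inv_into V \<xi>) (\<xi> (f p)))"
      by (rule smooth_on_comp[OF N sp sm]) (auto simp: N_def)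
    then have "smooth_on N (\<lambda>p. \<phi> (inv (f p)))"
      by (elim smooth_on_cong[OF N, rotated]) (auto simp: N_def chart_facts(3)[OF V(1)])
    then show "\<exists>N. open N \<and> x \<in> N \<and> smooth_on N (\<lambda>p. \<phi> (inv (f p)))"
      using N x V by (intro exI[of _ N]) (auto simp: N_def)
  qed
qed

lemma smooth_fun_iff:
  fixes f :: "'g \<Rightarrow> 'b::euclidean_space"
  shows "smooth_fun f \<longleftrightarrow> (\<forall>(U, \<phi>)\<in>A. smooth_on (\<phi> ` U) (\<lambda>p. f (inv_into U \<phi> p)))"
proof
  assume "smooth_fun f"
  then show "\<forall>(U, \<phi>)\<in>A. smooth_on (\<phi> ` U) (\<lambda>p. f (inv_into U \<phi> p))"
    by (auto simp: smooth_fun_def smooth_map_def vector_atlas_def o_def)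
next
  assume *: "\<forall>(U, \<phi>)\<in>A. smooth_on (\<phi> ` U) (\<lambda>p. f (inv_into U \<phi> p))"
  have "continuous (at x) f" for x
  proof -
    obtain U \<phi> where U: "(U, \<phi>) \<in> A" "x \<in> U" using chart_at .
    have "continuous_on (\<phi> ` U) (\<lambda>p. f (inv_into U \<phi> p))"
      using * U by (auto intro: smooth_on_imp_continuous_on)
    then have "continuous_on U (\<lambda>x. f (inv_into U \<phi> (\<phi> x)))"
      by (rule continuous_on_compose2[OF _ chart_facts(4)[OF U(1)]]) auto
    then have "continuous_on U f"
      by (rule continuous_on_eq) (simp add: chart_facts(3)[OF U(1)])
    then show ?thesis using U(2) by (simp add: continuous_on_eq_continuous_at[OF chart_facts(1)[OF U(1)]])
  qed
  then have "continuous_on UNIV f" by (simp add: continuous_on_eq_continuous_at)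
  then show "smooth_fun f"
    using * by (auto simp: smooth_fun_def smooth_map_def vector_atlas_def o_def)
qed

lemma smooth_fun_continuous: "smooth_fun f \<Longrightarrow> continuous_on S f"
  by (rule continuous_on_subset[of UNIV]) (simp_all add: smooth_fun_def smooth_map_def)

lemma smooth_fun_plot:
  fixes f :: "'g \<Rightarrow> 'b::euclidean_space"
  assumes f: "smooth_fun f" and h: "plot S h" shows "smooth_on S (\<lambda>p. f (h p))"
proof (rule smooth_on_local)
  fix x assume x: "x \<in> S"
  obtain U \<phi> where U: "(U, \<phi>) \<in> A" "h x \<in> U" using chart_at .
  let ?N = "S \<inter> h -` U"
  have N: "open ?N" by (intro plot_open_vimage h chart_facts[OF U(1)])
  have "smooth_on (\<phi> ` U) (\<lambda>p. f (inv_into U \<phi> p))" using f U by (auto simp: smooth_fun_iff)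
  then have "smooth_on ?N (\<lambda>p. f (inv_into U \<phi> (\<phi> (h p))))"
    by (rule smooth_on_comp[OF N plot_smooth[OF h U(1)]]) auto
  then have "smooth_on ?N (\<lambda>p. f (h p))"
    by (elim smooth_on_cong[OF N, rotated]) (simp add: chart_facts(3)[OF U(1)])
  then show "\<exists>N. open N \<and> x \<in> N \<and> smooth_on N (\<lambda>p. f (h p))" using N x U by blast
qed

lemma smooth_funI_plot:
  fixes f :: "'g \<Rightarrow> 'b::euclidean_space"
  assumes "\<And>S (h :: 'e \<Rightarrow> 'g). plot S h \<Longrightarrow> smooth_on S (\<lambda>p. f (h p))"
  shows "smooth_fun f"
  unfolding smooth_fun_iff using assms plot_chart by blast

text \<open>The choice term is the one inside \<open>chart_one\<close>, so the two components belong
  to a single chart of \<open>A\<close>.\<close>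

definition dom_one :: "'g set" where
  "dom_one = fst (SOME c. c \<in> A \<and> \<one> \<in> fst c)"

definition cod_one :: "'e set" where "cod_one = chart_one ` dom_one"

definition unchart :: "'e \<Rightarrow> 'g" where "unchart = inv_into dom_one chart_one"

text \<open>The chosen chart need not be centred, so the identity may have nonzero
  coordinates.\<close>

definition base :: 'e where "base = chart_one \<one>"

lemma chart_one: "(dom_one, chart_one) \<in> A" "\<one> \<in> dom_one"
proof -
  have "\<exists>c. c \<in> A \<and> \<one> \<in> fst c" using chart_at[of \<one>] by (metis fst_conv)
  from someI_ex[OF this] show "(dom_one, chart_one) \<in> A" "\<one> \<in> dom_one"
    by (auto simp: dom_one_def chart_one_def)
qed

lemma open_dom_one: "open dom_one" and open_cod_one: "open cod_one"
  using chart_facts[OF chart_one(1)] by (auto simp: cod_one_def)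

lemma unchart_chart_one [simp]: "x \<in> dom_one \<Longrightarrow> unchart (chart_one x) = x"
  and chart_one_unchart [simp]: "p \<in> cod_one \<Longrightarrow> chart_one (unchart p) = p"
  and unchart_in [simp]: "p \<in> cod_one \<Longrightarrow> unchart p \<in> dom_one"
  and chart_one_in [simp]: "x \<in> dom_one \<Longrightarrow> chart_one x \<in> cod_one"
  using chart_facts(3)[OF chart_one(1)]
  by (auto simp: unchart_def cod_one_def f_inv_into_f inv_into_into)

lemma base_in [simp]: "base \<in> cod_one" and unchart_base [simp]: "unchart base = \<one>"
  using chart_one(2) by (auto simp: base_def)

lemma plot_unchart: "plot cod_one unchart"
  using plot_chart[OF chart_one(1)] by (simp add: unchart_def cod_one_def)

lemma continuous_on_chart_one: "continuous_on dom_one chart_one"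
  using chart_facts[OF chart_one(1)] by simp

lemma plot_fst: "plot S h \<Longrightarrow> open T \<Longrightarrow> plot (S \<times> T) (\<lambda>z. h (fst z))"
  for h :: "'a::euclidean_space \<Rightarrow> 'g" and T :: "'b::euclidean_space set"
  by (rule plot_comp[of S h]) (auto intro!: open_Times smooth_on_bounded_linear bounded_linear_fst dest: plot_open)

lemma plot_snd: "plot S h \<Longrightarrow> open T \<Longrightarrow> plot (T \<times> S) (\<lambda>z. h (snd z))"
  for h :: "'a::euclidean_space \<Rightarrow> 'g" and T :: "'b::euclidean_space set"
  by (rule plot_comp[of S h]) (auto intro!: open_Times smooth_on_bounded_linear bounded_linear_snd dest: plot_open)

text \<open>Unlike a derivative in a chart, this condition makes sense everywhere on \<open>G\<close> and is invariant under
  left translation.\<close>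

definition ltangent :: "'e \<Rightarrow> (real \<Rightarrow> 'g) \<Rightarrow> real \<Rightarrow> bool" where
  "ltangent X c t \<longleftrightarrow> continuous (at t) c \<and>
     ((\<lambda>\<tau>. chart_one (inv (c t) \<otimes> c (t + \<tau>))) has_vector_derivative X) (at 0)"

lemma inv_mult_cancel [simp]: "inv x \<otimes> (x \<otimes> y) = y" "x \<otimes> (inv x \<otimes> y) = y"
  by (simp_all flip: m_assoc)

lemma ltangent_translate: "ltangent X c t \<Longrightarrow> ltangent X (\<lambda>t. x \<otimes> c t) t"
  by (simp add: ltangent_def isCont_mult_left inv_mult_group m_assoc)

section \<open>Curves with constant left-invariant velocity\<close>

lemma has_vector_derivative_at_shift:
  fixes f :: "real \<Rightarrow> 'b::real_normed_vector"
  shows "((\<lambda>\<tau>. f (t + \<tau>)) has_vector_derivative D) (at 0) \<longleftrightarrow> (f has_vector_derivative D) (at t)"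
proof
  assume "((\<lambda>\<tau>. f (t + \<tau>)) has_vector_derivative D) (at 0)"
  then have "(((\<lambda>\<tau>. f (t + \<tau>)) \<circ> (\<lambda>s. s - t)) has_vector_derivative 1 *\<^sub>R D) (at t)"
    by (intro vector_diff_chain_at) (auto intro!: derivative_eq_intros)
  then show "(f has_vector_derivative D) (at t)" by (simp add: o_def)
next
  assume "(f has_vector_derivative D) (at t)"
  then have "((f \<circ> (\<lambda>\<tau>. t + \<tau>)) has_vector_derivative 1 *\<^sub>R D) (at 0)"
    by (intro vector_diff_chain_at) (auto intro!: derivative_eq_intros)
  then show "((\<lambda>\<tau>. f (t + \<tau>)) has_vector_derivative D) (at 0)" by (simp add: o_def)
qed

lemma has_vector_derivative_chain:
  fixes \<beta> :: "real \<Rightarrow> 'a::real_normed_vector"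
  assumes "(\<beta> has_vector_derivative X) (at t)" "(F has_derivative D) (at (\<beta> t))"
  shows "((\<lambda>t. F (\<beta> t)) has_vector_derivative D X) (at t)"
  using diff_chain_at[OF assms(1)[unfolded has_vector_derivative_def] assms(2)]
    linear_cmul[OF has_derivative_linear[OF assms(2)]]
  by (simp add: has_vector_derivative_def o_def)

text \<open>Translating by c t moves the situation to the identity, so the single chart
  \<open>chart_one\<close> suffices for functions near any point of the group.\<close>

lemma ltangent_deriv:
  fixes F :: "'g \<Rightarrow> 'b::real_normed_vector"
  assumes c: "ltangent X c t" and F: "((\<lambda>q. F (c t \<otimes> unchart q)) has_derivative D) (at base)"
  shows "((\<lambda>t. F (c t)) has_vector_derivative D X) (at t)"
proof -
  let ?b = "\<lambda>\<tau>. inv (c t) \<otimes> c (t + \<tau>)"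
  have b0: "?b 0 = \<one>" by simp
  have "continuous (at t) c" using c by (simp add: ltangent_def)
  then have "continuous (at 0) (\<lambda>\<tau>. c (t + \<tau>))" by (simp add: isCont_iff continuous_at)
  then have "continuous (at 0) ?b" by (rule isCont_mult_left)
  then have "\<forall>\<^sub>F \<tau> in at 0. ?b \<tau> \<in> dom_one"
    using chart_one(2) open_dom_one b0 by (auto simp: continuous_at elim!: topological_tendstoD)
  then have ev: "\<forall>\<^sub>F \<tau> in at 0. F (c t \<otimes> unchart (chart_one (?b \<tau>))) = F (c (t + \<tau>))"
    by eventually_elim simp
  have "((\<lambda>\<tau>. F (c t \<otimes> unchart (chart_one (?b \<tau>)))) has_vector_derivative D X) (at 0)"
    by (rule has_vector_derivative_chain[of "\<lambda>\<tau>. chart_one (?b \<tau>)"])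
      (use c F in \<open>auto simp: ltangent_def base_def\<close>)
  then have "((\<lambda>\<tau>. F (c (t + \<tau>))) has_vector_derivative D X) (at 0)"
    unfolding has_vector_derivative_def
    by (rule has_derivative_transform_eventually[OF _ ev]) (simp_all add: base_def[symmetric])
  then show ?thesis using has_vector_derivative_at_shift[of "\<lambda>t. F (c t)" t] by simp
qed

lemma smooth_on_translate:
  fixes f :: "'g \<Rightarrow> 'b::euclidean_space"
  assumes "smooth_fun f" shows "smooth_on cod_one (\<lambda>q. f (x \<otimes> unchart q))"
  by (intro smooth_fun_plot[OF assms] plot_mult plot_const plot_unchart open_cod_one)

text \<open>The left-invariant vector field of X in the coordinates \<open>chart_one\<close>; its
  integral curve through \<open>base\<close> is the one-parameter subgroup of X near time 0.\<close>

definition lfield :: "'e \<Rightarrow> 'e \<Rightarrow> 'e" where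
  "lfield X p = frechet_derivative (\<lambda>q. chart_one (unchart p \<otimes> unchart q)) (at base) X"

lemma plot_mult_unchart: "plot (cod_one \<times> cod_one) (\<lambda>z. unchart (fst z) \<otimes> unchart (snd z))"
  by (intro plot_mult plot_fst plot_snd plot_unchart open_cod_one)

lemma smooth_on_lfield: "smooth_on cod_one (lfield X)"
  unfolding lfield_def
  using smooth_on_partial_snd[OF plot_smooth[OF plot_mult_unchart chart_one(1)] open_cod_one, of base X]
  by simp

lemma translate_chart_has_derivative:
  assumes "x \<otimes> unchart p \<in> dom_one" "p \<in> cod_one"
  shows "((\<lambda>q. chart_one (x \<otimes> unchart q)) has_derivative
    frechet_derivative (\<lambda>q. chart_one (x \<otimes> unchart q)) (at p)) (at p)"
proof -
  have "plot cod_one (\<lambda>q. x \<otimes> unchart q)" by (intro plot_mult plot_const plot_unchart open_cod_one)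
  from smooth_on_has_derivative[OF plot_smooth[OF this chart_one(1)], of p] show ?thesis
    using assms by simp
qed

lemma ltangent_imp_ode:
  assumes "ltangent X c t" "c t \<in> dom_one"
  shows "((\<lambda>t. chart_one (c t)) has_vector_derivative lfield X (chart_one (c t))) (at t)"
  using ltangent_deriv[OF assms(1) translate_chart_has_derivative, of] assms
  by (simp add: lfield_def)

text \<open>The left translations by c t and by its inverse have mutually inverse derivatives, so
  the velocity \<open>lfield X\<close> at c t is carried back to X at the identity.\<close>

lemma ode_imp_ltangent:
  assumes c: "continuous (at t) c" "c t \<in> dom_one"
    and d: "((\<lambda>t. chart_one (c t)) has_vector_derivative lfield X (chart_one (c t))) (at t)"
  shows "ltangent X c t"
proof -
  let ?x = "c t" and ?p = "chart_one (c t)"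
  let ?E = "frechet_derivative (\<lambda>r. chart_one (inv ?x \<otimes> unchart r)) (at ?p)"
  let ?D = "frechet_derivative (\<lambda>q. chart_one (?x \<otimes> unchart q)) (at base)"
  have E: "((\<lambda>r. chart_one (inv ?x \<otimes> unchart r)) has_derivative ?E) (at ?p)"
    by (rule translate_chart_has_derivative) (use c chart_one in auto)
  have D: "((\<lambda>q. chart_one (?x \<otimes> unchart q)) has_derivative ?D) (at base)"
    by (rule translate_chart_has_derivative) (use c chart_one in auto)
  have "((\<lambda>q. chart_one (inv ?x \<otimes> unchart (chart_one (?x \<otimes> unchart q)))) has_derivative (\<lambda>v. ?E (?D v))) (at base)"
    using diff_chain_at[OF D, of "\<lambda>r. chart_one (inv ?x \<otimes> unchart r)" ?E] E by (simp add: o_def)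
  moreover have "\<forall>\<^sub>F q in at base. chart_one (inv ?x \<otimes> unchart (chart_one (?x \<otimes> unchart q))) = q"
  proof -
    have "open (cod_one \<inter> (\<lambda>q. ?x \<otimes> unchart q) -` dom_one)"
      by (intro plot_open_vimage plot_mult plot_const plot_unchart open_cod_one open_dom_one)
    then have "\<forall>\<^sub>F q in at base. q \<in> cod_one \<inter> (\<lambda>q. ?x \<otimes> unchart q) -` dom_one"
      by (rule eventually_at_in_open') (use c in auto)
    then show ?thesis by eventually_elim simp
  qed
  ultimately have ID: "((\<lambda>q. q) has_derivative (\<lambda>v. ?E (?D v))) (at base)"
    by (rule has_derivative_transform_eventually) (use c chart_one in \<open>auto simp: base_def\<close>)
  have ED: "?E (?D X) = X"
    using fun_cong[OF has_derivative_unique[OF ID has_derivative_ident], of X] by simp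
  have "((\<lambda>s. chart_one (inv ?x \<otimes> unchart (chart_one (c s)))) has_vector_derivative ?E (lfield X ?p)) (at t)"
    by (rule has_vector_derivative_chain[OF d E])
  moreover have "\<forall>\<^sub>F s in at t. chart_one (inv ?x \<otimes> unchart (chart_one (c s))) = chart_one (inv ?x \<otimes> c s)"
  proof -
    have "\<forall>\<^sub>F s in at t. c s \<in> dom_one"
      using c open_dom_one by (auto simp: continuous_at elim!: topological_tendstoD)
    then show ?thesis by eventually_elim simp
  qed
  ultimately have "((\<lambda>s. chart_one (inv ?x \<otimes> c s)) has_vector_derivative ?E (lfield X ?p)) (at t)"
    unfolding has_vector_derivative_def
    by (rule has_derivative_transform_eventually) (use c in auto)
  moreover have "lfield X ?p = ?D X" using c by (simp add: lfield_def)
  ultimately have "((\<lambda>s. chart_one (inv ?x \<otimes> c s)) has_vector_derivative X) (at t)"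
    using ED by simp
  then show ?thesis
    using has_vector_derivative_at_shift[of "\<lambda>s. chart_one (inv ?x \<otimes> c s)" t X] c by (simp add: ltangent_def)
qed

lemma lfield_base: "lfield X base = X"
proof -
  have "((\<lambda>q. chart_one (\<one> \<otimes> unchart q)) has_derivative (\<lambda>v. v)) (at base)"
    by (rule has_derivative_transform_within_open[OF has_derivative_ident open_cod_one]) auto
  from fun_cong[OF frechet_derivative_at[OF this], of X] show ?thesis by (simp add: lfield_def)
qed

lemma lfield_lipschitz:
  obtains r L where "r > 0" "L \<ge> 0" "cball base r \<subseteq> cod_one"
    "\<And>x y. x \<in> cball base r \<Longrightarrow> y \<in> cball base r \<Longrightarrow> norm (lfield X x - lfield X y) \<le> L * norm (x - y)"
proof -
  obtain r where r: "r > 0" "cball base r \<subseteq> cod_one"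
    using open_contains_cball open_cod_one base_in by blast
  obtain L where L: "\<And>x y. x \<in> cball base r \<Longrightarrow> y \<in> cball base r \<Longrightarrow> norm (lfield X x - lfield X y) \<le> L * norm (x - y)"
    using smooth_on_imp_lipschitz_cball[OF smooth_on_lfield r(2)] by blast
  have "norm (lfield X x - lfield X y) \<le> max L 0 * norm (x - y)" if "x \<in> cball base r" "y \<in> cball base r" for x y
    using L[OF that] mult_right_mono[of L "max L 0" "norm (x - y)"] by simp
  then show ?thesis using that[of r "max L 0"] r by auto
qed

text \<open>Serves both the uniqueness of one-parameter subgroups and the local homomorphism
  property, where the two curves are t \<mapsto> \<gamma>(s + t) and t \<mapsto> \<gamma>(s)
  \<gamma>(t).\<close>

lemma ltangent_unique_near_0:
  assumes c: "\<And>t. \<bar>t\<bar> \<le> h \<Longrightarrow> ltangent X c t" and d: "\<And>t. \<bar>t\<bar> \<le> h \<Longrightarrow> ltangent X d t"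
    and h: "0 \<le> h" "h * L < 1"
    and L: "\<And>x y. x \<in> cball base r \<Longrightarrow> y \<in> cball base r \<Longrightarrow> norm (lfield X x - lfield X y) \<le> L * norm (x - y)"
    and cr: "\<And>t. \<bar>t\<bar> \<le> h \<Longrightarrow> c t \<in> dom_one \<and> chart_one (c t) \<in> cball base r"
    and dr: "\<And>t. \<bar>t\<bar> \<le> h \<Longrightarrow> d t \<in> dom_one \<and> chart_one (d t) \<in> cball base r"
    and cd: "c 0 = d 0" and t: "\<bar>t\<bar> \<le> h"
  shows "c t = d t"
proof -
  have "chart_one (c t) = chart_one (d t)"
  proof (rule ode_unique[of "cball base r" "lfield X" L h "\<lambda>t. chart_one (c t)" "\<lambda>t. chart_one (d t)"])
    show "chart_one (c s) \<in> cball base r \<and> ((\<lambda>t. chart_one (c t)) has_vector_derivative lfield X (chart_one (c s))) (at s)"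
      if "\<bar>s\<bar> \<le> h" for s using ltangent_imp_ode c cr that by blast
    show "chart_one (d s) \<in> cball base r \<and> ((\<lambda>t. chart_one (d t)) has_vector_derivative lfield X (chart_one (d s))) (at s)"
      if "\<bar>s\<bar> \<le> h" for s using ltangent_imp_ode d dr that by blast
  qed (use h L cd t in auto)
  then show ?thesis using cr[OF t] dr[OF t] unchart_chart_one by metis
qed

section \<open>Existence and uniqueness of one-parameter subgroups\<close>

lemma one_param_zero: "one_param_subgroup \<gamma> \<Longrightarrow> \<gamma> 0 = \<one>"
proof -
  assume "one_param_subgroup \<gamma>"
  then have "\<gamma> (0 + 0) = \<gamma> 0 \<otimes> \<gamma> 0" unfolding one_param_subgroup_def by blast
  then show ?thesis using l_cancel_one'[of "\<gamma> 0" "\<gamma> 0"] by simp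
qed

lemma one_param_ltangent:
  assumes "one_param_subgroup \<gamma>" "((chart_one \<circ> \<gamma>) has_vector_derivative X) (at 0)"
  shows "ltangent X \<gamma> t"
proof -
  have "continuous (at t) \<gamma>"
    using assms(1) by (simp add: one_param_subgroup_def continuous_on_eq_continuous_at)
  moreover have "inv (\<gamma> t) \<otimes> \<gamma> (t + \<tau>) = \<gamma> \<tau>" for \<tau>
    using assms(1) by (simp add: one_param_subgroup_def)
  ultimately show ?thesis using assms(2) by (simp add: ltangent_def o_def)
qed

lemma nhd_base:
  assumes "r > 0"
  shows "open (dom_one \<inter> chart_one -` ball base r)" "\<one> \<in> dom_one \<inter> chart_one -` ball base r"
  using assms chart_one(2) continuous_open_preimage[OF continuous_on_chart_one open_dom_one]
  by (auto simp: base_def)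

lemma one_param_unique:
  assumes g: "one_param_subgroup \<gamma>" "((chart_one \<circ> \<gamma>) has_vector_derivative X) (at 0)"
    and d: "one_param_subgroup \<delta>" "((chart_one \<circ> \<delta>) has_vector_derivative X) (at 0)"
  shows "\<gamma> = \<delta>"
proof -
  obtain r L where r: "r > 0" "L \<ge> 0" "cball base r \<subseteq> cod_one"
    and L: "\<And>x y. x \<in> cball base r \<Longrightarrow> y \<in> cball base r \<Longrightarrow> norm (lfield X x - lfield X y) \<le> L * norm (x - y)"
    using lfield_lipschitz[of X] by blast
  let ?N = "dom_one \<inter> chart_one -` ball base r"
  have near: "\<exists>e>0. \<forall>t. \<bar>t\<bar> < e \<longrightarrow> \<gamma> t \<in> ?N" if "one_param_subgroup \<gamma>" for \<gamma>
  proof -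
    have "continuous (at 0) \<gamma>"
      using that by (simp add: one_param_subgroup_def continuous_on_eq_continuous_at)
    then have "\<forall>\<^sub>F t in at 0. \<gamma> t \<in> ?N"
      using nhd_base[OF r(1)] one_param_zero[OF that] topological_tendstoD unfolding continuous_at by metis
    then obtain e where e: "e > 0" "\<forall>t. t \<noteq> 0 \<and> dist t 0 < e \<longrightarrow> \<gamma> t \<in> ?N"
      by (auto simp: eventually_at)
    have "\<gamma> t \<in> ?N" if "\<bar>t\<bar> < e" for t
      using that e(2) nhd_base(2)[OF r(1)] one_param_zero[OF \<open>one_param_subgroup \<gamma>\<close>]
      by (cases "t = 0") (simp_all add: dist_real_def)
    then show ?thesis using e(1) by blast
  qed
  obtain e1 e2 where e: "e1 > 0" "\<And>t. \<bar>t\<bar> < e1 \<Longrightarrow> \<gamma> t \<in> ?N" "e2 > 0" "\<And>t. \<bar>t\<bar> < e2 \<Longrightarrow> \<delta> t \<in> ?N"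
    using near[OF g(1)] near[OF d(1)] by auto
  \<comment> \<open>Halving keeps h strictly inside both neighbourhoods; the second entry gives h L
    < 1, also when L = 0.\<close>
  define h where "h = min (min e1 e2 / 2) (1 / (L + 1) / 2)"
  have h: "h > 0" "h < e1" "h < e2" "h \<le> 1 / (L + 1) / 2" using e r by (auto simp: h_def)
  have hL: "h * L < 1"
  proof -
    have "h * L \<le> (1 / (L + 1) / 2) * L" using h r by (intro mult_right_mono) auto
    also have "\<dots> < 1" using r by (simp add: divide_simps)
    finally show ?thesis .
  qed
  have eq: "\<gamma> t = \<delta> t" if "\<bar>t\<bar> \<le> h" for t
  proof (rule ltangent_unique_near_0[OF one_param_ltangent[OF g] one_param_ltangent[OF d] _ hL L _ _ _ that])
    show "\<gamma> s \<in> dom_one \<and> chart_one (\<gamma> s) \<in> cball base r" if "\<bar>s\<bar> \<le> h" for s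
      using e(2)[of s] h that by auto
    show "\<delta> s \<in> dom_one \<and> chart_one (\<delta> s) \<in> cball base r" if "\<bar>s\<bar> \<le> h" for s
      using e(4)[of s] h that by auto
  qed (use h one_param_zero[OF g(1)] one_param_zero[OF d(1)] in auto)
  have "\<gamma> (s + t) = \<gamma> s \<otimes> \<gamma> t" "\<delta> (s + t) = \<delta> s \<otimes> \<delta> t" for s t
    using g(1) d(1) by (simp_all add: one_param_subgroup_def)
  from one_param_eq_if_eq_near_0[OF carrier_UNIV h(1) this eq] show ?thesis by (rule ext)
qed

text \<open>The differential equation is solved near time 0 only. Left translates and time shifts of
  the solution keep its left-invariant velocity, so uniqueness makes it a local homomorphism, which
  then extends to the whole line by taking powers.\<close>

lemma one_param_exists:
  "\<exists>\<gamma>. one_param_subgroup \<gamma> \<and> ((chart_one \<circ> \<gamma>) has_vector_derivative X) (at 0)"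
proof -
  obtain r L where r: "r > 0" "L \<ge> 0" "cball base r \<subseteq> cod_one"
    and L: "\<And>x y. x \<in> cball base r \<Longrightarrow> y \<in> cball base r \<Longrightarrow> norm (lfield X x - lfield X y) \<le> L * norm (x - y)"
    using lfield_lipschitz[of X] by blast
  obtain h y where h: "h > 0" and y0: "y 0 = base"
    and y: "\<And>t. \<bar>t\<bar> < h \<Longrightarrow> y t \<in> cball base r \<and> (y has_vector_derivative lfield X (y t)) (at t)"
    using ode_exists[OF r(1) L] by blast
  define \<gamma> where "\<gamma> t = unchart (y t)" for t
  have yc: "continuous (at t) y" if "\<bar>t\<bar> < h" for t
    using y[OF that] has_vector_derivative_continuous by blast
  have \<gamma>c: "continuous (at t) \<gamma>" if "\<bar>t\<bar> < h" for t
  proof -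
    have "isCont unchart (y t)"
      using plot_continuous[OF plot_unchart] y[OF that] r(3)
      by (auto simp: continuous_on_eq_continuous_at[OF open_cod_one])
    then show ?thesis using continuous_at_compose[OF yc[OF that]] unfolding \<gamma>_def o_def by blast
  qed
  have \<gamma>d: "\<gamma> t \<in> dom_one" "chart_one (\<gamma> t) = y t" if "\<bar>t\<bar> < h" for t
    using y[OF that] r(3) by (auto simp: \<gamma>_def subset_iff)
  have \<gamma>t: "ltangent X \<gamma> t" if t: "\<bar>t\<bar> < h" for t
  proof (rule ode_imp_ltangent[OF \<gamma>c[OF t] \<gamma>d(1)[OF t]])
    have "(y has_vector_derivative lfield X (y t)) (at t)" using y[OF t] by simp
    then have "((\<lambda>t. chart_one (\<gamma> t)) has_vector_derivative lfield X (y t)) (at t)"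
      by (rule has_vector_derivative_transform_within_open[of _ _ _ "{-h<..<h}"])
        (use t \<gamma>d in auto)
    then show "((\<lambda>t. chart_one (\<gamma> t)) has_vector_derivative lfield X (chart_one (\<gamma> t))) (at t)"
      by (simp add: \<gamma>d[OF t])
  qed
  have \<gamma>0: "\<gamma> 0 = \<one>" by (simp add: \<gamma>_def y0)
  let ?N = "dom_one \<inter> chart_one -` ball base r"
  \<comment> \<open>The products \<gamma>(s) \<gamma>(t) have to stay in the coordinate ball where
    the Lipschitz bound holds; continuity at (0, 0) ensures this for small s and t.\<close>
  have "continuous_on ({-h<..<h} \<times> {-h<..<h}) (\<lambda>z. \<gamma> (fst z) \<otimes> \<gamma> (snd z))"
  proof (rule continuous_on_mult)
    have "continuous_on {-h<..<h} \<gamma>" using \<gamma>c by (auto intro!: continuous_at_imp_continuous_on)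
    then show "continuous_on ({-h<..<h} \<times> {-h<..<h}) (\<lambda>z. \<gamma> (fst z))"
      "continuous_on ({-h<..<h} \<times> {-h<..<h}) (\<lambda>z. \<gamma> (snd z))"
      by (auto intro!: continuous_on_compose2[of "{-h<..<h}" \<gamma>] continuous_intros)
  qed
  then have "open (({-h<..<h} \<times> {-h<..<h}) \<inter> (\<lambda>z. \<gamma> (fst z) \<otimes> \<gamma> (snd z)) -` ?N)"
    by (intro continuous_open_preimage nhd_base(1)[OF r(1)] open_Times) auto
  moreover have "(0, 0) \<in> ({-h<..<h} \<times> {-h<..<h}) \<inter> (\<lambda>z. \<gamma> (fst z) \<otimes> \<gamma> (snd z)) -` ?N"
    using h nhd_base(2)[OF r(1)] \<gamma>0 by simp
  ultimately obtain B C where BC: "open B" "open C" "(0, 0) \<in> B \<times> C"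
    "B \<times> C \<subseteq> ({-h<..<h} \<times> {-h<..<h}) \<inter> (\<lambda>z. \<gamma> (fst z) \<otimes> \<gamma> (snd z)) -` ?N"
    by (rule open_prod_elim)
  obtain e where e: "e > 0" "ball 0 e \<subseteq> B \<inter> C"
    using BC openE[of "B \<inter> C" 0] by auto
  define k where "k = min (min e (h / 2) / 2) (1 / (L + 1) / 2)"
  have k: "k > 0" "k < e" "k < h / 2" "k \<le> 1 / (L + 1) / 2" using e h r by (auto simp: k_def)
  have kL: "k * L < 1"
  proof -
    have "k * L \<le> (1 / (L + 1) / 2) * L" using k r by (intro mult_right_mono) auto
    also have "\<dots> < 1" using r by (simp add: divide_simps)
    finally show ?thesis .
  qed
  have hom: "\<gamma> (s + t) = \<gamma> s \<otimes> \<gamma> t" if s: "\<bar>s\<bar> \<le> k" and t: "\<bar>t\<bar> \<le> k" for s t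
  proof (rule ltangent_unique_near_0[of k X "\<lambda>t. \<gamma> (s + t)" "\<lambda>t. \<gamma> s \<otimes> \<gamma> t", OF _ _ _ kL L _ _ _ t])
    fix u assume u: "\<bar>u\<bar> \<le> k"
    have su: "\<bar>s + u\<bar> < h" "\<bar>u\<bar> < h" using s u k by linarith+
    show "ltangent X (\<lambda>t. \<gamma> s \<otimes> \<gamma> t) u" by (intro ltangent_translate \<gamma>t su)
    have "continuous (at u) (\<lambda>t. \<gamma> (s + t))"
      using \<gamma>c[OF su(1)] by (intro isCont_o2[of _ "\<lambda>t. s + t" \<gamma>]) auto
    then show "ltangent X (\<lambda>t. \<gamma> (s + t)) u"
      using \<gamma>t[OF su(1)] by (simp add: ltangent_def add.assoc)
    show "\<gamma> (s + u) \<in> dom_one \<and> chart_one (\<gamma> (s + u)) \<in> cball base r"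
      using \<gamma>d[OF su(1)] y[OF su(1)] by simp
    have "s \<in> ball 0 e" "u \<in> ball 0 e" using s u k by auto
    then have "(s, u) \<in> B \<times> C" using e by blast
    then have "\<gamma> s \<otimes> \<gamma> u \<in> ?N" using BC(4) by force
    then show "\<gamma> s \<otimes> \<gamma> u \<in> dom_one \<and> chart_one (\<gamma> s \<otimes> \<gamma> u) \<in> cball base r" by auto
  qed (use k \<gamma>0 in auto)
  obtain \<Gamma> where \<Gamma>: "\<And>s t. \<Gamma> (s + t) = \<Gamma> s \<otimes> \<Gamma> t" "\<And>t. \<bar>t\<bar> \<le> k \<Longrightarrow> \<Gamma> t = \<gamma> t"
    using local_hom_extend[OF carrier_UNIV k(1) hom] by blast
  have \<Gamma>0: "continuous (at 0) \<Gamma>"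
  proof -
    have "continuous (at 0) \<gamma>" using \<gamma>c h by simp
    moreover have "\<forall>\<^sub>F t in nhds 0. \<gamma> t = \<Gamma> t"
      using \<Gamma>(2) k by (auto simp: eventually_nhds_metric dist_real_def intro!: exI[of _ k])
    ultimately show ?thesis using isCont_cong by blast
  qed
  \<comment> \<open>Continuity at 0 spreads to t through \<Gamma>(s) = \<Gamma>(t) \<Gamma>(s -
    t).\<close>
  have "continuous (at t) \<Gamma>" for t
  proof -
    have "continuous (at t) (\<lambda>s. \<Gamma> t \<otimes> \<Gamma> (s - t))"
      using \<Gamma>0 by (intro isCont_mult_left isCont_o2[of _ "\<lambda>s. s - t" \<Gamma>]) auto
    then show ?thesis by (simp flip: \<Gamma>(1))
  qed
  then have "one_param_subgroup \<Gamma>"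
    using \<Gamma>(1) by (simp add: one_param_subgroup_def continuous_on_eq_continuous_at)
  moreover have "((\<lambda>t. chart_one (\<Gamma> t)) has_vector_derivative X) (at 0)"
  proof -
    have "(y has_vector_derivative X) (at 0)" using y[of 0] h y0 lfield_base by simp
    then show ?thesis
      by (rule has_vector_derivative_transform_within_open[of _ _ _ "{-k<..<k}"])
        (use k \<Gamma>(2) \<gamma>d in auto)
  qed
  ultimately show ?thesis by (auto simp: o_def)
qed

text \<open>\<open>lie_exp\<close> evaluates a one-parameter subgroup at time 1, so multiples of X
  are handled by rescaling time.\<close>

lemma lie_exp_eq:
  assumes g: "one_param_subgroup \<gamma>" "((chart_one \<circ> \<gamma>) has_vector_derivative X) (at 0)"
  shows "lie_exp (t *\<^sub>R X) = \<gamma> t"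
proof -
  define \<delta> where "\<delta> s = \<gamma> (t * s)" for s
  have "one_param_subgroup \<delta>"
    using g(1) by (auto simp: one_param_subgroup_def \<delta>_def distrib_left
        intro!: continuous_on_compose2[of UNIV \<gamma>] continuous_intros)
  moreover have "((chart_one \<circ> \<delta>) has_vector_derivative t *\<^sub>R X) (at 0)"
  proof -
    have "(((chart_one \<circ> \<gamma>) \<circ> (\<lambda>s. t * s)) has_vector_derivative t *\<^sub>R X) (at 0)"
      by (rule vector_diff_chain_at) (use g(2) in \<open>auto intro!: derivative_eq_intros\<close>)
    then show ?thesis by (simp add: o_def \<delta>_def)
  qed
  ultimately have "(THE \<gamma>. one_param_subgroup \<gamma> \<and> ((chart_one \<circ> \<gamma>) has_vector_derivative t *\<^sub>R X) (at 0)) = \<delta>"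
    using one_param_unique by (intro the_equality) auto
  then show ?thesis by (simp add: lie_exp_def \<delta>_def)
qed

lemma lie_exp_one_param:
  "one_param_subgroup (\<lambda>t. lie_exp (t *\<^sub>R X))"
  "((chart_one \<circ> (\<lambda>t. lie_exp (t *\<^sub>R X))) has_vector_derivative X) (at 0)"
proof -
  obtain \<gamma> where g: "one_param_subgroup \<gamma>" "((chart_one \<circ> \<gamma>) has_vector_derivative X) (at 0)"
    using one_param_exists by blast
  have "(\<lambda>t. lie_exp (t *\<^sub>R X)) = \<gamma>" using lie_exp_eq[OF g] by (intro ext)
  then show "one_param_subgroup (\<lambda>t. lie_exp (t *\<^sub>R X))"
    "((chart_one \<circ> (\<lambda>t. lie_exp (t *\<^sub>R X))) has_vector_derivative X) (at 0)" using g by simp_all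
qed

lemma lie_exp_zero [simp]: "lie_exp 0 = \<one>"
  using one_param_zero[OF lie_exp_one_param(1)] by simp

lemma lie_exp_add: "lie_exp ((s + t) *\<^sub>R X) = lie_exp (s *\<^sub>R X) \<otimes> lie_exp (t *\<^sub>R X)"
  using lie_exp_one_param(1)[of X] unfolding one_param_subgroup_def by blast

lemma lie_exp_minus: "lie_exp (- X) = inv (lie_exp X)"
proof -
  have "lie_exp X \<otimes> lie_exp (- X) = \<one>" using lie_exp_add[of 1 "-1" X] by simp
  then show ?thesis using inv_equality[of "lie_exp X" "lie_exp (- X)"] inv_comm[of "lie_exp X" "lie_exp (- X)"]
    by (metis carrier_simp inv_solve_left r_one)
qed

lemma lie_exp_ltangent: "ltangent X (\<lambda>t. lie_exp (t *\<^sub>R X)) t"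
  by (rule one_param_ltangent[OF lie_exp_one_param])

lemma continuous_lie_exp: "continuous_on S (\<lambda>t. lie_exp (t *\<^sub>R X))"
  using lie_exp_one_param(1)[of X] unfolding one_param_subgroup_def by (auto intro: continuous_on_subset[of UNIV])

end

section \<open>The Lie bracket and the adjoint action\<close>

lemma frechet_derivative_partial_fst:
  fixes \<Phi> :: "'a::real_normed_vector \<times> 'b::real_normed_vector \<Rightarrow> 'c::real_normed_vector"
  assumes "smooth_on S \<Phi>" "(a, q) \<in> S"
  shows "frechet_derivative (\<lambda>p. \<Phi> (p, q)) (at a) v = frechet_derivative \<Phi> (at (a, q)) (v, 0)"
proof -
  have "((\<lambda>p. (p, q)) has_derivative (\<lambda>v. (v, 0))) (at a)"
    by (auto intro!: derivative_eq_intros)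
  from fun_cong[OF frechet_derivative_at[OF diff_chain_at[OF this smooth_on_has_derivative[OF assms]]], of v]
  show ?thesis by (simp add: o_def)
qed

lemma frechet_derivative_cong_open:
  assumes "f differentiable (at x)" "open S" "x \<in> S" "\<And>y. y \<in> S \<Longrightarrow> f y = g y"
  shows "frechet_derivative f (at x) = frechet_derivative g (at x)"
proof -
  have "(g has_derivative frechet_derivative f (at x)) (at x)"
    by (rule has_derivative_transform_within_open[of f _ _ UNIV S])
      (use assms in \<open>auto simp: frechet_derivative_works\<close>)
  then show ?thesis using frechet_derivative_at by metis
qed

context lie_group begin

lemma lie_deriv_at:
  fixes f :: "'g \<Rightarrow> 'b::euclidean_space"
  assumes f: "smooth_fun f"
  shows "((\<lambda>t. f (x \<otimes> lie_exp (t *\<^sub>R X))) has_vector_derivative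
      frechet_derivative (\<lambda>q. f (x \<otimes> lie_exp (t *\<^sub>R X) \<otimes> unchart q)) (at base) X) (at t)"
proof -
  have "ltangent X (\<lambda>t. x \<otimes> lie_exp (t *\<^sub>R X)) t" by (intro ltangent_translate lie_exp_ltangent)
  from ltangent_deriv[OF this smooth_on_has_derivative[OF smooth_on_translate[OF f] base_in]]
  show ?thesis .
qed

text \<open>Trades the exponential curve for a Frechet derivative in the chart, from which linearity
  in X and smoothness in x follow.\<close>

lemma lie_deriv_eq:
  fixes f :: "'g \<Rightarrow> 'b::euclidean_space"
  assumes "smooth_fun f"
  shows "lie_deriv X f x = frechet_derivative (\<lambda>q. f (x \<otimes> unchart q)) (at base) X"
  using vector_derivative_at[OF lie_deriv_at[OF assms, of x X 0]] by (simp add: lie_deriv_def)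

lemma lie_deriv_has_vector_derivative:
  fixes f :: "'g \<Rightarrow> 'b::euclidean_space"
  assumes "smooth_fun f"
  shows "((\<lambda>t. f (x \<otimes> lie_exp (t *\<^sub>R X))) has_vector_derivative
      lie_deriv X f (x \<otimes> lie_exp (t *\<^sub>R X))) (at t)"
  using lie_deriv_at[OF assms] by (simp add: lie_deriv_eq[OF assms])

lemma lie_deriv_has_vector_derivative_0:
  fixes f :: "'g \<Rightarrow> 'b::euclidean_space"
  assumes "smooth_fun f"
  shows "((\<lambda>t. f (x \<otimes> lie_exp (t *\<^sub>R X))) has_vector_derivative lie_deriv X f x) (at 0)"
  using lie_deriv_has_vector_derivative[OF assms, of x X 0] by simp

lemma lie_derivI:
  "((\<lambda>t. f (x \<otimes> lie_exp (t *\<^sub>R X))) has_vector_derivative D) (at 0) \<Longrightarrow> lie_deriv X f x = D"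
  by (simp add: lie_deriv_def vector_derivative_at)

lemma linear_lie_deriv:
  fixes f :: "'g \<Rightarrow> 'b::euclidean_space"
  assumes "smooth_fun f" shows "linear (\<lambda>X. lie_deriv X f x)"
  using has_derivative_linear[OF smooth_on_has_derivative[OF smooth_on_translate[OF assms] base_in]]
  by (simp add: lie_deriv_eq[OF assms])

lemma smooth_fun_lie_deriv:
  fixes f :: "'g \<Rightarrow> 'b::euclidean_space"
  assumes f: "smooth_fun f" shows "smooth_fun (lie_deriv X f)"
proof (rule smooth_funI_plot)
  fix S and h :: "'e \<Rightarrow> 'g" assume h: "plot S h"
  have "smooth_on (S \<times> cod_one) (\<lambda>z. f (h (fst z) \<otimes> unchart (snd z)))"
    by (intro smooth_fun_plot[OF f] plot_mult plot_fst plot_snd h plot_unchart open_cod_one plot_open[OF h])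
  from smooth_on_partial_snd[OF this plot_open[OF h], of base X]
  show "smooth_on S (\<lambda>p. lie_deriv X f (h p))" by (simp add: lie_deriv_eq[OF f])
qed

section \<open>Rules for smooth functions on the group and their derivatives\<close>

lemma smooth_fun_const: "smooth_fun (\<lambda>x. c :: 'b::euclidean_space)"
  by (intro smooth_funI_plot smooth_on_const)

lemma smooth_fun_add:
  fixes f g :: "'g \<Rightarrow> 'b::euclidean_space"
  assumes "smooth_fun f" "smooth_fun g" shows "smooth_fun (\<lambda>x. f x + g x)"
proof (rule smooth_funI_plot)
  fix S and h :: "'e \<Rightarrow> 'g" assume h: "plot S h"
  show "smooth_on S (\<lambda>p. f (h p) + g (h p))"
    by (rule smooth_on_add[OF plot_open[OF h] smooth_fun_plot[OF assms(1) h] smooth_fun_plot[OF assms(2) h]])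
qed

lemma smooth_fun_bilinear:
  fixes f :: "'g \<Rightarrow> 'b::euclidean_space" and g :: "'g \<Rightarrow> 'c::euclidean_space"
    and B :: "'b \<Rightarrow> 'c \<Rightarrow> 'd::euclidean_space"
  assumes "bounded_bilinear B" "smooth_fun f" "smooth_fun g" shows "smooth_fun (\<lambda>x. B (f x) (g x))"
proof (rule smooth_funI_plot)
  fix S and h :: "'e \<Rightarrow> 'g" assume h: "plot S h"
  show "smooth_on S (\<lambda>p. B (f (h p)) (g (h p)))"
    by (rule smooth_on_bilinear[OF assms(1) plot_open[OF h] smooth_fun_plot[OF assms(2) h] smooth_fun_plot[OF assms(3) h]])
qed

lemma smooth_fun_linear:
  fixes f :: "'g \<Rightarrow> 'b::euclidean_space" and L :: "'b \<Rightarrow> 'c::euclidean_space"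
  assumes "linear L" "smooth_fun f" shows "smooth_fun (\<lambda>x. L (f x))"
proof (rule smooth_funI_plot)
  fix S and h :: "'e \<Rightarrow> 'g" assume h: "plot S h"
  show "smooth_on S (\<lambda>p. L (f (h p)))"
    by (rule smooth_on_comp[OF plot_open[OF h] smooth_fun_plot[OF assms(2) h], of UNIV L])
      (use assms(1) in \<open>auto intro: smooth_on_bounded_linear simp: linear_conv_bounded_linear\<close>)
qed

lemma smooth_fun_diff:
  fixes f g :: "'g \<Rightarrow> 'b::euclidean_space"
  assumes "smooth_fun f" "smooth_fun g" shows "smooth_fun (\<lambda>x. f x - g x)"
  using smooth_fun_add[OF assms(1) smooth_fun_linear[OF _ assms(2), of uminus]]
  by (simp add: linear_uminus)

lemma smooth_fun_sum:
  fixes f :: "'i \<Rightarrow> 'g \<Rightarrow> 'b::euclidean_space"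
  assumes "\<And>i. i \<in> I \<Longrightarrow> smooth_fun (f i)" shows "smooth_fun (\<lambda>x. \<Sum>i\<in>I. f i x)"
  using assms by (induction I rule: infinite_finite_induct) (auto intro: smooth_fun_add smooth_fun_const)

lemma smooth_fun_left: "smooth_fun f \<Longrightarrow> smooth_fun (\<lambda>y. f (x \<otimes> y))"
  and smooth_fun_right: "smooth_fun f \<Longrightarrow> smooth_fun (\<lambda>y. f (y \<otimes> x))"
  for f :: "'g \<Rightarrow> 'b::euclidean_space"
  by (auto intro!: smooth_funI_plot smooth_fun_plot plot_mult plot_const dest: plot_open)

lemma lie_deriv_left: "lie_deriv X (\<lambda>y. f (x \<otimes> y)) z = lie_deriv X f (x \<otimes> z)"
  by (simp add: lie_deriv_def m_assoc)

lemma lie_deriv_add: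
  fixes f g :: "'g \<Rightarrow> 'b::euclidean_space"
  assumes "smooth_fun f" "smooth_fun g"
  shows "lie_deriv X (\<lambda>x. f x + g x) x = lie_deriv X f x + lie_deriv X g x"
  by (rule lie_derivI[OF has_vector_derivative_add[OF lie_deriv_has_vector_derivative_0[OF assms(1)]
        lie_deriv_has_vector_derivative_0[OF assms(2)]]])

lemma lie_deriv_linear:
  fixes f :: "'g \<Rightarrow> 'b::euclidean_space" and L :: "'b \<Rightarrow> 'c::euclidean_space"
  assumes "linear L" "smooth_fun f" shows "lie_deriv X (\<lambda>x. L (f x)) x = L (lie_deriv X f x)"
  by (rule lie_derivI[OF bounded_linear.has_vector_derivative[OF assms(1)[unfolded linear_conv_bounded_linear]
        lie_deriv_has_vector_derivative_0[OF assms(2)]]])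

lemma lie_deriv_bilinear:
  fixes f :: "'g \<Rightarrow> 'b::euclidean_space" and g :: "'g \<Rightarrow> 'c::euclidean_space"
    and B :: "'b \<Rightarrow> 'c \<Rightarrow> 'd::euclidean_space"
  assumes "bounded_bilinear B" "smooth_fun f" "smooth_fun g"
  shows "lie_deriv X (\<lambda>x. B (f x) (g x)) x = B (f x) (lie_deriv X g x) + B (lie_deriv X f x) (g x)"
  using bounded_bilinear.has_vector_derivative[OF assms(1)
      lie_deriv_has_vector_derivative_0[OF assms(2), of x X] lie_deriv_has_vector_derivative_0[OF assms(3), of x X]]
  by (intro lie_derivI) simp

text \<open>At points outside U the function vanishes in a whole neighbourhood: the set of G that
  corresponds to \<open>C\<close> is compact, hence closed because G is Hausdorff, and it lies
  inside U.\<close>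

lemma smooth_fun_extend:
  fixes F :: "'e \<Rightarrow> 'b::euclidean_space"
  assumes U: "(U, \<phi>) \<in> A" and F: "smooth_on UNIV F" and C: "compact C" "C \<subseteq> \<phi> ` U"
    and F0: "\<And>p. p \<notin> C \<Longrightarrow> F p = 0"
  shows "smooth_fun (\<lambda>x. if x \<in> U then F (\<phi> x) else 0)"
proof (rule smooth_funI_plot)
  fix S and h :: "'e \<Rightarrow> 'g" assume h: "plot S h"
  let ?f = "\<lambda>x. if x \<in> U then F (\<phi> x) else 0"
  show "smooth_on S (\<lambda>p. ?f (h p))"
  proof (rule smooth_on_local)
    fix p assume p: "p \<in> S"
    show "\<exists>N. open N \<and> p \<in> N \<and> smooth_on N (\<lambda>p. ?f (h p))"
    proof (cases "h p \<in> U")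
      case True
      let ?N = "S \<inter> h -` U"
      have N: "open ?N" by (intro plot_open_vimage h chart_facts[OF U])
      have "smooth_on ?N (\<lambda>p. F (\<phi> (h p)))"
        by (rule smooth_on_comp[OF N plot_smooth[OF h U] F]) simp
      then have "smooth_on ?N (\<lambda>p. ?f (h p))"
        by (rule smooth_on_cong[OF N, rotated]) simp
      then show ?thesis using N p True by blast
    next
      case False
      let ?D = "inv_into U \<phi> ` C"
      have "compact ?D"
        by (intro compact_continuous_image continuous_on_subset[OF chart_facts(5)[OF U] C(2)] C(1))
      then have "open (- ?D)" using compact_imp_closed open_Compl by blast
      then have N: "open (S \<inter> h -` (- ?D))" by (intro plot_open_vimage h)
      have "?D \<subseteq> U" using C(2) by (auto intro!: inv_into_into)
      then have "p \<in> S \<inter> h -` (- ?D)" using p False by auto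
      moreover have "?f (h q) = 0" if "q \<in> S \<inter> h -` (- ?D)" for q
      proof (cases "h q \<in> U")
        case True
        then have "\<phi> (h q) \<notin> C"
          using that chart_facts(3)[OF U] by (auto simp: image_iff)
        then show ?thesis using F0 by simp
      qed simp
      then have "smooth_on (S \<inter> h -` (- ?D)) (\<lambda>p. ?f (h p))"
        by (intro smooth_on_cong[OF N _ smooth_on_const, of 0]) simp
      ultimately show ?thesis using N by blast
    qed
  qed
qed

lemma smooth_bump_at:
  assumes "open W" "x \<in> W"
  obtains f :: "'g \<Rightarrow> real" where "smooth_fun f" "\<And>y. f y \<ge> 0" "f x > 0" "\<And>y. y \<notin> W \<Longrightarrow> f y = 0"
proof -
  obtain U \<phi> where U: "(U, \<phi>) \<in> A" "x \<in> U" using chart_at .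
  let ?O = "\<phi> ` U \<inter> inv_into U \<phi> -` W"
  have "open ?O" by (rule plot_open_vimage[OF plot_chart[OF U(1)] assms(1)])
  moreover have "\<phi> x \<in> ?O" using U assms chart_facts(3)[OF U(1)] by simp
  ultimately obtain r where r: "r > 0" "cball (\<phi> x) r \<subseteq> ?O"
    using open_contains_cball by blast
  let ?f = "\<lambda>y. if y \<in> U then bump (\<phi> x) r (\<phi> y) else 0"
  have b0: "bump (\<phi> x) r p = 0" if "p \<notin> cball (\<phi> x) r" for p
    using that r by (intro bump_eq_0) (auto simp: dist_commute)
  have "smooth_fun ?f"
    by (rule smooth_fun_extend[OF U(1) smooth_on_bump compact_cball[of "\<phi> x" r] _ b0]) (use r in auto)
  moreover have "?f x > 0" using U r by (simp add: bump_pos_iff)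
  moreover have "?f y = 0" if "y \<notin> W" for y
  proof (cases "y \<in> U")
    case True
    then have "inv_into U \<phi> (\<phi> y) \<notin> W" using that chart_facts(3)[OF U(1)] by simp
    then have "\<phi> y \<notin> cball (\<phi> x) r" using r(2) by blast
    then show ?thesis using b0 by simp
  qed simp
  moreover have "?f y \<ge> 0" for y by (simp add: bump_nonneg)
  ultimately show ?thesis using that by blast
qed

text \<open>A cut-off linear coordinate. The factor p - base vanishes at \<open>base\<close>, so the
  derivative of the bump does not contribute there, and division by the value of the bump normalises
  the result.\<close>

lemma smooth_fun_with_lie_deriv:
  fixes b :: 'e
  obtains f :: "'g \<Rightarrow> real" where "smooth_fun f" "\<And>X. lie_deriv X f \<one> = X \<bullet> b"
proof -
  obtain r where r: "r > 0" "cball base r \<subseteq> cod_one"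
    using open_contains_cball open_cod_one base_in by blast
  let ?F = "\<lambda>p. bump base r p * ((p - base) \<bullet> b / bump base r base)"
  let ?f = "\<lambda>y. if y \<in> dom_one then ?F (chart_one y) else 0"
  have b1: "bump base r base > 0" using r by (simp add: bump_pos_iff)
  have 1: "smooth_on UNIV (\<lambda>p. (1 / bump base r base) * (p \<bullet> b) + - (base \<bullet> b / bump base r base))"
    by (rule smooth_on_add[OF open_UNIV smooth_on_bounded_linear smooth_on_const])
      (intro bounded_linear_const_mult bounded_linear_inner_left)
  have "smooth_on UNIV (\<lambda>p. bump base r p * ((1 / bump base r base) * (p \<bullet> b) + - (base \<bullet> b / bump base r base)))"
    by (rule smooth_on_bilinear[OF bounded_bilinear_mult open_UNIV smooth_on_bump 1])
  then have F: "smooth_on UNIV ?F" by (simp add: inner_diff_left diff_divide_distrib)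
  have sm: "smooth_fun ?f"
  proof (rule smooth_fun_extend[OF chart_one(1) F compact_cball[of base r]])
    show "cball base r \<subseteq> chart_one ` dom_one" using r by (simp add: cod_one_def)
    show "?F p = 0" if "p \<notin> cball base r" for p
      using that r bump_eq_0[of r p base] by (auto simp: dist_commute)
  qed
  have "lie_deriv X ?f \<one> = X \<bullet> b" for X
  proof -
    have B: "(bump base r has_derivative frechet_derivative (bump base r) (at base)) (at base)"
      by (rule smooth_on_has_derivative[OF smooth_on_bump[of UNIV]]) simp
    have "(?F has_derivative (\<lambda>v. v \<bullet> b)) (at base)"
      using b1 by (auto intro!: derivative_eq_intros B)
    then have "((\<lambda>q. ?f (\<one> \<otimes> unchart q)) has_derivative (\<lambda>v. v \<bullet> b)) (at base)"
      by (rule has_derivative_transform_within_open[OF _ open_cod_one base_in]) simp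
    from fun_cong[OF frechet_derivative_at[OF this], of X] show ?thesis
      unfolding lie_deriv_eq[OF sm] by simp
  qed
  then show ?thesis using that sm by blast
qed

text \<open>Gives uniqueness in the definition of the bracket, and turns identities in the Lie
  algebra into identities between derivations.\<close>

lemma lie_deriv_separates:
  assumes "\<And>f :: 'g \<Rightarrow> real. smooth_fun f \<Longrightarrow> lie_deriv X f \<one> = lie_deriv Y f \<one>"
  shows "X = Y"
proof (rule euclidean_eqI)
  fix b :: 'e
  obtain f :: "'g \<Rightarrow> real" where "smooth_fun f" "\<And>X. lie_deriv X f \<one> = X \<bullet> b"
    using smooth_fun_with_lie_deriv[of b] by blast
  then show "X \<bullet> b = Y \<bullet> b" using assms by metis
qed

section \<open>The adjoint action\<close>

lemma plot_conj:
  fixes h :: "'a::euclidean_space \<Rightarrow> 'g"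
  assumes "plot S h"
  shows "plot (S \<times> cod_one) (\<lambda>z. h (fst z) \<otimes> unchart (snd z) \<otimes> inv (h (fst z)))"
  by (intro plot_mult plot_inv plot_fst plot_snd assms plot_unchart open_cod_one plot_open[OF assms])

lemma conj_one_param:
  "one_param_subgroup (\<lambda>t. s \<otimes> lie_exp (t *\<^sub>R X) \<otimes> inv s)"
  unfolding one_param_subgroup_def
  by (auto intro!: continuous_on_mult continuous_on_const continuous_lie_exp simp: lie_exp_add m_assoc)

lemma Ad_derivative:
  "((\<lambda>t. chart_one (s \<otimes> lie_exp (t *\<^sub>R X) \<otimes> inv s)) has_vector_derivative
    frechet_derivative (\<lambda>q. chart_one (s \<otimes> unchart q \<otimes> inv s)) (at base) X) (at 0)"
  "((\<lambda>q. chart_one (s \<otimes> unchart q \<otimes> inv s)) has_derivative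
    frechet_derivative (\<lambda>q. chart_one (s \<otimes> unchart q \<otimes> inv s)) (at base)) (at base)"
proof -
  have "plot cod_one (\<lambda>q. s \<otimes> unchart q \<otimes> inv s)"
    by (intro plot_mult plot_const plot_unchart open_cod_one)
  from smooth_on_has_derivative[OF plot_smooth[OF this chart_one(1)], of base]
  show D: "((\<lambda>q. chart_one (s \<otimes> unchart q \<otimes> inv s)) has_derivative
    frechet_derivative (\<lambda>q. chart_one (s \<otimes> unchart q \<otimes> inv s)) (at base)) (at base)"
    using chart_one by simp
  show "((\<lambda>t. chart_one (s \<otimes> lie_exp (t *\<^sub>R X) \<otimes> inv s)) has_vector_derivative
    frechet_derivative (\<lambda>q. chart_one (s \<otimes> unchart q \<otimes> inv s)) (at base) X) (at 0)"
    using ltangent_deriv[OF lie_exp_ltangent[of X 0], of "\<lambda>y. chart_one (s \<otimes> y \<otimes> inv s)"] D by simp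
qed

lemma Ad_eq: "Ad s X = frechet_derivative (\<lambda>q. chart_one (s \<otimes> unchart q \<otimes> inv s)) (at base) X"
  unfolding Ad_def by (rule vector_derivative_at[OF Ad_derivative(1)])

lemma linear_Ad: "linear (Ad s)"
  using has_derivative_linear[OF Ad_derivative(2)] by (simp add: Ad_eq[abs_def])

text \<open>A conjugate of a one-parameter subgroup is another one, and \<open>Ad s X\<close> is by
  definition its velocity at 0.\<close>

lemma lie_exp_Ad: "lie_exp (t *\<^sub>R Ad s X) = s \<otimes> lie_exp (t *\<^sub>R X) \<otimes> inv s"
  by (rule lie_exp_eq[OF conj_one_param]) (use Ad_derivative(1) in \<open>simp add: o_def Ad_eq\<close>)

lemma lie_exp_inject: "(\<And>t. lie_exp (t *\<^sub>R X) = lie_exp (t *\<^sub>R Y)) \<Longrightarrow> X = Y"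
  using vector_derivative_unique_at[OF lie_exp_one_param(2)[of X]] lie_exp_one_param(2)[of Y] by simp

lemma Ad_mult: "Ad (s \<otimes> t) X = Ad s (Ad t X)"
  by (rule lie_exp_inject) (simp add: lie_exp_Ad inv_mult_group m_assoc)

lemma Ad_one [simp]: "Ad \<one> X = X"
  by (rule lie_exp_inject) (simp add: lie_exp_Ad)

lemma Ad_inv_cancel [simp]: "Ad (inv s) (Ad s X) = X" "Ad s (Ad (inv s) X) = X"
  by (simp_all flip: Ad_mult)

lemma smooth_fun_Ad: "smooth_fun (\<lambda>s. Ad s X)"
proof (rule smooth_funI_plot)
  fix S and h :: "'e \<Rightarrow> 'g" assume h: "plot S h"
  show "smooth_on S (\<lambda>p. Ad (h p) X)"
    using smooth_on_partial_snd[OF plot_smooth[OF plot_conj[OF h] chart_one(1)] plot_open[OF h], of base X] chart_one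
    by (simp add: Ad_eq)
qed

text \<open>Moving from x along the conjugate of exp(tX) by s is moving from x s along exp(tX) and
  then translating back by inv s on the right.\<close>

lemma lie_deriv_Ad: "lie_deriv (Ad s X) f x = lie_deriv X (\<lambda>y. f (y \<otimes> inv s)) (x \<otimes> s)"
  by (simp add: lie_deriv_def lie_exp_Ad m_assoc)

lemma lie_deriv_mult_Ad: "lie_deriv X f (x \<otimes> s) = lie_deriv (Ad s X) (\<lambda>y. f (y \<otimes> s)) x"
  by (simp add: lie_deriv_Ad m_assoc)

text \<open>Differentiate \<open>Ad(exp tX)Y\<close>, acting on \<open>f\<close> as \<open>r \<mapsto> f(exp(tX) r exp(-tX))\<close>, in both outer
  factors; symmetry of the mixed second derivatives of \<open>f(r q)\<close> turns the second term into \<open>YXf\<close>.\<close>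

lemma lie_deriv_derivative_Ad:
  fixes f :: "'g \<Rightarrow> real"
  assumes f: "smooth_fun f"
  shows "lie_deriv (lie_deriv X (\<lambda>s. Ad s Y) \<one>) f \<one> =
    lie_deriv X (lie_deriv Y f) \<one> - lie_deriv Y (lie_deriv X f) \<one>"
proof -
  let ?e = "\<lambda>t. lie_exp (t *\<^sub>R X)"
  let ?Z = "lie_deriv X (\<lambda>s. Ad s Y) \<one>"
  \<comment> \<open>The derivative of f(p r q) in r, at the identity and in direction Y, as a
    function of the coordinates of p and q.\<close>
  define \<Gamma> where "\<Gamma> z = frechet_derivative (\<lambda>r. f (unchart (fst z) \<otimes> unchart r \<otimes> unchart (snd z))) (at base) Y" for z
  have C2: "open (cod_one \<times> cod_one)" by (intro open_Times open_cod_one)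
  have p2: "plot (cod_one \<times> cod_one) (\<lambda>z. unchart (fst z))" "plot (cod_one \<times> cod_one) (\<lambda>z. unchart (snd z))"
    by (intro plot_fst plot_snd plot_unchart open_cod_one)+
  have s3: "smooth_on ((cod_one \<times> cod_one) \<times> cod_one)
      (\<lambda>w. f (unchart (fst (fst w)) \<otimes> unchart (snd w) \<otimes> unchart (snd (fst w))))"
    by (intro smooth_fun_plot[OF f] plot_mult plot_fst[OF p2(1) open_cod_one] plot_fst[OF p2(2) open_cod_one]
        plot_snd[OF plot_unchart C2])
  have \<Gamma>s: "smooth_on (cod_one \<times> cod_one) \<Gamma>"
    unfolding \<Gamma>_def using smooth_on_partial_snd[OF s3 C2, of base Y] by simp
  let ?D = "frechet_derivative \<Gamma> (at (base, base))"
  have \<Gamma>D: "(\<Gamma> has_derivative ?D) (at (base, base))"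
    by (rule smooth_on_has_derivative[OF \<Gamma>s]) simp
  have \<Gamma>_eq: "\<Gamma> (p, q) = lie_deriv Y (\<lambda>y. f (y \<otimes> unchart q)) (unchart p)" for p q
    using lie_deriv_eq[OF smooth_fun_right[OF f], of Y "unchart q" "unchart p"] by (simp add: \<Gamma>_def)

  have near: "\<forall>\<^sub>F t in at 0. ?e (c * t) \<in> dom_one" for c
  proof -
    have "continuous_on UNIV (\<lambda>t. ?e (c * t))"
      by (intro continuous_on_compose2[OF continuous_lie_exp[of UNIV X]] continuous_intros) auto
    then have "continuous (at 0) (\<lambda>t. ?e (c * t))" by (simp add: continuous_on_eq_continuous_at)
    then show ?thesis
      using chart_one(2) open_dom_one by (auto simp: continuous_at elim!: topological_tendstoD)
  qed
  have d1: "((\<lambda>t. chart_one (?e t)) has_vector_derivative X) (at 0)"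
    using lie_exp_one_param(2)[of X] by (simp add: o_def)
  have d2: "((\<lambda>t. chart_one (?e (- 1 * t))) has_vector_derivative - X) (at 0)"
  proof -
    have "((\<lambda>t. chart_one (lie_exp (t *\<^sub>R (- X)))) has_vector_derivative - X) (at 0)"
      using lie_exp_one_param(2)[of "- X"] by (simp add: o_def)
    then show ?thesis by simp
  qed
  have "((\<lambda>t. (chart_one (?e t), chart_one (?e (- 1 * t)))) has_vector_derivative (X, - X)) (at 0)"
    by (rule has_vector_derivative_Pair[OF d1 d2])
  then have "((\<lambda>t. \<Gamma> (chart_one (?e t), chart_one (?e (- 1 * t)))) has_vector_derivative ?D (X, - X)) (at 0)"
    by (rule has_vector_derivative_chain) (use \<Gamma>D in \<open>simp add: base_def\<close>)
  moreover have "\<forall>\<^sub>F t in at 0. \<Gamma> (chart_one (?e t), chart_one (?e (- 1 * t))) = lie_deriv (Ad (?e t) Y) f \<one>"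
    using near[of 1] near[of "- 1"]
    by eventually_elim (simp add: \<Gamma>_eq lie_deriv_Ad lie_exp_minus)
  ultimately have A1: "((\<lambda>t. lie_deriv (Ad (?e t) Y) f \<one>) has_vector_derivative ?D (X, - X)) (at 0)"
    unfolding has_vector_derivative_def
    by (rule has_derivative_transform_eventually)
      (simp_all add: \<Gamma>_eq base_def[symmetric])
  have "((\<lambda>t. Ad (\<one> \<otimes> ?e t) Y) has_vector_derivative ?Z) (at 0)"
    by (rule lie_deriv_has_vector_derivative_0[OF smooth_fun_Ad])
  \<comment> \<open>A derivation depends linearly on its Lie algebra element, so differentiation in
    t passes inside \<open>lie_deriv\<close>.\<close>
  then have "((\<lambda>t. lie_deriv (Ad (\<one> \<otimes> ?e t) Y) f \<one>) has_vector_derivative lie_deriv ?Z f \<one>) (at 0)"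
    by (rule bounded_linear.has_vector_derivative[OF linear_lie_deriv[OF f, unfolded linear_conv_bounded_linear]])
  then have "lie_deriv ?Z f \<one> = ?D (X, - X)"
    using vector_derivative_unique_at[OF A1] by simp
  also have "?D (X, - X) = ?D (X, 0) - ?D (0, X)"
    using linear_diff[OF has_derivative_linear[OF \<Gamma>D], of "(X, 0)" "(0, X)"] by simp
  also have "?D (X, 0) = lie_deriv X (lie_deriv Y f) \<one>"
  proof -
    have "?D (X, 0) = frechet_derivative (\<lambda>p. \<Gamma> (p, base)) (at base) X"
      by (rule frechet_derivative_partial_fst[OF \<Gamma>s, symmetric]) simp
    also have "(\<lambda>p. \<Gamma> (p, base)) = (\<lambda>p. lie_deriv Y f (\<one> \<otimes> unchart p))"
      by (simp add: \<Gamma>_eq)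
    finally show ?thesis by (simp add: lie_deriv_eq[OF smooth_fun_lie_deriv[OF f]])
  qed
  also have "?D (0, X) = lie_deriv Y (lie_deriv X f) \<one>"
  proof -
    \<comment> \<open>In f(p q) both derivatives become partial ones: Y acts on the first factor and
      X on the second.\<close>
    define \<Phi> where "\<Phi> z = f (unchart (fst z) \<otimes> unchart (snd z))" for z
    have \<Phi>s: "smooth_on (cod_one \<times> cod_one) \<Phi>"
      unfolding \<Phi>_def by (rule smooth_fun_plot[OF f plot_mult_unchart])
    have e1: "\<Gamma> (base, q) = frechet_derivative \<Phi> (at (base, q)) (Y, 0)" if "q \<in> cod_one" for q
      using frechet_derivative_partial_fst[OF \<Phi>s, of base q Y] that by (simp add: \<Gamma>_def \<Phi>_def)
    have e2: "lie_deriv X f (unchart p) = frechet_derivative \<Phi> (at (p, base)) (0, X)" if "p \<in> cod_one" for p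
      using frechet_derivative_partial_snd(2)[OF \<Phi>s, of p base X] that by (simp add: lie_deriv_eq[OF f] \<Phi>_def)
    have \<Phi>1: "smooth_on (cod_one \<times> cod_one) (\<lambda>z. frechet_derivative \<Phi> (at z) v)" for v
      by (rule smooth_on_frechet[OF \<Phi>s])
    have "?D (0, X) = frechet_derivative (\<lambda>q. \<Gamma> (base, q)) (at base) X"
      by (rule frechet_derivative_partial_snd(2)[OF \<Gamma>s, symmetric]) simp
    also have "\<dots> = frechet_derivative (\<lambda>q. frechet_derivative \<Phi> (at (base, q)) (Y, 0)) (at base) X"
    proof -
      have "(\<lambda>q. \<Gamma> (base, q)) differentiable (at base)"
        using frechet_derivative_partial_snd(1)[OF \<Gamma>s, of base base] unfolding differentiable_def by auto
      from frechet_derivative_cong_open[OF this open_cod_one base_in e1] show ?thesis by simp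
    qed
    also have "\<dots> = frechet_derivative (\<lambda>z. frechet_derivative \<Phi> (at z) (Y, 0)) (at (base, base)) (0, X)"
      by (rule frechet_derivative_partial_snd(2)[OF \<Phi>1]) simp
    also have "\<dots> = frechet_derivative (\<lambda>z. frechet_derivative \<Phi> (at z) (0, X)) (at (base, base)) (Y, 0)"
      by (rule symmetric_second_derivative[OF C2]) (use \<Phi>s in \<open>simp_all add: smooth_on_def\<close>)
    also have "\<dots> = frechet_derivative (\<lambda>p. frechet_derivative \<Phi> (at (p, base)) (0, X)) (at base) (Y)"
      by (rule frechet_derivative_partial_fst[OF \<Phi>1, symmetric]) simp
    also have "\<dots> = frechet_derivative (\<lambda>p. lie_deriv X f (\<one> \<otimes> unchart p)) (at base) Y"
    proof -
      have "(\<lambda>p. lie_deriv X f (\<one> \<otimes> unchart p)) differentiable (at base)"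
        using smooth_on_has_derivative[OF smooth_on_translate[OF smooth_fun_lie_deriv[OF f]] base_in]
        unfolding differentiable_def by blast
      from frechet_derivative_cong_open[OF this open_cod_one base_in] e2 show ?thesis by simp
    qed
    finally show ?thesis by (simp add: lie_deriv_eq[OF smooth_fun_lie_deriv[OF f]])
  qed
  finally show ?thesis .
qed

text \<open>Left translation of f reduces the commutator identity at x to the identity element,
  where it is the derivative of \<open>Ad\<close>. The first formula is what makes bilinearity
  accessible.\<close>

lemma lie_bracket_unique:
  fixes f :: "'g \<Rightarrow> real"
  shows "lie_bracket X Y = lie_deriv X (\<lambda>s. Ad s Y) \<one>"
    and "smooth_fun f \<Longrightarrow> lie_deriv (lie_bracket X Y) f x =
      lie_deriv X (lie_deriv Y f) x - lie_deriv Y (lie_deriv X f) x"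
proof -
  let ?Z = "lie_deriv X (\<lambda>s. Ad s Y) \<one>"
  have *: "lie_deriv ?Z f x = lie_deriv X (lie_deriv Y f) x - lie_deriv Y (lie_deriv X f) x"
    if f: "smooth_fun f" for f :: "'g \<Rightarrow> real" and x
  proof -
    have "lie_deriv X (\<lambda>y. f (x \<otimes> y)) = (\<lambda>y. lie_deriv X f (x \<otimes> y))" for X
      by (intro ext lie_deriv_left)
    then show ?thesis
      using lie_deriv_derivative_Ad[OF smooth_fun_left[OF f], of X Y x]
      by (simp add: lie_deriv_left)
  qed
  show eq: "lie_bracket X Y = ?Z"
    unfolding lie_bracket_def
  proof (rule the_equality)
    fix Z assume "\<forall>f :: 'g \<Rightarrow> real. smooth_fun f \<longrightarrow> (\<forall>x. lie_deriv Z f x =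
        lie_deriv X (lie_deriv Y f) x - lie_deriv Y (lie_deriv X f) x)"
    then show "Z = ?Z" using * by (intro lie_deriv_separates) metis
  qed (use * in blast)
  show "lie_deriv (lie_bracket X Y) f x = lie_deriv X (lie_deriv Y f) x - lie_deriv Y (lie_deriv X f) x"
    if "smooth_fun f"
    unfolding eq by (rule *[OF that])
qed

lemma lie_bracket_derivative:
  "((\<lambda>t. Ad (lie_exp (t *\<^sub>R X)) Y) has_vector_derivative lie_bracket X Y) (at 0)"
  using lie_deriv_has_vector_derivative_0[OF smooth_fun_Ad[of Y], of \<one> X] by (simp add: lie_bracket_unique(1))

lemma bounded_bilinear_lie_bracket: "bounded_bilinear lie_bracket"
proof -
  have 1: "linear (\<lambda>X. lie_bracket X Y)" for Y
    unfolding lie_bracket_unique(1) by (rule linear_lie_deriv[OF smooth_fun_Ad])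
  have "lie_bracket X (Y + Y') = lie_bracket X Y + lie_bracket X Y'" for X Y Y'
    using lie_deriv_add[OF smooth_fun_Ad smooth_fun_Ad, of X Y Y' \<one>]
    by (simp add: lie_bracket_unique(1) linear_add[OF linear_Ad])
  moreover have "lie_bracket X (c *\<^sub>R Y) = c *\<^sub>R lie_bracket X Y" for X Y c
    using lie_deriv_linear[OF linear_scaleR smooth_fun_Ad, of X c Y \<one>]
    by (simp add: lie_bracket_unique(1) linear_cmul[OF linear_Ad])
  ultimately have "linear (lie_bracket X)" for X by (intro linearI)
  then have "bilinear lie_bracket" using 1 by (simp add: bilinear_def)
  then show ?thesis by (simp add: bilinear_conv_bounded_bilinear)
qed

lemmas lie_bracket_add_left = bounded_bilinear.add_left[OF bounded_bilinear_lie_bracket]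
  and lie_bracket_add_right = bounded_bilinear.add_right[OF bounded_bilinear_lie_bracket]
  and lie_bracket_scaleR_left = bounded_bilinear.scaleR_left[OF bounded_bilinear_lie_bracket]
  and lie_bracket_scaleR_right = bounded_bilinear.scaleR_right[OF bounded_bilinear_lie_bracket]
  and lie_bracket_zero_left = bounded_bilinear.zero_left[OF bounded_bilinear_lie_bracket]
  and lie_bracket_zero_right = bounded_bilinear.zero_right[OF bounded_bilinear_lie_bracket]

lemma lie_bracket_antisym: "lie_bracket X Y = - lie_bracket Y X"
proof (rule lie_deriv_separates)
  fix f :: "'g \<Rightarrow> real" assume f: "smooth_fun f"
  show "lie_deriv (lie_bracket X Y) f \<one> = lie_deriv (- lie_bracket Y X) f \<one>"
    by (simp add: linear_neg[OF linear_lie_deriv[OF f]] lie_bracket_unique(2)[OF f])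
qed

text \<open>Both sides are compared as derivations; right translation by inv s intertwines X with
  \<open>Ad s X\<close>.\<close>

lemma Ad_lie_bracket: "Ad s (lie_bracket X Y) = lie_bracket (Ad s X) (Ad s Y)"
proof (rule lie_deriv_separates)
  fix f :: "'g \<Rightarrow> real" assume f: "smooth_fun f"
  let ?R = "\<lambda>y. f (y \<otimes> inv s)"
  have R: "lie_deriv X ?R = (\<lambda>y. lie_deriv (Ad s X) f (y \<otimes> inv s))" for X
    by (intro ext) (simp add: lie_deriv_Ad m_assoc)
  have RR: "lie_deriv X (\<lambda>y. lie_deriv (Ad s Y) f (y \<otimes> inv s)) z = lie_deriv (Ad s X) (lie_deriv (Ad s Y) f) (z \<otimes> inv s)" for X Y z
    by (simp add: lie_deriv_Ad m_assoc)
  have "lie_deriv (Ad s (lie_bracket X Y)) f \<one> = lie_deriv (lie_bracket X Y) ?R s"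
    by (simp add: lie_deriv_Ad)
  also have "\<dots> = lie_deriv X (lie_deriv Y ?R) s - lie_deriv Y (lie_deriv X ?R) s"
    by (rule lie_bracket_unique(2)[OF smooth_fun_right[OF f]])
  also have "\<dots> = lie_deriv (lie_bracket (Ad s X) (Ad s Y)) f \<one>"
    unfolding R[of X] R[of Y] RR[of X Y s] RR[of Y X s] lie_bracket_unique(2)[OF f, of "Ad s X"] by simp
  finally show "lie_deriv (Ad s (lie_bracket X Y)) f \<one> = lie_deriv (lie_bracket (Ad s X) (Ad s Y)) f \<one>" .
qed

text \<open>The derivative at t = 0 of the statement that \<open>Ad\<close> of exp(tZ) preserves
  brackets.\<close>

lemma jacobi:
  "lie_bracket Z (lie_bracket X Y) = lie_bracket (lie_bracket Z X) Y + lie_bracket X (lie_bracket Z Y)"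
proof -
  have "((\<lambda>t. lie_bracket (Ad (lie_exp (t *\<^sub>R Z)) X) (Ad (lie_exp (t *\<^sub>R Z)) Y)) has_vector_derivative
      lie_bracket X (lie_bracket Z Y) + lie_bracket (lie_bracket Z X) Y) (at 0)"
    using bounded_bilinear.has_vector_derivative[OF bounded_bilinear_lie_bracket
        lie_bracket_derivative[of Z X] lie_bracket_derivative[of Z Y]] by simp
  then show ?thesis
    using vector_derivative_unique_at[OF lie_bracket_derivative[of Z "lie_bracket X Y"]]
    by (simp add: Ad_lie_bracket add.commute)
qed

end

section \<open>The Killing form and the homogeneous space\<close>

definition lin_trace :: "('a::euclidean_space \<Rightarrow> 'a) \<Rightarrow> real" where
  "lin_trace L = (\<Sum>b\<in>Basis. L b \<bullet> b)"

lemma lin_trace_comp: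
  fixes L :: "'b::euclidean_space \<Rightarrow> 'a::euclidean_space" and M :: "'a \<Rightarrow> 'b"
  assumes "linear L" "linear M"
  shows "lin_trace (\<lambda>x. L (M x)) = lin_trace (\<lambda>x. M (L x))"
proof -
  have *: "lin_trace (\<lambda>x. L (M x)) = (\<Sum>b\<in>Basis. \<Sum>c\<in>Basis. (M b \<bullet> c) * (L c \<bullet> b))"
    if "linear L" "linear M" for L :: "'b::euclidean_space \<Rightarrow> 'a::euclidean_space" and M :: "'a \<Rightarrow> 'b"
  proof -
    have "L (M b) = (\<Sum>c\<in>Basis. (M b \<bullet> c) *\<^sub>R L c)" for b
      using linear_sum[OF that(1), of "\<lambda>c. (M b \<bullet> c) *\<^sub>R c" Basis]
      by (simp add: euclidean_representation linear_cmul[OF that(1)])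
    then show ?thesis by (simp add: lin_trace_def inner_sum_left)
  qed
  have **: "lin_trace (\<lambda>x. M (L x)) = (\<Sum>c\<in>Basis. \<Sum>b\<in>Basis. (L c \<bullet> b) * (M b \<bullet> c))"
  proof -
    have "M (L c) = (\<Sum>b\<in>Basis. (L c \<bullet> b) *\<^sub>R M b)" for c
      using linear_sum[OF assms(2), of "\<lambda>b. (L c \<bullet> b) *\<^sub>R b" Basis]
      by (simp add: euclidean_representation linear_cmul[OF assms(2)])
    then show ?thesis by (simp add: lin_trace_def inner_sum_left)
  qed
  show ?thesis unfolding *[OF assms] ** by (subst sum.swap) (simp add: mult.commute)
qed

lemma lin_trace_diff: "lin_trace (\<lambda>x. L x - M x) = lin_trace L - lin_trace M"
  by (simp add: lin_trace_def inner_diff_left sum_subtractf)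

text \<open>Instantiated with \<open>inv_inner\<close> and with \<open>Kil\<close>; orthonormality
  is never meant for the inner product of the type.\<close>

locale pos_def_form =
  fixes B :: "'a::euclidean_space \<Rightarrow> 'a \<Rightarrow> real"
  assumes bounded_bilinear: "bounded_bilinear B"
    and sym: "B x y = B y x"
    and pos: "x \<noteq> 0 \<Longrightarrow> B x x > 0"
begin

lemmas add_left = bounded_bilinear.add_left[OF bounded_bilinear]
  and add_right = bounded_bilinear.add_right[OF bounded_bilinear]
  and diff_left = bounded_bilinear.diff_left[OF bounded_bilinear]
  and diff_right = bounded_bilinear.diff_right[OF bounded_bilinear]
  and scaleR_left = bounded_bilinear.scaleR_left[OF bounded_bilinear, unfolded real_scaleR_def]
  and scaleR_right = bounded_bilinear.scaleR_right[OF bounded_bilinear, unfolded real_scaleR_def]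
  and sum_left = bounded_bilinear.sum_left[OF bounded_bilinear]
  and zero_left = bounded_bilinear.zero_left[OF bounded_bilinear]

lemma eq_0_iff: "B x x = 0 \<longleftrightarrow> x = 0"
  using pos[of x] zero_left by fastforce

lemma nonneg: "B x x \<ge> 0"
  using pos[of x] zero_left[of 0] by (cases "x = 0") auto

definition orthonormal :: "'a set \<Rightarrow> bool" where
  "orthonormal E \<longleftrightarrow> finite E \<and> (\<forall>e\<in>E. \<forall>f\<in>E. B e f = (if e = f then 1 else 0))"

lemma orthonormal_sum:
  assumes "orthonormal E" "f \<in> E" shows "B (\<Sum>e\<in>E. u e *\<^sub>R e) f = u f"
proof -
  have "B (\<Sum>e\<in>E. u e *\<^sub>R e) f = (\<Sum>e\<in>E. u e * (if e = f then 1 else 0))"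
    using assms by (simp add: sum_left scaleR_left orthonormal_def cong: sum.cong)
  also have "\<dots> = u f" using assms by (simp add: orthonormal_def if_distrib cong: if_cong)
  finally show ?thesis .
qed

lemma orthonormal_card: "orthonormal E \<Longrightarrow> card E \<le> DIM('a)"
proof -
  assume E: "orthonormal E"
  have "independent E"
    unfolding independent_explicit
  proof (intro conjI allI impI ballI)
    show "finite E" using E by (simp add: orthonormal_def)
    fix u e assume "(\<Sum>v\<in>E. u v *\<^sub>R v) = 0" "e \<in> E"
    then show "u e = 0" using orthonormal_sum[OF E, of e u] zero_left by simp
  qed
  then show ?thesis using independent_bound by blast
qed

text \<open>An orthonormal subset of V of maximal size is a basis: otherwise the normalised
  remainder of some vector of V could be adjoined. Sizes are bounded by the dimension.\<close>

lemma orthonormal_basis_exists: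
  assumes V: "subspace V"
  obtains E where "E \<subseteq> V" "orthonormal E" "\<And>x. x \<in> V \<Longrightarrow> x = (\<Sum>e\<in>E. B x e *\<^sub>R e)"
proof -
  define P where "P n \<longleftrightarrow> (\<exists>E. E \<subseteq> V \<and> orthonormal E \<and> card E = n)" for n
  have "P 0" unfolding P_def by (intro exI[of _ "{}"]) (simp add: orthonormal_def)
  moreover have "\<forall>n. P n \<longrightarrow> n \<le> DIM('a)" using orthonormal_card by (auto simp: P_def)
  ultimately obtain n where n: "P n" "\<And>m. P m \<Longrightarrow> m \<le> n"
    using Nat.ex_has_greatest_nat[of P 0 "DIM('a)"] by blast
  then obtain E where E: "E \<subseteq> V" "orthonormal E" "card E = n" by (auto simp: P_def)
  have fin: "finite E" using E by (simp add: orthonormal_def)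
  have "x = (\<Sum>e\<in>E. B x e *\<^sub>R e)" if x: "x \<in> V" for x
  proof (rule ccontr)
    assume "x \<noteq> (\<Sum>e\<in>E. B x e *\<^sub>R e)"
    define y where "y = x - (\<Sum>e\<in>E. B x e *\<^sub>R e)"
    have y: "y \<noteq> 0" "y \<in> V"
      using \<open>x \<noteq> _\<close> x E V by (auto simp: y_def intro!: subspace_diff subspace_sum subspace_scale)
    have yf: "B y f = 0" if "f \<in> E" for f
      using orthonormal_sum[OF E(2) that, of "B x"] by (simp add: y_def diff_left)
    define z where "z = (1 / sqrt (B y y)) *\<^sub>R y"
    have zz: "B z z = 1"
      using pos[OF y(1)] by (simp add: z_def scaleR_left scaleR_right)
    have zf: "B z f = 0" if "f \<in> E" for f using yf[OF that] by (simp add: z_def scaleR_left)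
    have "z \<notin> E" using zz zf by fastforce
    moreover have "orthonormal (insert z E)"
      using E(2) zz zf zf[unfolded sym[of z]] \<open>z \<notin> E\<close> by (auto simp: orthonormal_def)
    moreover have "z \<in> V" using y V by (auto simp: z_def intro: subspace_scale)
    ultimately have "insert z E \<subseteq> V" "orthonormal (insert z E)" "card (insert z E) = Suc n"
      using E fin by simp_all
    then have "P (Suc n)" unfolding P_def by blast
    then show False using n(2) by fastforce
  qed
  then show ?thesis using that E by blast
qed

text \<open>Lets the Killing form, a trace in the \<open>Basis\<close> of the type, be evaluated in
  a basis adapted to an invariant inner product.\<close>

lemma lin_trace_orthonormal:
  assumes M: "linear M" and E: "\<And>x. x = (\<Sum>e\<in>E. B x e *\<^sub>R e)"
  shows "lin_trace M = (\<Sum>e\<in>E. B (M e) e)"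
proof -
  have Mb: "M b = (\<Sum>e\<in>E. B b e *\<^sub>R M e)" for b
    using arg_cong[OF E[of b], of M] by (simp add: linear_sum[OF M] linear_cmul[OF M])
  have "M b \<bullet> b = (\<Sum>e\<in>E. B b e * (M e \<bullet> b))" for b
    using arg_cong[OF Mb[of b], of "\<lambda>v. v \<bullet> b"] by (simp only: inner_sum_left inner_scaleR_left)
  then have "lin_trace M = (\<Sum>b\<in>Basis. \<Sum>e\<in>E. B b e * (M e \<bullet> b))"
    by (simp only: lin_trace_def)
  also have "\<dots> = (\<Sum>e\<in>E. \<Sum>b\<in>Basis. B b e * (M e \<bullet> b))" by (rule sum.swap)
  also have "\<dots> = (\<Sum>e\<in>E. B (\<Sum>b\<in>Basis. (M e \<bullet> b) *\<^sub>R b) e)"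
    by (simp add: sum_left scaleR_left mult.commute)
  finally show ?thesis by (simp add: euclidean_representation)
qed

end

context compact_subgroup begin

lemma param_C_k_cong:
  fixes S :: "'a::real_normed_vector set" and L :: "'k::topological_space set"
  assumes S: "open S" and eq: "\<And>p k. p \<in> S \<Longrightarrow> k \<in> L \<Longrightarrow> H p k = H' p k" and H: "param_C_k n S L H"
  shows "param_C_k n S L H'"
  using eq H
proof (induction n arbitrary: H H')
  case 0
  then show ?case by (auto intro!: continuous_on_eq[of "S \<times> L" "\<lambda>(p, k). H p k"])
next
  case (Suc n)
  have d: "((\<lambda>p. H' p k) has_derivative frechet_derivative (\<lambda>p. H p k) (at p)) (at p)"
    if "p \<in> S" "k \<in> L" for p k
    by (rule has_derivative_transform_within_open[of "\<lambda>p. H p k" _ _ UNIV S])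
      (use Suc.prems that S in \<open>auto simp flip: frechet_derivative_works\<close>)
  have "param_C_k n S L (\<lambda>p k. frechet_derivative (\<lambda>p. H' p k) (at p) v)" for v
  proof (rule Suc.IH)
    show "frechet_derivative (\<lambda>p. H p k) (at p) v = frechet_derivative (\<lambda>p. H' p k) (at p) v"
      if "p \<in> S" "k \<in> L" for p k
      using frechet_derivative_at[OF d[OF that]] by simp
  qed (use Suc.prems in simp)
  moreover have "continuous_on (S \<times> L) (\<lambda>(p, k). H' p k)"
    using Suc.prems by (auto intro!: continuous_on_eq[of "S \<times> L" "\<lambda>(p, k). H p k"])
  ultimately show ?case using d by (auto simp: differentiable_def)
qed

text \<open>The parameter enters through its coordinates c k, so a smooth function of two Euclidean
  variables gives a family that is smooth in p and continuous in k.\<close>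

lemma param_C_k_smooth:
  fixes \<Phi> :: "'a::euclidean_space \<times> 'b::euclidean_space \<Rightarrow> real" and L :: "'k::topological_space set"
  assumes "open S" "smooth_on (S \<times> T) \<Phi>" "continuous_on L c" "c ` L \<subseteq> T"
  shows "param_C_k n S L (\<lambda>p k. \<Phi> (p, c k))"
  using assms(2)
proof (induction n arbitrary: \<Phi>)
  have cont: "continuous_on (S \<times> L) (\<lambda>(p, k). \<Phi> (p, c k))" if "smooth_on (S \<times> T) \<Phi>" for \<Phi> :: "'a \<times> 'b \<Rightarrow> real"
  proof -
    have "continuous_on (S \<times> L) (\<lambda>z. (fst z, c (snd z)))"
      by (intro continuous_on_Pair continuous_on_fst continuous_on_id continuous_on_compose2[OF assms(3)] continuous_on_snd) auto
    then have "continuous_on (S \<times> L) (\<lambda>z. \<Phi> (fst z, c (snd z)))"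
      by (rule continuous_on_compose2[OF smooth_on_imp_continuous_on[OF that]]) (use assms(4) in auto)
    then show ?thesis by (simp add: case_prod_unfold)
  qed
  {
    case 0
    then show ?case using cont by simp
  next
    case (Suc n)
    have d: "((\<lambda>p. \<Phi> (p, c k)) has_derivative (\<lambda>v. frechet_derivative \<Phi> (at (p, c k)) (v, 0))) (at p)"
      if "p \<in> S" "k \<in> L" for p k
    proof -
      have "((\<lambda>p. (p, c k)) has_derivative (\<lambda>v. (v, 0))) (at p)"
        by (auto intro!: derivative_eq_intros)
      moreover have "(p, c k) \<in> S \<times> T" using that assms(4) by auto
      ultimately show ?thesis
        using diff_chain_at[OF _ smooth_on_has_derivative[OF Suc.prems]] by (fastforce simp: o_def)
    qed
    have "param_C_k n S L (\<lambda>p k. frechet_derivative (\<lambda>p. \<Phi> (p, c k)) (at p) v)" for v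
    proof (rule param_C_k_cong[OF assms(1) _ Suc.IH])
      show "smooth_on (S \<times> T) (\<lambda>z. frechet_derivative \<Phi> (at z) (v, 0))"
        by (rule smooth_on_frechet[OF Suc.prems])
      show "frechet_derivative \<Phi> (at (p, c k)) (v, 0) = frechet_derivative (\<lambda>p. \<Phi> (p, c k)) (at p) v"
        if "p \<in> S" "k \<in> L" for p k
        using fun_cong[OF frechet_derivative_at[OF d[OF that]], of v] .
    qed
    then show ?case using d cont[OF Suc.prems] by (auto simp: differentiable_def)
  }
qed

end

locale compact_semisimple_pair = lie_group G A
  for G :: "'g::{second_countable_topology, t2_space} monoid" (structure)
    and A :: "('g, 'e::euclidean_space) chart set" +
  fixes K :: "'g set"
  assumes compact_G: "compact (UNIV :: 'g set)"
    and semisimple_G: "semisimple"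
    and subgroup_K: "subgroup K G"
    and closed_K: "closed K"
begin

sublocale HG: compact_subgroup G UNIV
  using subgroup_self carrier_UNIV
  by (intro compact_subgroup.intro is_group compact_subgroup_axioms.intro carrier_UNIV
      continuous_mult continuous_inverse compact_G) simp

sublocale HK: compact_subgroup G K
  using compact_Int_closed[OF compact_G closed_K]
  by (intro compact_subgroup.intro is_group compact_subgroup_axioms.intro carrier_UNIV
      continuous_mult continuous_inverse subgroup_K) simp

section \<open>Invariance and definiteness of the Killing form\<close>

lemma linear_ad: "linear (lie_bracket X)"
  by (intro linearI lie_bracket_add_right lie_bracket_scaleR_right)

lemma lie_bracket_bracket:
  "lie_bracket (lie_bracket X Y) Z = lie_bracket X (lie_bracket Y Z) - lie_bracket Y (lie_bracket X Z)"
  using jacobi[of X Y Z] by simp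

lemma Kil_trace: "Kil X Y = - lin_trace (\<lambda>b. lie_bracket X (lie_bracket Y b))"
  by (simp add: Kil_def lin_trace_def)

lemma bounded_bilinear_Kil: "bounded_bilinear Kil"
proof -
  have "bilinear Kil"
    unfolding bilinear_def
    by (intro conjI allI linearI)
      (simp_all add: Kil_def lie_bracket_add_left lie_bracket_add_right lie_bracket_scaleR_left
        lie_bracket_scaleR_right inner_add_left sum.distrib sum_distrib_left)
  then show ?thesis by (simp add: bilinear_conv_bounded_bilinear)
qed

lemma Kil_sym: "Kil X Y = Kil Y X"
  using lin_trace_comp[OF linear_ad linear_ad, of X Y] by (simp add: Kil_trace)

text \<open>The Jacobi identity expands both sides into differences of triple traces, which agree by
  cyclicity.\<close>

lemma Kil_ad: "Kil (lie_bracket X Y) Z = Kil X (lie_bracket Y Z)"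
proof -
  let ?t = "\<lambda>X Y Z. lin_trace (\<lambda>b. lie_bracket X (lie_bracket Y (lie_bracket Z b)))"
  have "?t Y X Z = ?t X Z Y"
    using lin_trace_comp[OF linear_ad linear_compose[OF linear_ad linear_ad], of Y X Z]
    by (simp add: o_def)
  moreover have "lin_trace (\<lambda>b. lie_bracket (lie_bracket X Y) (lie_bracket Z b)) = ?t X Y Z - ?t Y X Z"
    by (simp add: lie_bracket_bracket lin_trace_diff)
  moreover have "lin_trace (\<lambda>b. lie_bracket X (lie_bracket (lie_bracket Y Z) b)) = ?t X Y Z - ?t X Z Y"
    by (simp add: lie_bracket_bracket linear_diff[OF linear_ad] lin_trace_diff)
  ultimately show ?thesis by (simp add: Kil_trace)
qed

lemma Kil_Ad: "Kil (Ad s X) (Ad s Y) = Kil X Y"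
proof -
  have "lie_bracket (Ad s X) (lie_bracket (Ad s Y) b) = Ad s (lie_bracket X (lie_bracket Y (Ad (inv s) b)))" for b
    by (simp add: Ad_lie_bracket)
  then show ?thesis
    using lin_trace_comp[OF linear_Ad[of s] linear_compose[OF linear_compose[OF linear_Ad[of "inv s"] linear_ad[of Y]] linear_ad[of X]]]
    by (simp add: Kil_trace o_def)
qed

text \<open>The inverse is placed so that invariance under \<open>Ad t\<close> becomes a left
  translation of the averaged function, the invariance proved for the mean.\<close>

definition inv_inner :: "'e \<Rightarrow> 'e \<Rightarrow> real" where
  "inv_inner X Y = HG.mean (\<lambda>s. Ad (inv s) X \<bullet> Ad (inv s) Y)"

lemma continuous_on_Ad_inv: "continuous_on S (\<lambda>s. Ad (inv s) X)"
  by (rule continuous_on_compose2[OF smooth_fun_continuous[OF smooth_fun_Ad, of UNIV]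
        continuous_on_subset[OF continuous_inverse]]) auto

lemma inv_inner_form: "pos_def_form inv_inner"
proof (rule pos_def_form.intro)
  note c = continuous_on_inner[OF continuous_on_Ad_inv continuous_on_Ad_inv]
  have sym: "inv_inner X Y = inv_inner Y X" for X Y
    by (simp add: inv_inner_def inner_commute)
  have add: "inv_inner (X + X') Y = inv_inner X Y + inv_inner X' Y" for X X' Y
    by (simp add: inv_inner_def linear_add[OF linear_Ad] inner_add_left HG.mean_add c)
  have scale: "inv_inner (r *\<^sub>R X) Y = r * inv_inner X Y" for X Y r
    by (simp add: inv_inner_def linear_cmul[OF linear_Ad] HG.mean_cmult c)
  have "bilinear inv_inner"
    unfolding bilinear_def
  proof (intro conjI allI linearI)
    show "inv_inner X (Y + Y') = inv_inner X Y + inv_inner X Y'" for X Y Y'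
      using add[of Y Y' X] by (simp add: sym)
    show "inv_inner X (r *\<^sub>R Y) = r *\<^sub>R inv_inner X Y" for X Y r
      using scale[of r Y X] by (simp add: sym)
  qed (simp_all add: add scale)
  then show "bounded_bilinear inv_inner" by (simp add: bilinear_conv_bounded_bilinear)
  show "inv_inner X Y = inv_inner Y X" for X Y by (rule sym)
  show "inv_inner X X > 0" if "X \<noteq> 0" for X
  proof -
    have "Ad (inv s) X \<noteq> 0" for s
      using that Ad_inv_cancel(2)[of s X] linear_0[OF linear_Ad] by metis
    then show ?thesis unfolding inv_inner_def by (intro HG.mean_pos c) simp
  qed
qed

lemma inv_inner_Ad: "inv_inner (Ad t X) (Ad t Y) = inv_inner X Y"
proof -
  have "Ad (inv s) (Ad t Z) = Ad (inv (inv t \<otimes> s)) Z" for s Z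
    by (simp add: inv_mult_group flip: Ad_mult)
  then show ?thesis
    unfolding inv_inner_def
    using HG.mean_left_translate[OF continuous_on_inner[OF continuous_on_Ad_inv continuous_on_Ad_inv], of "inv t" X Y]
    by simp
qed

text \<open>Invariance under \<open>Ad\<close> of exp(tZ) makes a function of t constant; its
  derivative at 0 is the claim.\<close>

lemma inv_inner_ad: "inv_inner (lie_bracket Z X) Y = - inv_inner X (lie_bracket Z Y)"
proof -
  interpret pos_def_form inv_inner by (rule inv_inner_form)
  have "((\<lambda>t. inv_inner (Ad (lie_exp (t *\<^sub>R Z)) X) (Ad (lie_exp (t *\<^sub>R Z)) Y)) has_vector_derivative
      inv_inner X (lie_bracket Z Y) + inv_inner (lie_bracket Z X) Y) (at 0)"
    using bounded_bilinear.has_vector_derivative[OF bounded_bilinear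
        lie_bracket_derivative[of Z X] lie_bracket_derivative[of Z Y]] by simp
  moreover have "((\<lambda>t. inv_inner (Ad (lie_exp (t *\<^sub>R Z)) X) (Ad (lie_exp (t *\<^sub>R Z)) Y)) has_vector_derivative 0) (at 0)"
    by (simp add: inv_inner_Ad)
  ultimately have "inv_inner X (lie_bracket Z Y) + inv_inner (lie_bracket Z X) Y = 0"
    by (rule vector_derivative_unique_at)
  then show ?thesis by simp
qed

text \<open>Since ad X is skew for \<open>inv_inner\<close>, Kil X X is the sum of the squared
  lengths of [X, e] over an orthonormal basis. If it vanishes, X lies in the centre, which is an
  abelian ideal and hence 0 by semisimplicity.\<close>

lemma Kil_form: "pos_def_form Kil"
proof (rule pos_def_form.intro)
  interpret I: pos_def_form inv_inner by (rule inv_inner_form)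
  show "Kil X X > 0" if X: "X \<noteq> 0" for X
  proof -
    obtain E where "E \<subseteq> UNIV" and on: "I.orthonormal E"
      and E': "\<And>x. x \<in> UNIV \<Longrightarrow> x = (\<Sum>e\<in>E. inv_inner x e *\<^sub>R e)"
      using I.orthonormal_basis_exists[OF subspace_UNIV] by blast
    note E = E'[OF UNIV_I]
    have "Kil X X = (\<Sum>e\<in>E. inv_inner (lie_bracket X e) (lie_bracket X e))"
      using I.lin_trace_orthonormal[OF linear_compose[OF linear_ad linear_ad] E, of X X]
      by (simp add: Kil_trace o_def inv_inner_ad[of X "lie_bracket X _"] sum_negf)
    then have ge: "Kil X X \<ge> 0" and eq: "Kil X X = 0 \<Longrightarrow> \<forall>e\<in>E. lie_bracket X e = 0"
      using on by (auto intro!: sum_nonneg I.nonneg simp: sum_nonneg_eq_0_iff I.nonneg I.eq_0_iff I.orthonormal_def)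
    have "Kil X X \<noteq> 0"
    proof
      assume "Kil X X = 0"
      then have "lie_bracket X e = 0" if "e \<in> E" for e using eq that by blast
      then have 0: "lie_bracket X Y = 0" for Y
        using arg_cong[OF E[of Y], of "lie_bracket X"]
        by (simp add: linear_sum[OF linear_ad] linear_cmul[OF linear_ad])
      define I where "I = {Z. \<forall>Y. lie_bracket Z Y = 0}"
      have "lie_ideal I"
        unfolding lie_ideal_def I_def
        by (auto intro!: subspaceI simp: lie_bracket_add_left lie_bracket_scaleR_left
            lie_bracket_zero_left lie_bracket_zero_right lie_bracket_bracket)
      moreover have "\<forall>X\<in>I. \<forall>Y\<in>I. lie_bracket X Y = 0" by (simp add: I_def)
      ultimately have "I = {0}" using semisimple_G unfolding semisimple_def by blast
      then show False using X 0 by (auto simp: I_def)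
    qed
    then show ?thesis using ge by simp
  qed
qed (rule bounded_bilinear_Kil Kil_sym)+

sublocale Kil: pos_def_form Kil
  by (rule Kil_form)

text \<open>Replacing x by x s is a left translation of the averaged function of k, which gives
  right invariance under \<open>K\<close>. Smoothness is differentiation under the mean, with k
  expressed in charts.\<close>

lemma quotient_funs_average:
  assumes h: "smooth_fun h"
  shows "(\<lambda>x. HK.mean (\<lambda>k. h (x \<otimes> k))) \<in> quotient_funs K"
proof -
  have hc: "continuous_on K (\<lambda>k. h (x \<otimes> k))" for x
    by (rule continuous_on_compose2[OF smooth_fun_continuous[OF h, of UNIV]])
      (auto intro!: continuous_on_mult continuous_on_const continuous_on_id)
  have "HK.mean (\<lambda>k. h (x \<otimes> s \<otimes> k)) = HK.mean (\<lambda>k. h (x \<otimes> k))" if "s \<in> K" for x s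
    using HK.mean_left_translate[OF hc that, of x] by (simp add: m_assoc)
  moreover have "smooth_fun (\<lambda>x. HK.mean (\<lambda>k. h (x \<otimes> k)))"
    unfolding smooth_fun_iff
  proof (intro ballI, safe)
    fix U \<phi> assume U: "(U, \<phi>) \<in> A"
    show "smooth_on (\<phi> ` U) (\<lambda>p. HK.mean (\<lambda>k. h (inv_into U \<phi> p \<otimes> k)))"
      unfolding smooth_on_def
    proof (intro allI HK.C_k_on_mean chart_facts(2)[OF U] HK.param_C_k_local)
      fix n k assume "k \<in> K"
      obtain V \<xi> where V: "(V, \<xi>) \<in> A" "k \<in> V" using chart_at .
      have "smooth_on (\<phi> ` U \<times> \<xi> ` V) (\<lambda>z. h (inv_into U \<phi> (fst z) \<otimes> inv_into V \<xi> (snd z)))"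
        by (intro smooth_fun_plot[OF h] plot_mult plot_fst plot_snd plot_chart U V chart_facts(2)[OF U] chart_facts(2)[OF V(1)])
      from HK.param_C_k_smooth[OF chart_facts(2)[OF U] this, of "K \<inter> V" \<xi> n]
      have "HK.param_C_k n (\<phi> ` U) (K \<inter> V) (\<lambda>p k. h (inv_into U \<phi> p \<otimes> inv_into V \<xi> (\<xi> k)))"
        using continuous_on_subset[OF chart_facts(4)[OF V(1)], of "K \<inter> V"] by auto
      then have "HK.param_C_k n (\<phi> ` U) (K \<inter> V) (\<lambda>p k. h (inv_into U \<phi> p \<otimes> k))"
        by (rule HK.param_C_k_cong[OF chart_facts(2)[OF U], rotated]) (simp add: chart_facts(3)[OF V(1)])
      then show "\<exists>T. open T \<and> k \<in> T \<and> HK.param_C_k n (\<phi> ` U) (K \<inter> T) (\<lambda>p k. h (inv_into U \<phi> p \<otimes> k))"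
        using V chart_facts(1)[OF V(1)] by blast
    qed
  qed
  ultimately show ?thesis by (simp add: quotient_funs_def)
qed

text \<open>The coset y K is compact and misses \<open>K\<close>, so finitely many bumps vanishing
  on \<open>K\<close> have a sum that is positive on y K; its average is positive at y and 0 at the
  identity.\<close>

lemma quotient_funs_separate:
  assumes y: "y \<notin> K"
  obtains f where "f \<in> quotient_funs K" "f y \<noteq> f \<one>"
proof -
  have "\<exists>f. smooth_fun f \<and> (\<forall>x. f x \<ge> 0) \<and> f z > 0 \<and> (\<forall>x\<in>K. f x = (0::real))" if "z \<notin> K" for z
  proof -
    have "open (- K)" "z \<in> - K" using closed_K that by auto
    from smooth_bump_at[OF this] show ?thesis by (metis ComplD ComplI)
  qed
  then obtain b where b: "\<And>z. z \<notin> K \<Longrightarrow> smooth_fun (b z)" "\<And>z x. z \<notin> K \<Longrightarrow> b z x \<ge> 0"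
    "\<And>z. z \<notin> K \<Longrightarrow> b z z > (0::real)" "\<And>z x. z \<notin> K \<Longrightarrow> x \<in> K \<Longrightarrow> b z x = 0"
    by metis
  let ?C = "(\<lambda>k. y \<otimes> k) ` K"
  have C: "compact ?C"
    by (intro compact_continuous_image continuous_on_mult continuous_on_const continuous_on_id HK.compact)
  have CK: "z \<notin> K" if zC: "z \<in> ?C" for z
  proof
    assume "z \<in> K"
    obtain k where k: "k \<in> K" "z = y \<otimes> k" using zC by blast
    have "y = z \<otimes> inv k" using k(2) by (simp add: m_assoc)
    then show False using y HK.mult_K[OF \<open>z \<in> K\<close> HK.inv_K[OF k(1)]] by simp
  qed
  have op: "open {x. b z x > 0}" if "z \<in> ?C" for z
    by (intro open_Collect_less continuous_on_const smooth_fun_continuous b(1) CK that)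
  obtain Z where Z: "Z \<subseteq> ?C" "finite Z" "?C \<subseteq> (\<Union>z\<in>Z. {x. b z x > 0})"
    by (rule compactE_image[OF C, of ?C "\<lambda>z. {x. b z x > 0}"]) (use op b(3) CK in auto)
  define h where "h x = (\<Sum>z\<in>Z. b z x)" for x
  have h: "smooth_fun h" unfolding h_def by (intro smooth_fun_sum b(1) CK) (use Z in auto)
  have ZK: "z \<notin> K" if "z \<in> Z" for z using CK Z(1) that by blast
  have h0: "h k = 0" if "k \<in> K" for k
    unfolding h_def by (intro sum.neutral ballI b(4) ZK that)
  have h1: "h (y \<otimes> k) > 0" if k: "k \<in> K" for k
  proof -
    obtain z where z: "z \<in> Z" "b z (y \<otimes> k) > 0" using Z(3) k by blast
    have "b z (y \<otimes> k) \<le> h (y \<otimes> k)"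
      unfolding h_def by (rule member_le_sum[OF z(1)]) (use b(2) ZK Z(2) in auto)
    then show ?thesis using z by linarith
  qed
  let ?f = "\<lambda>x. HK.mean (\<lambda>k. h (x \<otimes> k))"
  have "continuous_on K (\<lambda>k. h (y \<otimes> k))"
    by (rule continuous_on_compose2[OF smooth_fun_continuous[OF h, of UNIV]])
      (auto intro!: continuous_on_mult continuous_on_const continuous_on_id)
  then have "?f y > 0" using h1 by (rule HK.mean_pos)
  moreover have "?f \<one> = 0"
    using HK.mean_cong[of "\<lambda>k. h (\<one> \<otimes> k)" "\<lambda>k. 0"] h0 by (simp add: HK.mean_const)
  ultimately show ?thesis using that[OF quotient_funs_average[OF h]] by simp
qed

section \<open>The Lie algebra of K and its complement\<close>

lemma quotient_funs_left:
  assumes "f \<in> quotient_funs K" shows "(\<lambda>y. f (x \<otimes> y)) \<in> quotient_funs K"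
  using assms smooth_fun_left[of f x] by (auto simp: quotient_funs_def simp flip: m_assoc)

text \<open>The right-hand side is visibly linear in \<open>X\<close>; this takes the place of the closed subgroup theorem.\<close>

lemma subgroup_algebra_iff:
  "X \<in> subgroup_algebra K \<longleftrightarrow> (\<forall>f\<in>quotient_funs K. lie_deriv X f \<one> = 0)"
proof (intro iffI ballI)
  fix f assume "X \<in> subgroup_algebra K" "f \<in> quotient_funs K"
  then have "(\<lambda>t. f (\<one> \<otimes> lie_exp (t *\<^sub>R X))) = (\<lambda>t. f \<one>)"
    unfolding subgroup_algebra_def quotient_funs_def by blast
  then show "lie_deriv X f \<one> = 0" by (intro lie_derivI) simp
next
  assume X: "\<forall>f\<in>quotient_funs K. lie_deriv X f \<one> = 0"
  have "lie_exp (t *\<^sub>R X) \<in> K" for t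
  proof (rule ccontr)
    assume "lie_exp (t *\<^sub>R X) \<notin> K"
    then obtain f where f: "f \<in> quotient_funs K" "f (lie_exp (t *\<^sub>R X)) \<noteq> f \<one>"
      by (rule quotient_funs_separate)
    have sm: "smooth_fun f" using f by (simp add: quotient_funs_def)
    \<comment> \<open>The hypothesis concerns the identity only; left translates of f stay right
      invariant under \<open>K\<close>, which carries it to every y and makes f constant along
      exp(tX).\<close>
    have "lie_deriv X f y = 0" for y
      using X quotient_funs_left[OF f(1), of y] lie_deriv_left[of X f y \<one>] by fastforce
    then have d: "((\<lambda>t. f (\<one> \<otimes> lie_exp (t *\<^sub>R X))) has_vector_derivative 0) (at t)" for t
      using lie_deriv_has_vector_derivative[OF sm, of \<one> X t] by simp
    have "f (\<one> \<otimes> lie_exp (t *\<^sub>R X)) = f (\<one> \<otimes> lie_exp (0 *\<^sub>R X))"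
      using DERIV_isconst_all[of "\<lambda>t. f (\<one> \<otimes> lie_exp (t *\<^sub>R X))" t 0] d
      by (simp add: has_real_derivative_iff_has_vector_derivative)
    then show False using f(2) by simp
  qed
  then show "X \<in> subgroup_algebra K" by (simp add: subgroup_algebra_def)
qed

lemma lie_deriv_subgroup_algebra:
  assumes "X \<in> subgroup_algebra K" "f \<in> quotient_funs K" shows "lie_deriv X f x = 0"
  using assms quotient_funs_left[OF assms(2), of x] lie_deriv_left[of X f x \<one>]
  by (fastforce simp: subgroup_algebra_iff)

lemma subspace_subgroup_algebra: "subspace (subgroup_algebra K)"
proof -
  have lin: "linear (\<lambda>X. lie_deriv X f \<one>)" if "f \<in> quotient_funs K" for f
    using that by (intro linear_lie_deriv) (simp add: quotient_funs_def)
  show ?thesis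
    by (intro subspaceI)
      (simp_all add: subgroup_algebra_iff linear_0[OF lin] linear_add[OF lin] linear_cmul[OF lin])
qed

lemma Ad_subgroup_algebra:
  assumes "s \<in> K" "X \<in> subgroup_algebra K" shows "Ad s X \<in> subgroup_algebra K"
  using assms HK.mult_K HK.inv_K by (simp add: subgroup_algebra_def lie_exp_Ad)

lemma Ad_complement:
  assumes "s \<in> K" "X \<in> complement K" shows "Ad s X \<in> complement K"
  unfolding complement_def
proof safe
  fix Y assume Y: "Y \<in> subgroup_algebra K"
  have "Kil (Ad s X) Y = Kil X (Ad (inv s) Y)"
    using Kil_Ad[of s X "Ad (inv s) Y"] by simp
  then show "Kil (Ad s X) Y = 0"
    using assms(2) Ad_subgroup_algebra[OF HK.inv_K[OF assms(1)] Y] by (simp add: complement_def)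
qed

lemma subspace_complement: "subspace (complement K)"
  by (rule subspaceI) (auto simp: complement_def Kil.add_left Kil.scaleR_left Kil.zero_left)

lemma complement_Int: "X \<in> complement K \<Longrightarrow> X \<in> subgroup_algebra K \<Longrightarrow> X = 0"
  using Kil.eq_0_iff by (auto simp: complement_def)

lemma proj_eqI: "Y \<in> complement K \<Longrightarrow> X - Y \<in> subgroup_algebra K \<Longrightarrow> proj K X = Y"
  unfolding proj_def
proof (rule the_equality)
  fix Z assume Y: "Y \<in> complement K" "X - Y \<in> subgroup_algebra K"
    and Z: "Z \<in> complement K \<and> X - Z \<in> subgroup_algebra K"
  have "Z - Y \<in> complement K" using Y Z subspace_complement by (blast intro: subspace_diff)
  moreover have "(X - Y) - (X - Z) \<in> subgroup_algebra K"
    using Y Z subspace_subgroup_algebra by (blast intro: subspace_diff)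
  ultimately have "Z - Y = 0" by (intro complement_Int) simp_all
  then show "Z = Y" by simp
qed simp

text \<open>Subtracting the \<open>Kil\<close>-orthogonal projection onto the algebra of
  \<open>K\<close> gives a decomposition of X, which \<open>proj_eqI\<close> identifies with the
  definite description.\<close>

lemma proj_props: "proj K X \<in> complement K" "X - proj K X \<in> subgroup_algebra K"
proof -
  obtain E where E: "E \<subseteq> subgroup_algebra K" "Kil.orthonormal E"
    "\<And>x. x \<in> subgroup_algebra K \<Longrightarrow> x = (\<Sum>e\<in>E. Kil x e *\<^sub>R e)"
    using Kil.orthonormal_basis_exists[OF subspace_subgroup_algebra] by blast
  define Y where "Y = (\<Sum>e\<in>E. Kil X e *\<^sub>R e)"
  have Y: "Y \<in> subgroup_algebra K" unfolding Y_def
    using E(1) by (intro subspace_sum subspace_scale subspace_subgroup_algebra) auto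
  have orth: "Kil (X - Y) Z = 0" if Z: "Z \<in> subgroup_algebra K" for Z
  proof -
    have 0: "Kil (X - Y) e = 0" if "e \<in> E" for e
      using Kil.orthonormal_sum[OF E(2) that, of "Kil X"] by (simp add: Y_def Kil.diff_left)
    have "Kil (X - Y) Z = Kil Z (X - Y)" by (rule Kil_sym)
    also have "\<dots> = (\<Sum>e\<in>E. Kil Z e * Kil e (X - Y))"
      using arg_cong[OF E(3)[OF Z], of "\<lambda>Z. Kil Z (X - Y)"] by (simp add: Kil.sum_left Kil.scaleR_left)
    also have "\<dots> = 0" using 0 by (simp add: Kil_sym[of _ "X - Y"])
    finally show ?thesis .
  qed
  have "proj K X = X - Y" using Y orth by (intro proj_eqI) (simp_all add: complement_def)
  then show "proj K X \<in> complement K" "X - proj K X \<in> subgroup_algebra K"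
    using Y orth by (simp_all add: complement_def)
qed

lemma proj_complement: "X \<in> complement K \<Longrightarrow> proj K X = X"
  using subspace_0[OF subspace_subgroup_algebra] by (intro proj_eqI) simp_all

lemma linear_proj: "linear (proj K)"
proof (rule linearI)
  note c = subspace_add[OF subspace_complement] subspace_scale[OF subspace_complement] proj_props
  fix X Y :: 'e and r :: real
  have "X + Y - (proj K X + proj K Y) = (X - proj K X) + (Y - proj K Y)" by simp
  then have "X + Y - (proj K X + proj K Y) \<in> subgroup_algebra K"
    using subspace_add[OF subspace_subgroup_algebra proj_props(2) proj_props(2), of X Y] by (simp only:)
  then show "proj K (X + Y) = proj K X + proj K Y" by (intro proj_eqI c)
  have "r *\<^sub>R X - r *\<^sub>R proj K X = r *\<^sub>R (X - proj K X)" by (simp add: scaleR_diff_right)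
  then have "r *\<^sub>R X - r *\<^sub>R proj K X \<in> subgroup_algebra K"
    using subspace_scale[OF subspace_subgroup_algebra proj_props(2), of r X] by (simp only:)
  then show "proj K (r *\<^sub>R X) = r *\<^sub>R proj K X" by (intro proj_eqI c)
qed

lemma Ad_proj: "s \<in> K \<Longrightarrow> Ad s (proj K X) = proj K (Ad s X)"
  using Ad_subgroup_algebra[OF _ proj_props(2), of s X]
  by (intro proj_eqI[symmetric] Ad_complement proj_props) (simp_all add: linear_diff[OF linear_Ad])

lemma Kil_proj: "Z \<in> complement K \<Longrightarrow> Kil (proj K X) Z = Kil X Z"
  using proj_props(2)[of X] Kil_sym[of "X - proj K X" Z] Kil.diff_left[of X "proj K X" Z]
  by (simp add: complement_def)

end

section \<open>The Levi-Civita connection\<close>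

context lie_group begin

lemma lie_deriv_sum:
  fixes f :: "'i \<Rightarrow> 'g \<Rightarrow> 'b::euclidean_space"
  assumes "finite I" "\<And>i. i \<in> I \<Longrightarrow> smooth_fun (f i)"
  shows "lie_deriv X (\<lambda>x. \<Sum>i\<in>I. f i x) x = (\<Sum>i\<in>I. lie_deriv X (f i) x)"
  by (rule lie_derivI[OF has_vector_derivative_sum])
    (use assms lie_deriv_has_vector_derivative_0 in blast)

lemma lie_deriv_Basis:
  fixes f :: "'g \<Rightarrow> 'b::euclidean_space"
  assumes "smooth_fun f"
  shows "lie_deriv X f x = (\<Sum>b\<in>Basis. (X \<bullet> b) *\<^sub>R lie_deriv b f x)"
  using linear_sum[OF linear_lie_deriv[OF assms, of x], of "\<lambda>b. (X \<bullet> b) *\<^sub>R b" Basis]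
  by (simp add: euclidean_representation linear_cmul[OF linear_lie_deriv[OF assms]])

lemma smooth_fun_coord: "smooth_fun W \<Longrightarrow> smooth_fun (\<lambda>x. W x \<bullet> b)"
  for W :: "'g \<Rightarrow> 'b::euclidean_space"
  by (rule smooth_fun_linear[of "\<lambda>v. v \<bullet> b" W]) (auto intro: bounded_linear.linear bounded_linear_inner_left)

lemma smooth_fun_lie_deriv_field:
  fixes f :: "'g \<Rightarrow> 'b::euclidean_space"
  assumes W: "smooth_fun W" and f: "smooth_fun f"
  shows "smooth_fun (\<lambda>x. lie_deriv (W x) f x)"
  unfolding lie_deriv_Basis[OF f, of "W _"]
  by (intro smooth_fun_sum smooth_fun_bilinear[OF bounded_bilinear_scaleR] smooth_fun_coord
      smooth_fun_lie_deriv W f)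

text \<open>In coordinates of W the product rule leaves a second derivative with W x frozen and a
  first-order term from the coefficients; for X = V x the latter is the derivation along the
  canonical derivative of W.\<close>

lemma lie_deriv_lie_deriv_field:
  fixes f :: "'g \<Rightarrow> 'b::euclidean_space"
  assumes W: "smooth_fun W" and f: "smooth_fun f"
  shows "lie_deriv X (\<lambda>y. lie_deriv (W y) f y) x =
    lie_deriv X (lie_deriv (W x) f) x + lie_deriv (lie_deriv X W x) f x"
proof -
  let ?c = "\<lambda>b y. (W y \<bullet> b) *\<^sub>R lie_deriv b f y"
  have sc: "smooth_fun (?c b)" for b
    by (intro smooth_fun_bilinear[OF bounded_bilinear_scaleR] smooth_fun_coord smooth_fun_lie_deriv W f)
  have lc: "lie_deriv X (\<lambda>y. W y \<bullet> b) x = lie_deriv X W x \<bullet> b" for b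
    by (rule lie_deriv_linear[OF _ W, of "\<lambda>v. v \<bullet> b"]) (auto intro: bounded_linear.linear bounded_linear_inner_left)
  have "lie_deriv X (\<lambda>y. lie_deriv (W y) f y) x = lie_deriv X (\<lambda>y. \<Sum>b\<in>Basis. ?c b y) x"
    unfolding lie_deriv_Basis[OF f, of "W _"] ..
  also have "\<dots> = (\<Sum>b\<in>Basis. lie_deriv X (?c b) x)"
    by (rule lie_deriv_sum) (use sc in auto)
  also have "\<dots> = (\<Sum>b\<in>Basis. (W x \<bullet> b) *\<^sub>R lie_deriv X (lie_deriv b f) x + (lie_deriv X W x \<bullet> b) *\<^sub>R lie_deriv b f x)"
    by (intro sum.cong refl)
      (simp add: lie_deriv_bilinear[OF bounded_bilinear_scaleR smooth_fun_coord[OF W] smooth_fun_lie_deriv[OF f]] lc)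
  also have "\<dots> = (\<Sum>b\<in>Basis. (W x \<bullet> b) *\<^sub>R lie_deriv X (lie_deriv b f) x) + lie_deriv (lie_deriv X W x) f x"
    by (simp add: sum.distrib lie_deriv_Basis[OF f, of "lie_deriv X W x"])
  also have "(\<Sum>b\<in>Basis. (W x \<bullet> b) *\<^sub>R lie_deriv X (lie_deriv b f) x) = lie_deriv X (lie_deriv (W x) f) x"
  proof -
    have "lie_deriv X (lie_deriv (W x) f) x = lie_deriv X (\<lambda>y. \<Sum>b\<in>Basis. (W x \<bullet> b) *\<^sub>R lie_deriv b f y) x"
      using lie_deriv_Basis[OF f, of "W x"] by presburger
    also have "\<dots> = (\<Sum>b\<in>Basis. lie_deriv X (\<lambda>y. (W x \<bullet> b) *\<^sub>R lie_deriv b f y) x)"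
      by (rule lie_deriv_sum) (auto intro!: smooth_fun_linear[OF linear_scaleR] smooth_fun_lie_deriv f)
    also have "\<dots> = (\<Sum>b\<in>Basis. (W x \<bullet> b) *\<^sub>R lie_deriv X (lie_deriv b f) x)"
      by (intro sum.cong refl lie_deriv_linear[OF linear_scaleR] smooth_fun_lie_deriv f)
    finally show ?thesis by simp
  qed
  finally show ?thesis .
qed

lemma derivation_eq: "smooth_fun f \<Longrightarrow> derivation V f x = lie_deriv (V x) f x"
  unfolding derivation_def
  by (intro DERIV_imp_deriv)
    (simp add: has_real_derivative_iff_has_vector_derivative lie_deriv_has_vector_derivative_0)

lemma nabla_c_eq: "nabla_c V W x = lie_deriv (V x) W x"
  by (simp add: nabla_c_def lie_deriv_def)

end

context compact_semisimple_pair begin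

section \<open>Vector fields on G/K and their bracket\<close>

lemma vector_fieldsD:
  assumes "V \<in> vector_fields K"
  shows "smooth_fun V" "V x \<in> complement K" "s \<in> K \<Longrightarrow> V (x \<otimes> s) = Ad (inv s) (V x)"
  using assms by (auto simp: vector_fields_def)

lemma quotient_funsD:
  assumes "f \<in> quotient_funs K"
  shows "smooth_fun f" "s \<in> K \<Longrightarrow> f (x \<otimes> s) = f x"
  using assms by (auto simp: quotient_funs_def)

lemma vector_fields_add:
  assumes "V \<in> vector_fields K" "W \<in> vector_fields K" shows "(\<lambda>x. V x + W x) \<in> vector_fields K"
  using vector_fieldsD[OF assms(1)] vector_fieldsD[OF assms(2)] subspace_add[OF subspace_complement]
  by (auto simp: vector_fields_def linear_add[OF linear_Ad] intro!: smooth_fun_add)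

lemma vector_fields_diff:
  assumes "V \<in> vector_fields K" "W \<in> vector_fields K" shows "(\<lambda>x. V x - W x) \<in> vector_fields K"
  using vector_fieldsD[OF assms(1)] vector_fieldsD[OF assms(2)] subspace_diff[OF subspace_complement]
  by (auto simp: vector_fields_def linear_diff[OF linear_Ad] intro!: smooth_fun_diff)

lemma vector_fields_scale:
  assumes "f \<in> quotient_funs K" "V \<in> vector_fields K" shows "(\<lambda>x. f x *\<^sub>R V x) \<in> vector_fields K"
  using quotient_funsD[OF assms(1)] vector_fieldsD[OF assms(2)] subspace_scale[OF subspace_complement]
  by (auto simp: vector_fields_def linear_cmul[OF linear_Ad]
      intro!: smooth_fun_bilinear[OF bounded_bilinear_scaleR])

lemma vector_fields_bilinear:
  assumes V: "V \<in> vector_fields K" and W: "W \<in> vector_fields K"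
    and B: "bounded_bilinear B"
    and m: "\<And>X Y. X \<in> complement K \<Longrightarrow> Y \<in> complement K \<Longrightarrow> B X Y \<in> complement K"
    and Ad: "\<And>s X Y. s \<in> K \<Longrightarrow> X \<in> complement K \<Longrightarrow> Y \<in> complement K \<Longrightarrow> B (Ad s X) (Ad s Y) = Ad s (B X Y)"
  shows "(\<lambda>x. B (V x) (W x)) \<in> vector_fields K"
  using vector_fieldsD[OF V] vector_fieldsD[OF W] m Ad HK.inv_K
  by (simp add: vector_fields_def smooth_fun_bilinear[OF B])

text \<open>Values stay in the complement because the linear map \<open>proj K\<close> fixes W and
  commutes with differentiation. Equivariance combines right translation of the derivative with
  linearity of \<open>Ad\<close>.\<close>

lemma nabla_c_vector_fields:
  assumes V: "V \<in> vector_fields K" and W: "W \<in> vector_fields K"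
  shows "(\<lambda>x. lie_deriv (V x) W x) \<in> vector_fields K"
  unfolding vector_fields_def mem_Collect_eq
proof (intro conjI allI ballI)
  note W' = vector_fieldsD[OF W]
  show "smooth_fun (\<lambda>x. lie_deriv (V x) W x)"
    by (rule smooth_fun_lie_deriv_field[OF vector_fieldsD(1)[OF V] W'(1)])
  fix x
  have "(\<lambda>y. proj K (W y)) = W" using W'(2) proj_complement by (intro ext) blast
  then have "proj K (lie_deriv (V x) W x) = lie_deriv (V x) W x"
    using lie_deriv_linear[OF linear_proj W'(1), of "V x" x] by simp
  then show "lie_deriv (V x) W x \<in> complement K" using proj_props(1) by metis
  fix s assume s: "s \<in> K"
  have "lie_deriv (V (x \<otimes> s)) W (x \<otimes> s) = lie_deriv (V x) (\<lambda>y. W (y \<otimes> s)) x"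
    using lie_deriv_mult_Ad[of "V (x \<otimes> s)" W x s] vector_fieldsD(3)[OF V s, of x] by simp
  also have "(\<lambda>y. W (y \<otimes> s)) = (\<lambda>y. Ad (inv s) (W y))" using W'(3)[OF s] by (intro ext)
  also have "lie_deriv (V x) \<dots> x = Ad (inv s) (lie_deriv (V x) W x)"
    by (rule lie_deriv_linear[OF linear_Ad W'(1)])
  finally show "lie_deriv (V (x \<otimes> s)) W (x \<otimes> s) = Ad (inv s) (lie_deriv (V x) W x)" .
qed

lemma bounded_bilinear_proj_bracket: "bounded_bilinear (\<lambda>X Y. proj K (lie_bracket X Y))"
proof -
  have "bilinear (\<lambda>X Y. proj K (lie_bracket X Y))"
    unfolding bilinear_def
    by (intro conjI allI linearI)
      (simp_all add: lie_bracket_add_left lie_bracket_add_right lie_bracket_scaleR_left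
        lie_bracket_scaleR_right linear_add[OF linear_proj] linear_cmul[OF linear_proj])
  then show ?thesis by (simp add: bilinear_conv_bounded_bilinear)
qed

text \<open>The difference at x, moved to the identity by left translation of the test functions,
  lies in the algebra of \<open>K\<close>; it also lies in the complement, and the two meet only in
  0.\<close>

lemma vector_fields_eqI:
  assumes U: "U \<in> vector_fields K" "U' \<in> vector_fields K"
    and eq: "\<And>f. f \<in> quotient_funs K \<Longrightarrow> lie_deriv (U x) f x = lie_deriv (U' x) f x"
  shows "U x = U' x"
proof -
  have "U x - U' x \<in> subgroup_algebra K"
    unfolding subgroup_algebra_iff
  proof
    fix f assume f: "f \<in> quotient_funs K"
    have "lie_deriv (U x - U' x) f \<one> = lie_deriv (U x - U' x) (\<lambda>y. f (inv x \<otimes> y)) x"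
      by (simp add: lie_deriv_left)
    also have "\<dots> = 0"
      using eq[OF quotient_funs_left[OF f, of "inv x"]] quotient_funsD(1)[OF quotient_funs_left[OF f, of "inv x"]]
      by (simp add: linear_diff[OF linear_lie_deriv])
    finally show "lie_deriv (U x - U' x) f \<one> = 0" .
  qed
  moreover have "U x - U' x \<in> complement K"
    using vector_fieldsD(2)[OF U(1)] vector_fieldsD(2)[OF U(2)] by (rule subspace_diff[OF subspace_complement])
  ultimately have "U x - U' x = 0" by (intro complement_Int)
  then show ?thesis by simp
qed

text \<open>\<open>comm\<close> gives existence for the definite description and
  \<open>vector_fields_eqI\<close> uniqueness; the first-order terms of the iterated derivations are
  the two canonical derivatives.\<close>

lemma field_bracket_eq:
  assumes V: "V \<in> vector_fields K" and W: "W \<in> vector_fields K"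
  shows "field_bracket K V W =
    (\<lambda>x. lie_deriv (V x) W x - lie_deriv (W x) V x + proj K (lie_bracket (V x) (W x)))"
    (is "_ = ?U")
proof -
  have U: "?U \<in> vector_fields K"
    by (intro vector_fields_add vector_fields_diff nabla_c_vector_fields V W
        vector_fields_bilinear[OF V W bounded_bilinear_proj_bracket])
      (simp_all add: proj_props Ad_proj Ad_lie_bracket)
  have comm: "derivation ?U f x = derivation V (derivation W f) x - derivation W (derivation V f) x"
    if f: "f \<in> quotient_funs K" for f x
  proof -
    note sf = quotient_funsD(1)[OF f]
    have 1: "derivation V (derivation W f) x =
        lie_deriv (V x) (lie_deriv (W x) f) x + lie_deriv (lie_deriv (V x) W x) f x"
      if "V \<in> vector_fields K" "W \<in> vector_fields K" for V W
    proof -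
      have "derivation W f = (\<lambda>y. lie_deriv (W y) f y)"
        by (intro ext derivation_eq[OF sf])
      then show ?thesis
        using derivation_eq[OF smooth_fun_lie_deriv_field[OF vector_fieldsD(1)[OF that(2)] sf], of V x]
          lie_deriv_lie_deriv_field[OF vector_fieldsD(1)[OF that(2)] sf, of "V x" x] by simp
    qed
    let ?b = "lie_bracket (V x) (W x)"
    have "lie_deriv ?b f x = lie_deriv (proj K ?b) f x"
      using lie_deriv_subgroup_algebra[OF proj_props(2) f, of ?b x]
      by (simp add: linear_diff[OF linear_lie_deriv[OF sf]])
    then show ?thesis
      unfolding 1[OF V W] 1[OF W V] derivation_eq[OF sf]
      by (simp add: linear_diff[OF linear_lie_deriv[OF sf]] linear_add[OF linear_lie_deriv[OF sf]]
          lie_bracket_unique(2)[OF sf])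
  qed
  show ?thesis
    unfolding field_bracket_def
  proof (rule the_equality)
    show "?U \<in> vector_fields K \<and> (\<forall>f\<in>quotient_funs K. \<forall>x.
        derivation ?U f x = derivation V (derivation W f) x - derivation W (derivation V f) x)"
      using U comm by blast
    fix U' assume U': "U' \<in> vector_fields K \<and> (\<forall>f\<in>quotient_funs K. \<forall>x.
        derivation U' f x = derivation V (derivation W f) x - derivation W (derivation V f) x)"
    show "U' = ?U"
    proof
      fix x
      have U'vf: "U' \<in> vector_fields K" using U' by blast
      show "U' x = ?U x"
      proof (rule vector_fields_eqI[OF U'vf U])
        fix f assume f: "f \<in> quotient_funs K"
        have "derivation U' f x = derivation ?U f x" using U' comm[OF f, of x] f by simp
        then show "lie_deriv (U' x) f x = lie_deriv (?U x) f x"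
          by (simp add: derivation_eq[OF quotient_funsD(1)[OF f]])
      qed
    qed
  qed
qed

lemma Kil_bracket_swap: "Kil (lie_bracket X Y) Z = - Kil (lie_bracket X Z) Y"
  using lie_bracket_antisym[of Y Z] Kil.scaleR_right[of X "- 1" "lie_bracket Z Y"]
  by (simp add: Kil_ad)

lemma levi_civita_metric:
  assumes "levi_civita K g D" "V \<in> vector_fields K" "W \<in> vector_fields K" "Z \<in> vector_fields K"
  shows "derivation V (\<lambda>y. g (W y) (Z y)) x = g (D V W x) (Z x) + g (W x) (D V Z x)"
  using assms by (simp add: levi_civita_def metric_compatible_def)

text \<open>The Levi-Civita conditions evaluate a connection on vector fields, their sums and their
  function multiples only, so values elsewhere may differ.\<close>

lemma levi_civita_cong:
  assumes eq: "\<And>V W x. V \<in> vector_fields K \<Longrightarrow> W \<in> vector_fields K \<Longrightarrow> D V W x = D' V W x"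
    and D: "levi_civita K g D"
  shows "levi_civita K g D'"
proof -
  have fe: "D V W = D' V W" if "V \<in> vector_fields K" "W \<in> vector_fields K" for V W
    using eq[OF that] by (intro ext)
  show ?thesis
    using D unfolding levi_civita_def connection_def torsion_free_def metric_compatible_def
    by (simp add: fe vector_fields_add vector_fields_scale)
qed

end

text \<open>The operator S enters through its relation to g0; linearity, bijectivity and commutation
  with \<open>Ad\<close> are derived from that relation below.\<close>

locale invariant_metric = compact_semisimple_pair G A K
  for G :: "'g::{second_countable_topology, t2_space} monoid" (structure)
    and A :: "('g, 'e::euclidean_space) chart set" and K :: "'g set" +
  fixes g0 :: "'e \<Rightarrow> 'e \<Rightarrow> real" and S :: "'e \<Rightarrow> 'e"
  assumes inner_g0: "inner_product_on (complement K) g0"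
    and g0_Ad: "s \<in> K \<Longrightarrow> X \<in> complement K \<Longrightarrow> Y \<in> complement K \<Longrightarrow> g0 (Ad s X) (Ad s Y) = g0 X Y"
    and S_in: "X \<in> complement K \<Longrightarrow> S X \<in> complement K"
    and g0_Kil: "X \<in> complement K \<Longrightarrow> Y \<in> complement K \<Longrightarrow> g0 X Y = Kil (S X) Y"
begin

section \<open>The operator S, its extension and its inverse\<close>

lemma g0_sym: "X \<in> complement K \<Longrightarrow> Y \<in> complement K \<Longrightarrow> g0 X Y = g0 Y X"
  and g0_add: "X \<in> complement K \<Longrightarrow> Y \<in> complement K \<Longrightarrow> Z \<in> complement K \<Longrightarrow> g0 (X + Y) Z = g0 X Z + g0 Y Z"
  and g0_scale: "X \<in> complement K \<Longrightarrow> Z \<in> complement K \<Longrightarrow> g0 (r *\<^sub>R X) Z = r * g0 X Z"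
  and g0_pos: "X \<in> complement K \<Longrightarrow> X \<noteq> 0 \<Longrightarrow> g0 X X > 0"
  using inner_g0 unfolding inner_product_on_def by blast+

lemma complement_eqI:
  assumes "X \<in> complement K" "Y \<in> complement K" "\<And>Z. Z \<in> complement K \<Longrightarrow> Kil X Z = Kil Y Z"
  shows "X = Y"
  using assms(3)[OF subspace_diff[OF subspace_complement assms(1,2)]] Kil.eq_0_iff[of "X - Y"]
  by (simp add: Kil.diff_left)

text \<open>\<open>S\<close> is only specified on the complement; \<open>T = SP\<close> and \<open>R = S\<inverse>P\<close> are defined everywhere.\<close>

definition T :: "'e \<Rightarrow> 'e" where "T X = S (proj K X)"

definition R :: "'e \<Rightarrow> 'e" where "R X = inv_into (complement K) S (proj K X)"

lemma T_in: "T X \<in> complement K"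
  by (simp add: T_def S_in proj_props)

lemma T_S: "X \<in> complement K \<Longrightarrow> T X = S X"
  by (simp add: T_def proj_complement)

lemma Kil_T: "Z \<in> complement K \<Longrightarrow> Kil (T X) Z = g0 (proj K X) Z"
  by (simp add: T_def g0_Kil proj_props)

lemma linear_T: "linear T"
  by (intro linearI complement_eqI T_in subspace_add[OF subspace_complement] subspace_scale[OF subspace_complement])
    (simp_all add: Kil_T Kil.add_left Kil.scaleR_left linear_add[OF linear_proj] linear_cmul[OF linear_proj]
      g0_add g0_scale proj_props)

lemma T_eq_0: "X \<in> complement K \<Longrightarrow> T X = 0 \<Longrightarrow> X = 0"
  using Kil_T[of X X] g0_pos[of X] by (auto simp: Kil.zero_left proj_complement)

text \<open>Surjectivity comes from finite dimension, applied on the whole Lie algebra to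
  \<open>T'\<close>, which is S on the complement and the identity on the algebra of
  \<open>K\<close>; it is injective because the two components can be separated.\<close>

lemma S_bij: "bij_betw S (complement K) (complement K)"
proof -
  have inj: "inj_on S (complement K)"
  proof (rule inj_onI)
    fix X Y assume XY: "X \<in> complement K" "Y \<in> complement K" "S X = S Y"
    then have "T (X - Y) = 0" by (simp add: linear_diff[OF linear_T] T_S)
    then have "X - Y = 0" by (rule T_eq_0[OF subspace_diff[OF subspace_complement XY(1,2)]])
    then show "X = Y" by simp
  qed
  define T' where "T' X = T X + (X - proj K X)" for X
  have lin: "linear T'"
    unfolding T'_def by (intro linear_compose_add linear_compose_sub linear_T linear_proj linear_ident)
  have split: "T X = Y \<and> X = proj K X" if "T' X = Y" "Y \<in> complement K" for X Y
  proof -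
    have "X - proj K X = Y - T X" using that by (auto simp: T'_def)
    moreover have "Y - T X \<in> complement K" by (intro subspace_diff[OF subspace_complement] that T_in)
    ultimately have "X - proj K X = 0" using proj_props(2)[of X] by (intro complement_Int) simp_all
    then show ?thesis using that by (simp add: T'_def)
  qed
  have "X = 0" if "T' X = 0" for X
    using split[OF that subspace_0[OF subspace_complement]] T_eq_0[of X] proj_props(1)[of X] by metis
  then have "inj T'" using linear_injective_0[OF lin] by blast
  then have "surj T'" using linear_injective_imp_surjective[OF lin] by blast
  have "Y \<in> S ` complement K" if Y: "Y \<in> complement K" for Y
  proof -
    obtain X where "T' X = Y" using \<open>surj T'\<close> by (metis surjD)
    from split[OF this Y] have "Y = S (proj K X)" unfolding T_def by blast
    then show ?thesis using proj_props(1) by blast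
  qed
  then show ?thesis using inj S_in by (auto simp: bij_betw_def)
qed

lemma R_in: "R X \<in> complement K"
  using bij_betw_inv_into[OF S_bij] proj_props(1)[of X] unfolding R_def bij_betw_def by blast

lemma T_R: "T (R X) = proj K X"
  using bij_betw_inv_into_right[OF S_bij proj_props(1)] R_in[of X] by (simp add: T_S) (simp add: R_def)

lemma T_inject: "X \<in> complement K \<Longrightarrow> Y \<in> complement K \<Longrightarrow> T X = T Y \<Longrightarrow> X = Y"
  using bij_betw_imp_inj_on[OF S_bij] by (simp add: T_S inj_on_def)

lemma linear_R: "linear R"
proof (rule linearI)
  show "R (X + Y) = R X + R Y" for X Y
    by (rule T_inject[OF R_in subspace_add[OF subspace_complement R_in R_in]])
      (simp add: T_R linear_add[OF linear_T] linear_add[OF linear_proj])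
  show "R (r *\<^sub>R X) = r *\<^sub>R R X" for r X
    by (rule T_inject[OF R_in subspace_scale[OF subspace_complement R_in]])
      (simp add: T_R linear_cmul[OF linear_T] linear_cmul[OF linear_proj])
qed

text \<open>Tested with \<open>Kil\<close> against the complement, both sides reduce to values of
  g0, which is invariant under \<open>K\<close>.\<close>

lemma Ad_T:
  assumes s: "s \<in> K" shows "Ad s (T X) = T (Ad s X)"
proof (rule complement_eqI[OF Ad_complement[OF s T_in] T_in])
  fix Z assume Z: "Z \<in> complement K"
  have Z': "Ad (inv s) Z \<in> complement K" by (rule Ad_complement[OF HK.inv_K[OF s] Z])
  have "Kil (Ad s (T X)) Z = Kil (T X) (Ad (inv s) Z)"
    using Kil_Ad[of s "T X" "Ad (inv s) Z"] by simp
  also have "\<dots> = g0 (Ad s (proj K X)) (Ad s (Ad (inv s) Z))"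
    by (simp only: Kil_T[OF Z'] g0_Ad[OF s proj_props(1) Z'])
  also have "\<dots> = Kil (T (Ad s X)) Z" by (simp add: Kil_T[OF Z] Ad_proj[OF s])
  finally show "Kil (Ad s (T X)) Z = Kil (T (Ad s X)) Z" .
qed

lemma Ad_R: "s \<in> K \<Longrightarrow> Ad s (R X) = R (Ad s X)"
  by (rule T_inject[OF Ad_complement[OF _ R_in] R_in]) (simp_all add: T_R Ad_proj flip: Ad_T)

text \<open>The pointwise part of the connection, with \<open>T\<close> and \<open>R\<close> in
  place of S and its inverse so that it is bilinear on the whole Lie algebra. The first half carries
  the torsion, the second is symmetric in X and Y.\<close>

definition \<Lambda> :: "'e \<Rightarrow> 'e \<Rightarrow> 'e" where
  "\<Lambda> X Y = (1/2) *\<^sub>R proj K (lie_bracket X Y) + (1/2) *\<^sub>R R (lie_bracket X (T Y) + lie_bracket Y (T X))"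

lemma bounded_bilinear_\<Lambda>: "bounded_bilinear \<Lambda>"
proof -
  have "bilinear \<Lambda>"
    unfolding bilinear_def
    by (intro conjI allI linearI)
      (simp_all add: \<Lambda>_def lie_bracket_add_left lie_bracket_add_right lie_bracket_scaleR_left
        lie_bracket_scaleR_right linear_add[OF linear_proj] linear_cmul[OF linear_proj]
        linear_add[OF linear_T] linear_cmul[OF linear_T] linear_add[OF linear_R] linear_cmul[OF linear_R]
        scaleR_add_right mult.commute)
  then show ?thesis by (simp add: bilinear_conv_bounded_bilinear)
qed

lemma \<Lambda>_in: "\<Lambda> X Y \<in> complement K"
  unfolding \<Lambda>_def
  by (intro subspace_add[OF subspace_complement] subspace_scale[OF subspace_complement] proj_props R_in)

lemma Ad_\<Lambda>: "s \<in> K \<Longrightarrow> \<Lambda> (Ad s X) (Ad s Y) = Ad s (\<Lambda> X Y)"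
  by (simp add: \<Lambda>_def linear_add[OF linear_Ad] linear_cmul[OF linear_Ad] Ad_proj Ad_R Ad_lie_bracket Ad_T)

lemma \<Lambda>_torsion: "\<Lambda> X Y - \<Lambda> Y X = proj K (lie_bracket X Y)"
proof -
  have "proj K (lie_bracket Y X) = - proj K (lie_bracket X Y)"
    using lie_bracket_antisym[of Y X] by (simp add: linear_neg[OF linear_proj])
  then show ?thesis by (simp add: \<Lambda>_def add.commute flip: scaleR_add_left)
qed

text \<open>A Koszul formula: by ad-invariance of \<open>Kil\<close> the three terms are the values
  of g0 at (P[X, Y], Z), (P[Z, X], Y) and (P[Z, Y], X).\<close>

lemma g0_\<Lambda>:
  assumes "X \<in> complement K" "Y \<in> complement K" "Z \<in> complement K"
  shows "2 * g0 (\<Lambda> X Y) Z = Kil (lie_bracket X Y) (T Z) + Kil (lie_bracket X (T Y)) Z + Kil (lie_bracket Y (T X)) Z"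
proof -
  have "Kil (T (proj K U)) Z = Kil U (T Z)" for U
  proof -
    have "Kil (T (proj K U)) Z = g0 Z (proj K U)"
      using assms(3) by (simp add: Kil_T proj_complement proj_props g0_sym)
    also have "\<dots> = Kil (T Z) (proj K U)"
      using assms(3) by (simp add: Kil_T proj_complement proj_props)
    also have "\<dots> = Kil U (T Z)" by (simp add: Kil_sym[of "T Z"] Kil_proj T_in)
    finally show ?thesis .
  qed
  moreover have "g0 (\<Lambda> X Y) Z = Kil (T (\<Lambda> X Y)) Z"
    using assms(3) by (simp add: Kil_T proj_complement \<Lambda>_in)
  ultimately show ?thesis
    using assms(3)
    by (simp add: \<Lambda>_def linear_add[OF linear_T] linear_cmul[OF linear_T] T_R Kil.add_left Kil.scaleR_left Kil_proj)
qed

text \<open>The six terms of the two Koszul formulas cancel in pairs by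
  \<open>Kil_bracket_swap\<close>; the pair containing \<open>T X\<close> also uses antisymmetry of
  the bracket.\<close>

lemma g0_\<Lambda>_skew:
  assumes "X \<in> complement K" "Y \<in> complement K" "Z \<in> complement K"
  shows "g0 (\<Lambda> X Y) Z + g0 Y (\<Lambda> X Z) = 0"
proof -
  have "Kil (lie_bracket Z (T X)) Y = - Kil (lie_bracket Y (T X)) Z"
    using Kil_bracket_swap[of Y "T X" Z] Kil_bracket_swap[of Z "T X" Y] lie_bracket_antisym[of Y Z]
      Kil.scaleR_left[of "- 1" "lie_bracket Z Y" "T X"] by simp
  then have "2 * (g0 (\<Lambda> X Y) Z + g0 (\<Lambda> X Z) Y) = 0"
    using g0_\<Lambda>[OF assms] g0_\<Lambda>[OF assms(1,3,2)] Kil_bracket_swap[of X Y "T Z"] Kil_bracket_swap[of X Z "T Y"]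
    by (simp add: algebra_simps)
  then show ?thesis using g0_sym[OF assms(2) \<Lambda>_in] by simp
qed

text \<open>The connection of the theorem written through \<Lambda>; the two agree on vector fields,
  whose values lie in the complement.\<close>

definition LC :: "('g \<Rightarrow> 'e) \<Rightarrow> ('g \<Rightarrow> 'e) \<Rightarrow> 'g \<Rightarrow> 'e" where
  "LC V W x = lie_deriv (V x) W x + \<Lambda> (V x) (W x)"

lemma nabla_ct_L_S_eq:
  assumes "V \<in> vector_fields K" "W \<in> vector_fields K"
  shows "nabla_ct K V W x + L_S K S V W x = LC V W x"
  using vector_fieldsD(2)[OF assms(1), of x] vector_fieldsD(2)[OF assms(2), of x]
  by (simp add: nabla_ct_def nabla_c_eq L_ct_def L_S_def LC_def \<Lambda>_def R_def T_S)

section \<open>The Levi-Civita conditions and uniqueness\<close>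

lemma LC_vector_fields:
  assumes "V \<in> vector_fields K" "W \<in> vector_fields K" shows "LC V W \<in> vector_fields K"
  unfolding LC_def[abs_def]
  by (intro vector_fields_add nabla_c_vector_fields vector_fields_bilinear[OF _ _ bounded_bilinear_\<Lambda>]
      assms \<Lambda>_in Ad_\<Lambda>)

lemma LC_connection: "connection K LC"
proof -
  note [simp] = bounded_bilinear.add_left[OF bounded_bilinear_\<Lambda>] bounded_bilinear.add_right[OF bounded_bilinear_\<Lambda>]
    bounded_bilinear.scaleR_left[OF bounded_bilinear_\<Lambda>] bounded_bilinear.scaleR_right[OF bounded_bilinear_\<Lambda>]
  show ?thesis
    unfolding connection_def
  proof (intro conjI ballI allI)
    fix V W assume V: "V \<in> vector_fields K" and W: "W \<in> vector_fields K"
    note sV = vector_fieldsD(1)[OF V] and sW = vector_fieldsD(1)[OF W]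
    show "LC V W \<in> vector_fields K" by (rule LC_vector_fields[OF V W])
    show "LC V (\<lambda>y. W y + W' y) x = LC V W x + LC V W' x" if "W' \<in> vector_fields K" for W' x
      by (simp add: LC_def lie_deriv_add[OF sW vector_fieldsD(1)[OF that]])
    show "LC (\<lambda>y. V y + V' y) W x = LC V W x + LC V' W x" for V' x
      by (simp add: LC_def linear_add[OF linear_lie_deriv[OF sW]])
    fix f x assume f: "f \<in> quotient_funs K"
    show "LC (\<lambda>y. f y *\<^sub>R V y) W x = f x *\<^sub>R LC V W x"
      by (simp add: LC_def linear_cmul[OF linear_lie_deriv[OF sW]] scaleR_add_right)
    show "LC V (\<lambda>y. f y *\<^sub>R W y) x = derivation V f x *\<^sub>R W x + f x *\<^sub>R LC V W x"
      by (simp add: LC_def lie_deriv_bilinear[OF bounded_bilinear_scaleR quotient_funsD(1)[OF f] sW]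
          derivation_eq[OF quotient_funsD(1)[OF f]] scaleR_add_right)
  qed
qed

text \<open>g0 is bilinear on the complement only. This form lives on the whole Lie algebra and
  agrees with g0 there, so the product rule for derivatives applies to it.\<close>

lemma bounded_bilinear_g0: "bounded_bilinear (\<lambda>X. Kil (T X))"
proof -
  have "bilinear (\<lambda>X. Kil (T X))"
    unfolding bilinear_def
    by (intro conjI allI linearI)
      (simp_all add: Kil.add_left Kil.add_right Kil.scaleR_left Kil.scaleR_right linear_add[OF linear_T]
        linear_cmul[OF linear_T])
  then show ?thesis by (simp add: bilinear_conv_bounded_bilinear)
qed

lemma g0_eq: "X \<in> complement K \<Longrightarrow> Y \<in> complement K \<Longrightarrow> g0 X Y = Kil (T X) Y"
  by (simp add: Kil_T proj_complement)

lemma LC_metric: "metric_compatible K g0 LC"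
  unfolding metric_compatible_def
proof (intro ballI allI)
  fix V W Z x assume V: "V \<in> vector_fields K" and W: "W \<in> vector_fields K" and Z: "Z \<in> vector_fields K"
  note vV = vector_fieldsD[OF V] and vW = vector_fieldsD[OF W] and vZ = vector_fieldsD[OF Z]
  note dW = vector_fieldsD(2)[OF nabla_c_vector_fields[OF V W]] and dZ = vector_fieldsD(2)[OF nabla_c_vector_fields[OF V Z]]
  have "(\<lambda>y. g0 (W y) (Z y)) = (\<lambda>y. Kil (T (W y)) (Z y))"
    by (intro ext g0_eq vW(2) vZ(2))
  then have "derivation V (\<lambda>y. g0 (W y) (Z y)) x =
      Kil (T (W x)) (lie_deriv (V x) Z x) + Kil (T (lie_deriv (V x) W x)) (Z x)"
    using derivation_eq[OF smooth_fun_bilinear[OF bounded_bilinear_g0 vW(1) vZ(1)], of V x]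
      lie_deriv_bilinear[OF bounded_bilinear_g0 vW(1) vZ(1), of "V x" x] by simp
  also have "\<dots> = g0 (W x) (lie_deriv (V x) Z x) + g0 (lie_deriv (V x) W x) (Z x)"
    by (simp add: g0_eq vW vZ dW dZ)
  also have "\<dots> = g0 (LC V W x) (Z x) + g0 (W x) (LC V Z x)"
  proof -
    have "g0 (W x) (LC V Z x) = g0 (W x) (lie_deriv (V x) Z x) + g0 (W x) (\<Lambda> (V x) (Z x))"
      using vW(2)[of x] dZ[of x] \<Lambda>_in
      by (simp add: g0_eq LC_def Kil.add_right subspace_add[OF subspace_complement])
    moreover have "g0 (LC V W x) (Z x) = g0 (lie_deriv (V x) W x) (Z x) + g0 (\<Lambda> (V x) (W x)) (Z x)"
      using vZ(2)[of x] dW[of x] \<Lambda>_in by (simp add: LC_def g0_add)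
    ultimately show ?thesis using g0_\<Lambda>_skew[OF vV(2) vW(2) vZ(2), of x x x] by simp
  qed
  finally show "derivation V (\<lambda>y. g0 (W y) (Z y)) x = g0 (LC V W x) (Z x) + g0 (W x) (LC V Z x)" .
qed

lemma LC_torsion_free: "torsion_free K LC"
  unfolding torsion_free_def
proof (intro ballI allI)
  fix V W x assume V: "V \<in> vector_fields K" and W: "W \<in> vector_fields K"
  show "LC V W x - LC W V x = field_bracket K V W x"
    unfolding field_bracket_eq[OF V W] \<Lambda>_torsion[symmetric] LC_def by simp
qed

lemma LC_levi_civita: "levi_civita K g0 LC"
  by (simp add: levi_civita_def LC_connection LC_metric LC_torsion_free)

text \<open>Three skew and three symmetric exchanges return to the initial expression with the
  opposite sign. The test field Z is \<open>B V W\<close> itself, so no tangent vector has to be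
  extended to a field.\<close>

lemma levi_civita_unique:
  assumes D: "levi_civita K g0 D" and D': "levi_civita K g0 D'"
    and V: "V \<in> vector_fields K" and W: "W \<in> vector_fields K"
  shows "D V W x = D' V W x"
proof -
  let ?F = "vector_fields K"
  define B where "B V W x = D V W x - D' V W x" for V W x
  have DF: "D V W \<in> ?F" "D' V W \<in> ?F" if "V \<in> ?F" "W \<in> ?F" for V W
    using D D' that by (auto simp: levi_civita_def connection_def)
  have BF: "B V W \<in> ?F" if "V \<in> ?F" "W \<in> ?F" for V W
    unfolding B_def[abs_def] by (intro vector_fields_diff DF that)
  have B_sym: "B V W x = B W V x" if "V \<in> ?F" "W \<in> ?F" for V W x
  proof -
    have "D V W x - D W V x = D' V W x - D' W V x"
      using D D' that by (simp add: levi_civita_def torsion_free_def)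
    then show ?thesis by (simp add: B_def algebra_simps)
  qed
  have B_skew: "g0 (B V W x) (Z x) = - g0 (B V Z x) (W x)" if "V \<in> ?F" "W \<in> ?F" "Z \<in> ?F" for V W Z x
  proof -
    have "g0 (D V W x) (Z x) + g0 (W x) (D V Z x) = g0 (D' V W x) (Z x) + g0 (W x) (D' V Z x)"
      using levi_civita_metric[OF D that, of x] levi_civita_metric[OF D' that, of x] by simp
    moreover have "g0 (B V W x) (Z x) = g0 (D V W x) (Z x) - g0 (D' V W x) (Z x)"
      using vector_fieldsD(2)[OF that(3)] vector_fieldsD(2)[OF DF(1)[OF that(1,2)]] vector_fieldsD(2)[OF DF(2)[OF that(1,2)]]
      by (simp add: B_def g0_eq subspace_diff[OF subspace_complement] linear_diff[OF linear_T] Kil.diff_left)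
    moreover have "g0 (W x) (B V Z x) = g0 (W x) (D V Z x) - g0 (W x) (D' V Z x)"
      using vector_fieldsD(2)[OF that(2)] vector_fieldsD(2)[OF DF(1)[OF that(1,3)]] vector_fieldsD(2)[OF DF(2)[OF that(1,3)]]
      by (simp add: B_def g0_eq subspace_diff[OF subspace_complement] Kil.diff_right)
    moreover have "g0 (W x) (B V Z x) = g0 (B V Z x) (W x)"
      by (rule g0_sym[OF vector_fieldsD(2)[OF that(2)] vector_fieldsD(2)[OF BF[OF that(1,3)]]])
    ultimately show ?thesis by simp
  qed
  define Z where "Z = B V W"
  have Z: "Z \<in> ?F" unfolding Z_def by (rule BF[OF V W])
  have "g0 (B V W x) (Z x) = - g0 (B V Z x) (W x)" by (rule B_skew[OF V W Z])
  also have "\<dots> = - g0 (B Z V x) (W x)" by (simp only: B_sym[OF V Z])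
  also have "\<dots> = g0 (B Z W x) (V x)" using B_skew[OF Z V W, of x] by simp
  also have "\<dots> = g0 (B W Z x) (V x)" by (simp only: B_sym[OF Z W])
  also have "\<dots> = - g0 (B W V x) (Z x)" by (rule B_skew[OF W Z V])
  also have "\<dots> = - g0 (B V W x) (Z x)" by (simp only: B_sym[OF W V])
  finally have "g0 (B V W x) (B V W x) = 0" by (simp add: Z_def)
  then have "B V W x = 0"
    using g0_pos[OF vector_fieldsD(2)[OF BF[OF V W]], of x] by (cases "B V W x = 0") auto
  then show ?thesis by (simp add: B_def)
qed

end

text \<open>The values of \<open>nabla0\<close> off the vector fields are unconstrained, so equality
  of connections means equality on vector fields. One direction is uniqueness, the other says that
  the explicit formula is a Levi-Civita connection.\<close>

theorem theorem2p5:
  fixes G :: "'g::{second_countable_topology, t2_space} monoid"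
    and A :: "('g, 'e::euclidean_space) chart set"
    and K :: "'g set"
    and g0 :: "'e \<Rightarrow> 'e \<Rightarrow> real"
    and S :: "'e \<Rightarrow> 'e"
    and nabla0 :: "('g \<Rightarrow> 'e) \<Rightarrow> ('g \<Rightarrow> 'e) \<Rightarrow> 'g \<Rightarrow> 'e"
  assumes "lie_group G A"
    and "connected (UNIV :: 'g set)"
    and "compact (UNIV :: 'g set)"
    and "lie_group.semisimple G A"
    and "subgroup K G"
    and "closed K"
    and "inner_product_on (lie_group.complement G A K) g0"
    and "\<And>s X Y. s \<in> K \<Longrightarrow> X \<in> lie_group.complement G A K \<Longrightarrow> Y \<in> lie_group.complement G A K \<Longrightarrow>
           g0 (lie_group.Ad G A s X) (lie_group.Ad G A s Y) = g0 X Y"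
    and "\<And>X. X \<in> lie_group.complement G A K \<Longrightarrow> S X \<in> lie_group.complement G A K"
    and "\<And>X Y. X \<in> lie_group.complement G A K \<Longrightarrow> Y \<in> lie_group.complement G A K \<Longrightarrow>
           g0 X Y = lie_group.Kil G A (S X) Y"
  shows "lie_group.levi_civita G A K g0 nabla0 \<longleftrightarrow>
    (\<forall>V \<in> lie_group.vector_fields G A K. \<forall>W \<in> lie_group.vector_fields G A K. \<forall>x.
       nabla0 V W x = lie_group.nabla_ct G A K V W x + lie_group.L_S G A K S V W x)"
proof -
  interpret invariant_metric G A K g0 S
    by (rule invariant_metric.intro[OF
          compact_semisimple_pair.intro[OF assms(1) compact_semisimple_pair_axioms.intro[OF assms(3-6)]]
          invariant_metric_axioms.intro[OF assms(7-10)]])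
  show ?thesis
  proof
    assume "levi_civita K g0 nabla0"
    then show "\<forall>V\<in>vector_fields K. \<forall>W\<in>vector_fields K. \<forall>x. nabla0 V W x = nabla_ct K V W x + L_S K S V W x"
      using levi_civita_unique[OF _ LC_levi_civita] nabla_ct_L_S_eq by simp
  next
    assume *: "\<forall>V\<in>vector_fields K. \<forall>W\<in>vector_fields K. \<forall>x. nabla0 V W x = nabla_ct K V W x + L_S K S V W x"
    show "levi_civita K g0 nabla0"
      by (rule levi_civita_cong[OF _ LC_levi_civita]) (use * nabla_ct_L_S_eq in simp)
  qed
qed

end
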